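(* Let $p\in\mathbb C[z,w]$ be a distinguished homogeneous polynomial, let $B_1,B_2$ be nonconstant finite Blaschke products, and set $p_B(z,w)=p(B_1(z),B_2(w))$. If $\mathcal M$ is a finitely generated submodule of $H^2(\mathbb D^2)$ containing $p_B$, then: (1) both $S_{z,\mathcal M^\perp}$ and $S_{w,\mathcal M^\perp}$ are $(1,\infty)$-essentially unitary, and $\mathcal M$ is Hilbert–Schmidt; (2) the quotient module $\mathcal M^\perp$ is $(1,\infty)$-essentially normal.
   Context: $H^2(\mathbb D^2)$ is the Hardy space of the bidisc, a Hilbert module over $\mathbb C[z,w]$. Submodules are closed subspaces invariant under multiplication by polynomials; $\mathcal M$ is finitely generated if it is the smallest submodule containing finitely many functions. On a submodule, $R_f=M_f|_{\mathcal M}$; on a quotient module $\mathcal N$, $S_{f,\mathcal N}=P_{\mathcal N}M_f|_{\mathcal N}$. The core operator is $C_{\mathcal M}=\mathrm{Id}_{\mathcal M}-R_zR_z^*-R_wR_w^*+R_{zw}R_{zw}^*$; $\mathcal M$ is Hilbert–Schmidt if $C_{\mathcal M}$ is Hilbert–Schmidt. The Macaev ideal $\mathfrak L^{(1,\infty)}$ consists of compact operators with singular values $\lambda_1\ge\lambda_2\ge\cdots$ satisfying $\sup_n\frac1{\ln(n+1)}\sum_{k=1}^n\lambda_k<\infty$. An operator $A$ is $(1,\infty)$-essentially unitary if $\mathrm{Id}-A^*A$ and $\mathrm{Id}-AA^*$ lie in $\mathfrak L^{(1,\infty)}$; a quotient module is $(1,\infty)$-essentially normal if $[S_f^*,S_g]\in\mathfrak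 L^{(1,\infty)}$ for all polynomials $f,g$. A polynomial $p$ is distinguished if the ideal it generates is distinguished, i.e. $\partial(Z(p)\cap\mathbb D^2)\subset\mathbb T^2$. *)

theory Defs
  imports "HOL-Analysis.Analysis" "HOL-Library.Function_Algebras"
begin

text \<open>Elements of the Hardy space of the bidisc are represented by their Taylor
coefficient functions (m,n) \<mapsto> a_{m,n}; H^2(D^2) is the set of square-summable ones.\<close>

type_synonym coef = "nat \<times> nat \<Rightarrow> complex"

definition H2 :: "coef set" where
  "H2 = {f. (\<lambda>k. (cmod (f k))\<^sup>2) summable_on UNIV}"

definition h2inner :: "coef \<Rightarrow> coef \<Rightarrow> complex" where
  "h2inner f g = infsum (\<lambda>k. f k * cnj (g k)) UNIV"

definition h2norm :: "coef \<Rightarrow> real" where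
  "h2norm f = sqrt (infsum (\<lambda>k. (cmod (f k))\<^sup>2) UNIV)"

definition poly2 :: "coef set" where
  "poly2 = {p. finite {k. p k \<noteq> 0}}"

definition peval :: "coef \<Rightarrow> complex \<Rightarrow> complex \<Rightarrow> complex" where
  "peval p z w = (\<Sum>k\<in>{k. p k \<noteq> 0}. p k * z ^ fst k * w ^ snd k)"

definition homogeneous2 :: "coef \<Rightarrow> bool" where
  "homogeneous2 p \<longleftrightarrow> (\<exists>d. \<forall>i j. p (i, j) \<noteq> 0 \<longrightarrow> i + j = d)"

definition bidisc :: "(complex \<times> complex) set" where
  "bidisc = {(z, w). cmod z < 1 \<and> cmod w < 1}"

definition torus2 :: "(complex \<times> complex) set" where
  "torus2 = {(z, w). cmod z = 1 \<and> cmod w = 1}"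

definition zeroset2 :: "coef \<Rightarrow> (complex \<times> complex) set" where
  "zeroset2 p = {(z, w). peval p z w = 0}"

definition distinguished :: "coef \<Rightarrow> bool" where
  "distinguished p \<longleftrightarrow> closure (zeroset2 p \<inter> bidisc) - bidisc \<subseteq> torus2"

definition pmul :: "coef \<Rightarrow> coef \<Rightarrow> coef" where
  "pmul p f = (\<lambda>(m, n). \<Sum>i\<le>m. \<Sum>j\<le>n. p (i, j) * f (m - i, n - j))"

definition mono_z :: coef where "mono_z = (\<lambda>k. if k = (1, 0) then 1 else 0)"
definition mono_w :: coef where "mono_w = (\<lambda>k. if k = (0, 1) then 1 else 0)"
definition mono_zw :: coef where "mono_zw = (\<lambda>k. if k = (1, 1) then 1 else 0)"

definition closed_subspace :: "coef set \<Rightarrow> bool" where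
  "closed_subspace K \<longleftrightarrow> K \<subseteq> H2 \<and> 0 \<in> K \<and>
     (\<forall>f\<in>K. \<forall>g\<in>K. f + g \<in> K) \<and> (\<forall>c. \<forall>f\<in>K. (\<lambda>k. c * f k) \<in> K) \<and>
     (\<forall>s f. (\<forall>n. s n \<in> K) \<and> f \<in> H2 \<and> (\<lambda>n. h2norm (s n - f)) \<longlonglongrightarrow> 0 \<longrightarrow> f \<in> K)"

definition submodule :: "coef set \<Rightarrow> bool" where
  "submodule M \<longleftrightarrow> closed_subspace M \<and> (\<forall>p\<in>poly2. \<forall>f\<in>M. pmul p f \<in> M)"

definition gen_submodule :: "coef set \<Rightarrow> coef set" where
  "gen_submodule F = \<Inter>{N. submodule N \<and> F \<subseteq> N}"

definition finitely_generated :: "coef set \<Rightarrow> bool" where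
  "finitely_generated M \<longleftrightarrow> (\<exists>F. finite F \<and> F \<subseteq> H2 \<and> M = gen_submodule F)"

definition orth :: "coef set \<Rightarrow> coef set" where
  "orth M = {g\<in>H2. \<forall>f\<in>M. h2inner f g = 0}"

definition proj :: "coef set \<Rightarrow> coef \<Rightarrow> coef" where
  "proj K f = (THE g. g \<in> K \<and> (\<forall>h\<in>K. h2inner (f - g) h = 0))"

text \<open>Operators on a closed subspace K are functions; only their values on K matter.\<close>

definition adj :: "coef set \<Rightarrow> (coef \<Rightarrow> coef) \<Rightarrow> coef \<Rightarrow> coef" where
  "adj K A g = (THE h. h \<in> K \<and> (\<forall>x\<in>K. h2inner (A x) g = h2inner x h))"

definition Rop :: "coef \<Rightarrow> coef \<Rightarrow> coef" where
  "Rop p = pmul p"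

definition Sop :: "coef \<Rightarrow> coef set \<Rightarrow> coef \<Rightarrow> coef" where
  "Sop p N = (\<lambda>f. proj N (pmul p f))"

definition core :: "coef set \<Rightarrow> coef \<Rightarrow> coef" where
  "core M = (\<lambda>f. f - Rop mono_z (adj M (Rop mono_z) f) - Rop mono_w (adj M (Rop mono_w) f)
                 + Rop mono_zw (adj M (Rop mono_zw) f))"

definition opnorm :: "coef set \<Rightarrow> (coef \<Rightarrow> coef) \<Rightarrow> real" where
  "opnorm K T = Sup {h2norm (T x) | x. x \<in> K \<and> h2norm x \<le> 1}"

definition bdd_rank_lt :: "coef set \<Rightarrow> (coef \<Rightarrow> coef) \<Rightarrow> nat \<Rightarrow> bool" where
  "bdd_rank_lt K F n \<longleftrightarrow>
     (\<forall>x\<in>K. F x \<in> K) \<and>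
     (\<forall>x\<in>K. \<forall>y\<in>K. F (x + y) = F x + F y) \<and>
     (\<forall>c. \<forall>x\<in>K. F (\<lambda>k. c * x k) = (\<lambda>k. c * F x k)) \<and>
     (\<exists>C. \<forall>x\<in>K. h2norm (F x) \<le> C * h2norm x) \<and>
     (\<exists>r<n. \<exists>v :: nat \<Rightarrow> coef. \<forall>x\<in>K. \<exists>c :: nat \<Rightarrow> complex.
         F x = (\<lambda>k. \<Sum>i<r. c i * v i k))"

text \<open>Singular values s_1 \<ge> s_2 \<ge> ... (approximation numbers), indexed from 1:
s_n(A) = inf { ||A - F|| : F of rank < n }.\<close>
definition sv :: "coef set \<Rightarrow> (coef \<Rightarrow> coef) \<Rightarrow> nat \<Rightarrow> real" where
  "sv K A n = Inf {opnorm K (\<lambda>x. A x - F x) | F. bdd_rank_lt K F n}"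

definition compact_op :: "coef set \<Rightarrow> (coef \<Rightarrow> coef) \<Rightarrow> bool" where
  "compact_op K A \<longleftrightarrow> (\<lambda>n. sv K A (Suc n)) \<longlonglongrightarrow> 0"

definition hilbert_schmidt :: "coef set \<Rightarrow> (coef \<Rightarrow> coef) \<Rightarrow> bool" where
  "hilbert_schmidt K A \<longleftrightarrow> compact_op K A \<and> summable (\<lambda>n. (sv K A (Suc n))\<^sup>2)"

definition macaev :: "coef set \<Rightarrow> (coef \<Rightarrow> coef) \<Rightarrow> bool" where
  "macaev K A \<longleftrightarrow> compact_op K A \<and>
     (\<exists>C. \<forall>n\<ge>1. (\<Sum>k=1..n. sv K A k) / ln (real n + 1) \<le> C)"

definition ess_unitary :: "coef set \<Rightarrow> (coef \<Rightarrow> coef) \<Rightarrow> bool" where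
  "ess_unitary K A \<longleftrightarrow>
     macaev K (\<lambda>x. x - adj K A (A x)) \<and> macaev K (\<lambda>x. x - A (adj K A x))"

definition ess_normal :: "coef set \<Rightarrow> bool" where
  "ess_normal N \<longleftrightarrow> (\<forall>f\<in>poly2. \<forall>g\<in>poly2.
     macaev N (\<lambda>x. adj N (Sop f N) (Sop g N x) - Sop g N (adj N (Sop f N) x)))"

definition blaschke :: "complex \<Rightarrow> complex list \<Rightarrow> complex \<Rightarrow> complex" where
  "blaschke c as z = c * (\<Prod>i<length as. (z - as ! i) / (1 - cnj (as ! i) * z))"

definition nonconst_fin_blaschke :: "(complex \<Rightarrow> complex) \<Rightarrow> bool" where
  "nonconst_fin_blaschke B \<longleftrightarrow> (\<exists>c as. cmod c = 1 \<and> as \<noteq> [] \<and>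
      (\<forall>a\<in>set as. cmod a < 1) \<and> B = blaschke c as)"

definition represents :: "coef \<Rightarrow> (complex \<Rightarrow> complex \<Rightarrow> complex) \<Rightarrow> bool" where
  "represents f g \<longleftrightarrow> (\<forall>z w. cmod z < 1 \<and> cmod w < 1 \<longrightarrow>
      ((\<lambda>(m, n). f (m, n) * z ^ m * w ^ n) has_sum g z w) UNIV)"

end

theory Submission
  imports Defs "HOL-Computational_Algebra.Fundamental_Theorem_Algebra"
begin

text \<open>A distinguished homogeneous polynomial is a product of factors \<open>z - \<alpha> w\<close> with \<open>|\<alpha>| = 1\<close>.
  Multiplication by \<open>B\<^sub>1(z)\<close> and \<open>B\<^sub>2(w)\<close> gives commuting isometries \<open>U\<close>, \<open>V\<close>, and on the
  complement \<open>N\<^sub>0\<close> of the submodule generated by \<open>p\<^sub>B\<close> the product of the \<open>(U - \<alpha> V)\<^sup>*\<close> vanishes.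
  This relation expresses \<open>V\<^sup>*\<^sup>m\<close> through averages of \<open>U\<^sup>*\<^sup>j V\<^sup>*\<^bsup>(m-j)\<^esup>\<close>, whose images under the
  projection \<open>I - M\<^sub>z M\<^sub>z\<^sup>*\<close> have norm \<open>O(m\<^bsup>-1/2\<^esup>)\<close>; on the other hand \<open>V\<^sup>*\<^sup>m\<close> is isometric on the
  range of that projection off \<open>O(m)\<close> directions. So the projection restricted to \<open>N\<^sub>0\<close> has
  \<open>s\<^sub>n = O(n\<^bsup>-1/2\<^esup>)\<close>, and \<open>I - S\<^sub>z S\<^sub>z\<^sup>*\<close> has \<open>s\<^sub>n = O(1/n)\<close>.
  As \<open>S\<^sub>z\<close> is injective on \<open>N\<^sub>0\<close>, an index argument yields the same for \<open>I - S\<^sub>z\<^sup>* S\<^sub>z\<close>.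
  For a larger module \<open>M\<close>, finite generation bounds the cokernel of \<open>S\<^sub>z\<close> on the part of \<open>M\<close> inside
  \<open>N\<^sub>0\<close>, so the same index argument applies there and passes to the complement of \<open>M\<close>. The core
  operator and all commutators are then algebraic combinations of operators in the ideal.\<close>

section \<open>Complex Hilbert spaces\<close>

text \<open>The defect projection D = I - ZZ^* satisfies D U = b0 D with b0 = B1(0), and |b0| < 1
  because B1 is nonconstant. Distinguishedness enters as |\<alpha>| = 1, which keeps the
  coefficients of the averages unimodular. The relation D U = b0 D also bounds the norm of D G y
  below by a multiple of that of D y, where G is the product of the U - \<alpha> V; this is the
  source of the injectivity of S_z on N_0. Finite generation is used through division with
  remainder: modulo Z M the operator G becomes a nonzero polynomial in W, so only finitely many
  vectors W^j f have to be controlled. The rate O(1/n) is convenient because it survives sums,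
  adjoints and bounded factors and is produced by any product of two operators of rate
  n^(-1/2).\<close>

text \<open>The real inner product is the real part of the complex one. Real and complex adjoints of
  complex-linear operators agree, and so do real and complex orthogonal complements of complex
  subspaces; hence most of the operator theory needs only the real structure.\<close>

class chilbert = real_inner + complete_space +
  fixes scaleC :: "complex \<Rightarrow> 'a \<Rightarrow> 'a" (infixr "*\<^sub>C" 75)
  assumes scaleC_add_right: "c *\<^sub>C (x + y) = c *\<^sub>C x + c *\<^sub>C y"
    and scaleC_add_left: "(b + c) *\<^sub>C x = b *\<^sub>C x + c *\<^sub>C x"
    and scaleC_scaleC [simp]: "b *\<^sub>C c *\<^sub>C x = (b * c) *\<^sub>C x"
    and scaleC_of_real: "of_real r *\<^sub>C x = r *\<^sub>R x"
    and inner_scaleC_left: "inner (c *\<^sub>C x) y = inner x (cnj c *\<^sub>C y)"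
begin

subclass banach ..

end

lemma scaleC_one [simp]: "1 *\<^sub>C (x::'a::chilbert) = x"
  using scaleC_of_real[of 1 x] by simp

lemma scaleC_zero_left [simp]: "0 *\<^sub>C (x::'a::chilbert) = 0"
  using scaleC_of_real[of 0 x] by simp

lemma inner_scaleC_right: "inner x (c *\<^sub>C y) = inner (cnj c *\<^sub>C x) (y::'a::chilbert)"
  by (simp add: inner_scaleC_left)

lemma scaleC_minus_left: "(- c) *\<^sub>C (x::'a::chilbert) = - (c *\<^sub>C x)"
  using scaleC_add_left[of "-c" c x] by (simp add: eq_neg_iff_add_eq_0)

lemma norm_scaleC [simp]: "norm (c *\<^sub>C (x::'a::chilbert)) = cmod c * norm x"
proof -
  have "(norm (c *\<^sub>C x))\<^sup>2 = inner x (of_real ((cmod c)\<^sup>2) *\<^sub>C x)"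
    unfolding complex_norm_square by (simp add: power2_norm_eq_inner inner_scaleC_left mult.commute)
  also have "\<dots> = (cmod c * norm x)\<^sup>2"
    by (simp add: scaleC_of_real power2_norm_eq_inner power_mult_distrib del: of_real_power)
  finally show ?thesis
    by (simp add: power2_eq_iff_nonneg)
qed

lemma bounded_linear_scaleC: "bounded_linear (\<lambda>x. c *\<^sub>C (x::'a::chilbert))"
proof (rule bounded_linear_intro[where K = "cmod c"])
  fix r and x :: 'a
  show "c *\<^sub>C r *\<^sub>R x = r *\<^sub>R c *\<^sub>C x"
    by (simp add: mult.commute flip: scaleC_of_real)
qed (auto simp: scaleC_add_right mult.commute)

lemmas scaleC_zero_right [simp] = linear_0[OF bounded_linear.linear[OF bounded_linear_scaleC]]
lemmas scaleC_diff_right = linear_diff[OF bounded_linear.linear[OF bounded_linear_scaleC]]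
lemmas scaleC_sum_right = linear_sum[OF bounded_linear.linear[OF bounded_linear_scaleC]]

lemma scaleC_diff_left: "(b - c) *\<^sub>C (x::'a::chilbert) = b *\<^sub>C x - c *\<^sub>C x"
  using scaleC_add_left[of b "-c" x] by (simp add: scaleC_minus_left)

lemma scaleC_complex: "c *\<^sub>C (x::'a::chilbert) = Re c *\<^sub>R x + Im c *\<^sub>R \<i> *\<^sub>C x"
proof -
  have "c = of_real (Re c) + of_real (Im c) * \<i>"
    by (simp add: complex_eq mult.commute)
  then have "c *\<^sub>C x = (of_real (Re c) + of_real (Im c) * \<i>) *\<^sub>C x"
    by simp
  then show ?thesis
    by (simp only: scaleC_add_left scaleC_scaleC[symmetric] scaleC_of_real)
qed

text \<open>Real orthogonality to both \<open>x\<close> and \<open>\<i> *\<^sub>C x\<close> is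
  complex orthogonality to x. For this reason some finite test sets below list vectors in pairs v,
  iv.\<close>

lemma inner_scaleC_zeroI:
  fixes x y :: "'a::chilbert"
  assumes "inner x y = 0" "inner (\<i> *\<^sub>C x) y = 0"
  shows "inner (c *\<^sub>C x) y = 0"
  using assms by (subst scaleC_complex) (simp add: inner_add_left)

text \<open>Boundedness and real linearity are kept as one component, with complex homogeneity
  added, so that real facts on adjoints and projections apply directly.\<close>

definition cop :: "('a::chilbert \<Rightarrow> 'a) \<Rightarrow> bool" where
  "cop A \<longleftrightarrow> bounded_linear A \<and> (\<forall>c x. A (c *\<^sub>C x) = c *\<^sub>C A x)"

lemma cop_bounded_linear: "cop A \<Longrightarrow> bounded_linear A"
  and cop_scaleC: "cop A \<Longrightarrow> A (c *\<^sub>C x) = c *\<^sub>C A x"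
  and cop_add: "cop A \<Longrightarrow> A (x + y) = A x + A y"
  and cop_diff: "cop A \<Longrightarrow> A (x - y) = A x - A y"
  and cop_minus: "cop A \<Longrightarrow> A (- x) = - A x"
  and cop_zero: "cop A \<Longrightarrow> A 0 = 0"
  and cop_scaleR: "cop A \<Longrightarrow> A (r *\<^sub>R x) = r *\<^sub>R A x"
  and cop_sum: "cop A \<Longrightarrow> A (sum f S) = (\<Sum>i\<in>S. A (f i))"
  by (auto simp: cop_def linear_simps real_vector.linear_sum[OF bounded_linear.linear])

lemmas cop_simps = cop_scaleC cop_add cop_diff cop_minus cop_zero cop_scaleR cop_sum

lemma cop_id: "cop (\<lambda>x. x)"
  and cop_const_zero: "cop (\<lambda>x. 0)"
  and cop_compose: "cop A \<Longrightarrow> cop B \<Longrightarrow> cop (\<lambda>x. A (B x))"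
  and cop_plus: "cop A \<Longrightarrow> cop B \<Longrightarrow> cop (\<lambda>x. A x + B x)"
  and cop_minus_op: "cop A \<Longrightarrow> cop B \<Longrightarrow> cop (\<lambda>x. A x - B x)"
  and cop_scale: "cop A \<Longrightarrow> cop (\<lambda>x. c *\<^sub>C A x)"
  by (auto simp: cop_def scaleC_add_right scaleC_diff_right mult.commute
      bounded_linear_add bounded_linear_sub
      intro: bounded_linear_compose[where f = A]
        bounded_linear_compose[OF bounded_linear_scaleC])

lemma cop_sum_op: "(\<And>i. i \<in> S \<Longrightarrow> cop (A i)) \<Longrightarrow> cop (\<lambda>x. \<Sum>i\<in>S. A i x)"
  by (induction S rule: infinite_finite_induct) (auto intro: cop_const_zero cop_plus)

lemma cop_funpow: "cop A \<Longrightarrow> cop (A ^^ n)"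
  by (induction n) (auto simp: o_def id_def intro: cop_id cop_compose)

section \<open>Orthogonal projections and adjoints\<close>

text \<open>A minimising sequence for the distance to \<open>K\<close> is Cauchy by the
  parallelogram law, and the residual at its limit is orthogonal to \<open>K\<close> because moving
  along \<open>h\<close> cannot decrease the distance.\<close>

lemma ex_orthogonal_decomposition:
  fixes K :: "'a::{real_inner,complete_space} set"
  assumes K: "subspace K" "closed K"
  shows "\<exists>y\<in>K. \<forall>h\<in>K. inner (x - y) h = 0"
proof -
  define \<delta> where "\<delta> = Inf ((\<lambda>k. (norm (x - k))\<^sup>2) ` K)"
  have bdd: "bdd_below ((\<lambda>k. (norm (x - k))\<^sup>2) ` K)"
    by (auto intro!: bdd_belowI[where m = 0])
  have \<delta>_le: "\<delta> \<le> (norm (x - k))\<^sup>2" if "k \<in> K" for k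
    unfolding \<delta>_def using bdd that by (auto intro: cInf_lower)
  have "\<exists>k\<in>K. (norm (x - k))\<^sup>2 < \<delta> + 1 / Suc n" for n
  proof (rule ccontr)
    assume "\<not> ?thesis"
    then have "\<delta> + 1 / Suc n \<le> \<delta>"
      unfolding \<delta>_def using subspace_0[OF K(1)] by (intro cInf_greatest) (auto simp: not_less)
    then show False by simp
  qed
  then obtain k where k: "\<And>n. k n \<in> K" "\<And>n. (norm (x - k n))\<^sup>2 < \<delta> + 1 / Suc n"
    by metis
  \<comment> \<open>The midpoint of \<open>k m\<close> and \<open>k n\<close> lies in
    \<open>K\<close>, so its squared distance to x is at least \<delta>.\<close>
  have par: "(norm (k m - k n))\<^sup>2 \<le> 2 / Suc m + 2 / Suc n" for m n
  proof -
    have "(1/2) *\<^sub>R (k m + k n) \<in> K"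
      using K(1) k(1) by (simp add: subspace_scale subspace_add)
    then have "4 * \<delta> \<le> 4 * (norm (x - (1/2) *\<^sub>R (k m + k n)))\<^sup>2"
      using \<delta>_le by simp
    also have "\<dots> = 2 * (norm (x - k m))\<^sup>2 + 2 * (norm (x - k n))\<^sup>2 - (norm (k m - k n))\<^sup>2"
      by (simp add: power2_norm_eq_inner inner_diff_left inner_diff_right inner_add_left
          inner_add_right inner_commute algebra_simps)
    finally show ?thesis using k(2)[of m] k(2)[of n] by simp
  qed
  have "Cauchy k"
  proof (rule CauchyI)
    fix e :: real assume e: "0 < e"
    obtain N where N: "4 / e\<^sup>2 < real N"
      using reals_Archimedean2 by blast
    have "norm (k m - k n) < e" if "m \<ge> N" "n \<ge> N" for m n
    proof -
      have "4 / e\<^sup>2 < Suc N" using N by simp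
      then have "4 / Suc N < e\<^sup>2"
        using e by (simp add: field_simps)
      moreover have "2 / real (Suc m) \<le> 2 / Suc N" "2 / real (Suc n) \<le> 2 / Suc N"
        using that by (simp_all add: frac_le)
      moreover have "2 / real (Suc N) + 2 / Suc N = 4 / Suc N"
        by (simp flip: add_divide_distrib)
      ultimately have "(norm (k m - k n))\<^sup>2 < e\<^sup>2"
        using par[of m n] by linarith
      then show ?thesis using e by (simp add: power2_less_imp_less)
    qed
    then show "\<exists>M. \<forall>m\<ge>M. \<forall>n\<ge>M. norm (k m - k n) < e" by blast
  qed
  then obtain y where y: "k \<longlonglongrightarrow> y"
    using Cauchy_convergent_iff convergent_def by blast
  have yK: "y \<in> K"
    using K(2) k(1) y closed_sequentially by blast
  have "(\<lambda>n. (norm (x - k n))\<^sup>2) \<longlonglongrightarrow> (norm (x - y))\<^sup>2"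
    by (intro tendsto_intros y)
  moreover have "(\<lambda>n. \<delta> + 1 / Suc n) \<longlonglongrightarrow> \<delta>"
    using tendsto_add[OF tendsto_const[of \<delta>] LIMSEQ_inverse_real_of_nat] by (simp add: divide_inverse)
  ultimately have "(norm (x - y))\<^sup>2 \<le> \<delta>"
    using k(2) by (intro LIMSEQ_le) (auto intro: less_imp_le)
  then have min: "(norm (x - y))\<^sup>2 \<le> (norm (x - h))\<^sup>2" if "h \<in> K" for h
    using \<delta>_le[OF that] by linarith
  have "inner (x - y) h = 0" if h: "h \<in> K" for h
  proof (cases "h = 0")
    case False
    \<comment> \<open>The step length that minimises the distance from x along the line y + t
      h.\<close>
    define t where "t = inner (x - y) h / inner h h"
    have "y + t *\<^sub>R h \<in> K"
      using yK h K(1) by (simp add: subspace_add subspace_scale)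
    from min[OF this] have "2 * t * inner (x - y) h \<le> t * (t * inner h h)"
      by (simp add: power2_norm_eq_inner inner_diff_left inner_diff_right inner_add_left
          inner_add_right inner_commute algebra_simps)
    moreover have "t * inner h h = inner (x - y) h"
      using False by (simp add: t_def)
    ultimately have "t * inner (x - y) h \<le> 0" by simp
    then have "(inner (x - y) h)\<^sup>2 / inner h h \<le> 0"
      by (simp add: t_def power2_eq_square)
    then show ?thesis
      using False inner_gt_zero_iff[of h] by (auto simp: divide_le_0_iff simp del: inner_gt_zero_iff)
  qed simp
  with yK show ?thesis by blast
qed

definition oproj :: "'a::real_inner set \<Rightarrow> 'a \<Rightarrow> 'a" where
  "oproj K x = (SOME y. y \<in> K \<and> (\<forall>h\<in>K. inner (x - y) h = 0))"

context
  fixes K :: "'a::{real_inner,complete_space} set"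
  assumes K: "subspace K" "closed K"
begin

lemma oproj_in: "oproj K x \<in> K"
  and oproj_orth: "h \<in> K \<Longrightarrow> inner (x - oproj K x) h = 0"
  using someI_ex[OF ex_orthogonal_decomposition[OF K, unfolded Bex_def], of x]
  unfolding oproj_def by auto

lemma oproj_unique:
  assumes "y \<in> K" "\<And>h. h \<in> K \<Longrightarrow> inner (x - y) h = 0"
  shows "oproj K x = y"
proof -
  have "oproj K x - y \<in> K"
    using K(1) oproj_in assms(1) by (simp add: subspace_diff)
  then have "inner (oproj K x - y) (oproj K x - y) = 0"
    using assms(2)[of "oproj K x - y"] oproj_orth[of "oproj K x - y" x]
    by (simp add: inner_diff_left)
  then show ?thesis by simp
qed

lemma oproj_eq_iff: "oproj K x = x \<longleftrightarrow> x \<in> K"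
  using oproj_in oproj_unique by (metis inner_zero_left right_minus_eq)

lemma oproj_idem: "oproj K (oproj K x) = oproj K x"
  by (simp add: oproj_eq_iff oproj_in)

lemma oproj_inner: "inner (oproj K x) y = inner x (oproj K y)"
  using oproj_orth[OF oproj_in, of x y] oproj_orth[OF oproj_in, of y x]
  by (simp add: inner_diff_left inner_diff_right inner_commute)

lemma norm_oproj_le: "norm (oproj K x) \<le> norm x"
proof -
  have "(norm (oproj K x))\<^sup>2 = inner x (oproj K x)"
    by (metis oproj_inner oproj_idem power2_norm_eq_inner)
  also have "\<dots> \<le> norm x * norm (oproj K x)"
    by (rule norm_cauchy_schwarz)
  finally have "norm (oproj K x) * norm (oproj K x) \<le> norm x * norm (oproj K x)"
    by (simp add: power2_eq_square)
  then show ?thesis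
    by (metis mult_right_le_imp_le norm_ge_zero norm_zero order_le_less zero_less_norm_iff)
qed

lemma bounded_linear_oproj: "bounded_linear (oproj K)"
proof (rule bounded_linear_intro[where K = 1])
  show "oproj K (x + y) = oproj K x + oproj K y" for x y
    using K(1) oproj_in oproj_orth
    by (intro oproj_unique) (auto simp: subspace_add add_diff_add inner_add_left)
  show "oproj K (r *\<^sub>R x) = r *\<^sub>R oproj K x" for r x
    using K(1) oproj_in oproj_orth
    by (intro oproj_unique) (auto simp: subspace_scale simp flip: scaleR_diff_right)
qed (simp add: norm_oproj_le)

lemma oproj_eq_0_iff: "oproj K x = 0 \<longleftrightarrow> (\<forall>h\<in>K. inner h x = 0)"
proof
  assume "oproj K x = 0"
  then show "\<forall>h\<in>K. inner h x = 0"
    using oproj_orth[of _ x] by (simp add: inner_commute)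
next
  assume "\<forall>h\<in>K. inner h x = 0"
  then show "oproj K x = 0"
    using K(1) by (intro oproj_unique) (auto simp: subspace_0 inner_commute)
qed

end

section \<open>Closed complex subspaces and orthogonal complements\<close>

definition csubspace :: "'a::chilbert set \<Rightarrow> bool" where
  "csubspace K \<longleftrightarrow> subspace K \<and> closed K \<and> (\<forall>c. \<forall>x\<in>K. c *\<^sub>C x \<in> K)"

lemma csubspace_subspace: "csubspace K \<Longrightarrow> subspace K"
  and csubspace_closed: "csubspace K \<Longrightarrow> closed K"
  and csubspace_scaleC: "csubspace K \<Longrightarrow> x \<in> K \<Longrightarrow> c *\<^sub>C x \<in> K"
  by (auto simp: csubspace_def)

lemma cop_oproj: "csubspace K \<Longrightarrow> cop (oproj K)"
  unfolding cop_def
proof safe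
  assume K: "csubspace K"
  then show "bounded_linear (oproj K)"
    by (simp add: bounded_linear_oproj csubspace_def)
  fix c x
  show "oproj K (c *\<^sub>C x) = c *\<^sub>C oproj K x"
    using K by (intro oproj_unique)
      (auto simp: csubspace_def oproj_in oproj_orth inner_scaleC_left simp flip: scaleC_diff_right)
qed

text \<open>Taken of an arbitrary set and with the real inner product: a finite set then stands for
  a closed subspace of real codimension at most its cardinality, which is how finite codimension is
  counted below.\<close>

definition ocomp :: "'a::real_inner set \<Rightarrow> 'a set" where
  "ocomp S = {x. \<forall>s\<in>S. inner s x = 0}"

lemma subspace_ocomp: "subspace (ocomp S)"
  by (auto simp: ocomp_def subspace_def inner_add_right)

lemma closed_ocomp: "closed (ocomp S)"
proof -
  have "ocomp S = (\<Inter>s\<in>S. {x. inner s x = 0})"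
    by (auto simp: ocomp_def)
  also have "closed \<dots>"
    by (intro closed_INT ballI closed_Collect_eq continuous_intros)
  finally show ?thesis .
qed

lemma csubspace_ocomp:
  assumes "\<And>c s. s \<in> S \<Longrightarrow> c *\<^sub>C s \<in> S"
  shows "csubspace (ocomp S)"
  using assms by (auto simp: csubspace_def subspace_ocomp closed_ocomp) (auto simp: ocomp_def inner_scaleC_right)

lemma oproj_ocomp:
  fixes K :: "'a::{real_inner,complete_space} set"
  assumes "subspace K" "closed K"
  shows "oproj (ocomp K) x = x - oproj K x"
  using oproj_orth[OF assms] oproj_in[OF assms]
  by (intro oproj_unique subspace_ocomp closed_ocomp) (auto simp: ocomp_def inner_commute)

text \<open>The kernel of a nonzero functional has a one-dimensional complement, spanned by the
  residual \<open>u\<close> of any vector outside the kernel.\<close>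

lemma riesz_representation:
  fixes f :: "'a::{real_inner,complete_space} \<Rightarrow> real"
  assumes f: "bounded_linear f"
  shows "\<exists>y. \<forall>x. f x = inner x y"
proof (cases "\<exists>x. f x \<noteq> 0")
  case True
  then obtain x0 where x0: "f x0 \<noteq> 0" by blast
  define K where "K = {x. f x = 0}"
  interpret f: bounded_linear f by fact
  have K: "subspace K" "closed K"
    by (auto simp: K_def subspace_def f.add f.scaleR f.zero
        intro!: closed_Collect_eq continuous_intros f.continuous_on)
  define u where "u = x0 - oproj K x0"
  have fu: "f u \<noteq> 0"
    using oproj_in[OF K, of x0] x0 by (simp add: u_def f.diff K_def)
  then have u0: "inner u u \<noteq> 0"
    using f.zero by auto
  have "inner (x - (f x / f u) *\<^sub>R u) u = 0" for x
    using oproj_orth[OF K, of "x - (f x / f u) *\<^sub>R u" x0] fu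
    by (simp add: K_def f.diff f.scaleR u_def inner_commute)
  then have "f x = inner x ((f u / inner u u) *\<^sub>R u)" for x
    using fu u0 by (simp add: inner_diff_left field_simps)
  then show ?thesis by blast
qed (auto intro: exI[of _ 0])

text \<open>\<open>adjoint\<close> is defined by choice and is meaningful once some adjoint exists;
  the Riesz theorem, applied for each y separately, supplies one.\<close>

lemma inner_adjoint:
  fixes A :: "'a::{real_inner,complete_space} \<Rightarrow> 'b::real_inner"
  assumes A: "bounded_linear A"
  shows "inner x (adjoint A y) = inner (A x) y"
proof -
  have "\<exists>z. \<forall>x. inner (A x) y = inner x z" for y
    by (intro riesz_representation bounded_linear_compose[OF bounded_linear_inner_left A])
  then have "\<exists>B. \<forall>x y. inner (A x) y = inner x (B y)"
    by metis
  then have "\<forall>x y. inner (A x) y = inner x (adjoint A y)"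
    unfolding adjoint_def by (rule someI_ex)
  then show ?thesis by simp
qed

lemma inner_adjoint_left:
  fixes A :: "'a::{real_inner,complete_space} \<Rightarrow> 'b::real_inner"
  shows "bounded_linear A \<Longrightarrow> inner (adjoint A y) x = inner y (A x)"
  by (metis inner_adjoint inner_commute)

lemma adjoint_eqI:
  "(\<And>x y. inner (A x) y = inner x (B y)) \<Longrightarrow> adjoint A = B"
  by (simp add: adjoint_unique)

lemma norm_adjoint_le:
  fixes A :: "'a::{real_inner,complete_space} \<Rightarrow> 'b::real_inner"
  assumes A: "bounded_linear A" and le: "\<And>x. norm (A x) \<le> C * norm x" and C: "0 \<le> C"
  shows "norm (adjoint A y) \<le> C * norm y"
proof (cases "adjoint A y = 0")
  case False
  have "(norm (adjoint A y))\<^sup>2 = inner (A (adjoint A y)) y"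
    by (simp add: power2_norm_eq_inner inner_adjoint[OF A])
  also have "\<dots> \<le> C * norm (adjoint A y) * norm y"
    using norm_cauchy_schwarz le mult_right_mono by (meson norm_ge_zero order_trans)
  finally show ?thesis
    using False by (simp add: power2_eq_square)
qed (simp add: C)

lemma bounded_linear_adjoint:
  fixes A :: "'a::{real_inner,complete_space} \<Rightarrow> 'b::real_inner"
  assumes A: "bounded_linear A"
  shows "bounded_linear (adjoint A)"
proof -
  obtain C where C: "0 \<le> C" "\<And>x. norm (A x) \<le> norm x * C"
    using bounded_linear.nonneg_bounded[OF A] by blast
  have eqI: "u = v" if "\<And>x. inner x u = inner x v" for u v :: 'a
    using that vector_eq_ldot[of u v] by simp
  show ?thesis
  proof (rule bounded_linear_intro[where K = C])
    show "adjoint A (x + y) = adjoint A x + adjoint A y" for x y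
      by (rule eqI) (simp add: inner_adjoint[OF A] inner_add_right)
    show "adjoint A (r *\<^sub>R x) = r *\<^sub>R adjoint A x" for r x
      by (rule eqI) (simp add: inner_adjoint[OF A])
    show "norm (adjoint A x) \<le> norm x * C" for x
      using norm_adjoint_le[OF A _ C(1), of x] C(2) by (simp add: mult.commute)
  qed
qed

lemma adjoint_compose:
  fixes A B :: "'a::{real_inner,complete_space} \<Rightarrow> 'a"
  assumes "bounded_linear A" "bounded_linear B"
  shows "adjoint (\<lambda>x. A (B x)) = (\<lambda>x. adjoint B (adjoint A x))"
  by (rule adjoint_eqI) (simp add: inner_adjoint assms)

lemma adjoint_adjoint_hilbert:
  fixes A :: "'a::{real_inner,complete_space} \<Rightarrow> 'a"
  assumes "bounded_linear A"
  shows "adjoint (adjoint A) = A"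
  by (rule adjoint_eqI) (simp add: inner_adjoint_left assms)

lemma cop_adjoint:
  assumes A: "cop A"
  shows "cop (adjoint A)"
  unfolding cop_def
proof safe
  note bl = cop_bounded_linear[OF A]
  show "bounded_linear (adjoint A)"
    by (rule bounded_linear_adjoint[OF bl])
  fix c x
  have "inner y (adjoint A (c *\<^sub>C x)) = inner y (c *\<^sub>C adjoint A x)" for y
    by (simp add: inner_adjoint[OF bl] inner_scaleC_right cop_scaleC[OF A])
  then show "adjoint A (c *\<^sub>C x) = c *\<^sub>C adjoint A x"
    using vector_eq_ldot[THEN iffD1] by blast
qed

lemma adjoint_commute:
  fixes A B C D :: "'a::{real_inner,complete_space} \<Rightarrow> 'a"
  assumes "bounded_linear A" "bounded_linear B" "bounded_linear C" "bounded_linear D"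
    and "\<And>x. A (B x) = C (D x)"
  shows "adjoint B (adjoint A x) = adjoint D (adjoint C x)"
proof -
  have "(\<lambda>x. A (B x)) = (\<lambda>x. C (D x))"
    using assms(5) by (rule ext)
  then show ?thesis
    using fun_cong[OF adjoint_compose[OF assms(1,2)], of x]
      fun_cong[OF adjoint_compose[OF assms(3,4)], of x] by simp
qed

text \<open>By polarisation, preserving norms means preserving inner products.\<close>

lemma adjoint_isometry:
  fixes A :: "'a::{real_inner,complete_space} \<Rightarrow> 'a"
  assumes A: "bounded_linear A" and iso: "\<And>x. norm (A x) = norm x"
  shows "adjoint A (A x) = x"
proof -
  have "inner (A u) (A v) = inner u v" for u v
    using iso[of "u + v"] iso[of u] iso[of v]
    by (simp add: linear_simps[OF A] dot_norm)
  then have "inner u (adjoint A (A x)) = inner u x" for u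
    by (simp add: inner_adjoint[OF A])
  then show ?thesis
    using vector_eq_ldot[THEN iffD1] by blast
qed

section \<open>Operators with decaying approximation numbers\<close>

text \<open>In a Hilbert space the approximation numbers agree with the Gelfand numbers, which measure
  the norm on subspaces of finite codimension. So \<open>decay a A\<close> means \<open>s\<^sub>n(A) = O(n\<^bsup>-a/2\<^esup>)\<close>.
  All operators in question turn out to satisfy \<open>s\<^sub>n = O(1/n)\<close>, which implies
  both the Macaev and the Hilbert-Schmidt property.\<close>

definition decay :: "nat \<Rightarrow> ('a::real_inner \<Rightarrow> 'a) \<Rightarrow> bool" where
  "decay a A \<longleftrightarrow> bounded_linear A \<and>
     (\<exists>C::nat. \<forall>n\<ge>1. \<exists>V. finite V \<and> card V \<le> C * n \<and>
        (\<forall>x\<in>ocomp V. norm (A x) \<le> C * (1 / sqrt n) ^ a * norm x))"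

lemma decay_bounded_linear: "decay a A \<Longrightarrow> bounded_linear A"
  by (simp add: decay_def)

lemma decayI:
  assumes "bounded_linear A"
    and V: "\<And>n. 1 \<le> n \<Longrightarrow> \<exists>V. finite V \<and> card V \<le> D * n \<and>
        (\<forall>x\<in>ocomp V. norm (A x) \<le> C * (1 / sqrt n) ^ a * norm x)"
  shows "decay a A"
proof -
  define E where "E = max D (nat \<lceil>C\<rceil>)"
  have "\<exists>V. finite V \<and> card V \<le> E * n \<and>
      (\<forall>x\<in>ocomp V. norm (A x) \<le> E * (1 / sqrt n) ^ a * norm x)" if "1 \<le> n" for n
  proof -
    from V[OF that] obtain V where V: "finite V" "card V \<le> D * n"
      "\<forall>x\<in>ocomp V. norm (A x) \<le> C * (1 / sqrt n) ^ a * norm x" by blast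
    have "C \<le> real E"
      unfolding E_def using real_nat_ceiling_ge[of C] by linarith
    then have "C * (1 / sqrt n) ^ a * norm x \<le> E * (1 / sqrt n) ^ a * norm x" for x :: 'a
      by (intro mult_right_mono) auto
    moreover have "card V \<le> E * n"
      using V(2) by (rule order_trans) (auto simp: E_def)
    ultimately show "\<exists>V. finite V \<and> card V \<le> E * n \<and>
        (\<forall>x\<in>ocomp V. norm (A x) \<le> E * (1 / sqrt n) ^ a * norm x)"
      using V(1,3) order_trans by blast
  qed
  with assms(1) show ?thesis unfolding decay_def by blast
qed

lemma decayE:
  assumes "decay a A"
  obtains C :: nat where "\<And>n. 1 \<le> n \<Longrightarrow> \<exists>V. finite V \<and> card V \<le> C * n \<and>
        (\<forall>x\<in>ocomp V. norm (A x) \<le> C * (1 / sqrt n) ^ a * norm x)"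
  using assms unfolding decay_def by blast

lemma ocomp_Un: "ocomp (S \<union> T) = ocomp S \<inter> ocomp T"
  by (auto simp: ocomp_def)

text \<open>Turns a finite-codimension condition on \<open>A x\<close> into one on \<open>x\<close>
  with no more directions. Test sets are pulled back through operators in this way.\<close>

lemma ocomp_image_adjoint:
  fixes A :: "'a::{real_inner,complete_space} \<Rightarrow> 'b::real_inner"
  shows "bounded_linear A \<Longrightarrow> x \<in> ocomp (adjoint A ` V) \<longleftrightarrow> A x \<in> ocomp V"
  by (auto simp: ocomp_def inner_adjoint_left)

lemma decay_0:
  assumes A: "bounded_linear A"
  shows "decay 0 A"
proof -
  obtain C where "\<And>x. norm (A x) \<le> norm x * C"
    using bounded_linear.nonneg_bounded[OF A] by blast
  then show ?thesis
    by (intro decayI[where D = 0 and C = C, OF A] exI[of _ "{}"]) (simp add: mult.commute)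
qed

text \<open>The finitely many exceptional directions are free: they join every test set, and
  \<open>card F \<le> card F * n\<close> because n \<ge> 1.\<close>

lemma decay_dominated:
  assumes A: "bounded_linear A" and B: "decay a B" and F: "finite F"
    and le: "\<And>x. x \<in> ocomp F \<Longrightarrow> norm (A x) \<le> c * norm (B x)"
  shows "decay a A"
proof -
  obtain C where C: "\<And>n. 1 \<le> n \<Longrightarrow> \<exists>V. finite V \<and> card V \<le> C * n \<and>
        (\<forall>x\<in>ocomp V. norm (B x) \<le> C * (1 / sqrt n) ^ a * norm x)"
    using decayE[OF B] by blast
  show ?thesis
  proof (rule decayI[where D = "C + card F" and C = "\<bar>c\<bar> * C", OF A])
    fix n :: nat assume n: "1 \<le> n"
    from C[OF this] obtain V where V: "finite V" "card V \<le> C * n"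
      "\<And>x. x\<in>ocomp V \<Longrightarrow> norm (B x) \<le> C * (1 / sqrt n) ^ a * norm x" by blast
    have "card (V \<union> F) \<le> C * n + card F * n"
      using card_Un_le[of V F] V(2) mult_le_mono2[OF n, of "card F"] by linarith
    moreover have "norm (A x) \<le> \<bar>c\<bar> * C * (1 / sqrt n) ^ a * norm x"
      if "x \<in> ocomp (V \<union> F)" for x
    proof -
      have "norm (A x) \<le> \<bar>c\<bar> * norm (B x)"
        using le[of x] that mult_right_mono[OF abs_ge_self[of c], of "norm (B x)"]
        by (simp add: ocomp_Un)
      also have "\<dots> \<le> \<bar>c\<bar> * (C * (1 / sqrt n) ^ a * norm x)"
        using V(3) that by (intro mult_left_mono) (auto simp: ocomp_Un)
      finally show ?thesis by (simp add: mult.assoc)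
    qed
    ultimately show "\<exists>V. finite V \<and> card V \<le> (C + card F) * n \<and>
        (\<forall>x\<in>ocomp V. norm (A x) \<le> \<bar>c\<bar> * C * (1 / sqrt n) ^ a * norm x)"
      using V(1) F by (intro exI[of _ "V \<union> F"]) (simp add: distrib_right)
  qed
qed

lemma decay_finite_rank:
  assumes "bounded_linear A" "finite F" "\<And>x. x \<in> ocomp F \<Longrightarrow> A x = 0"
  shows "decay a A"
proof -
  have "decay a (\<lambda>x. 0::'a)"
    by (rule decayI[where D = 0 and C = 0]) (auto intro!: exI[of _ "{}"])
  then show ?thesis
    using assms decay_dominated[where c = 0 and F = F and B = "\<lambda>x. 0::'a"] by auto
qed

lemma decay_add:
  assumes "decay a A" "decay a B"
  shows "decay a (\<lambda>x. A x + B x)"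
proof -
  obtain C where C: "\<And>n. 1 \<le> n \<Longrightarrow> \<exists>V. finite V \<and> card V \<le> C * n \<and>
        (\<forall>x\<in>ocomp V. norm (A x) \<le> C * (1 / sqrt n) ^ a * norm x)"
    using decayE[OF assms(1)] by blast
  obtain D where D: "\<And>n. 1 \<le> n \<Longrightarrow> \<exists>V. finite V \<and> card V \<le> D * n \<and>
        (\<forall>x\<in>ocomp V. norm (B x) \<le> D * (1 / sqrt n) ^ a * norm x)"
    using decayE[OF assms(2)] by blast
  show ?thesis
  proof (rule decayI[where D = "C + D" and C = "C + D"])
    show "bounded_linear (\<lambda>x. A x + B x)"
      using assms by (intro bounded_linear_add decay_bounded_linear)
    fix n :: nat assume n: "1 \<le> n"
    obtain V where V: "finite V" "card V \<le> C * n"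
      "\<And>x. x\<in>ocomp V \<Longrightarrow> norm (A x) \<le> C * (1 / sqrt n) ^ a * norm x" using C[OF n] by blast
    obtain W where W: "finite W" "card W \<le> D * n"
      "\<And>x. x\<in>ocomp W \<Longrightarrow> norm (B x) \<le> D * (1 / sqrt n) ^ a * norm x" using D[OF n] by blast
    have "norm (A x + B x) \<le> (C + D) * (1 / sqrt n) ^ a * norm x"
      if "x \<in> ocomp (V \<union> W)" for x
      using norm_triangle_ineq[of "A x" "B x"] V(3)[of x] W(3)[of x] that
      by (simp add: ocomp_Un distrib_right)
    moreover have "card (V \<union> W) \<le> (C + D) * n"
      using card_Un_le[of V W] V(2) W(2) by (simp add: distrib_right)
    ultimately show "\<exists>V. finite V \<and> card V \<le> (C + D) * n \<and>
        (\<forall>x\<in>ocomp V. norm (A x + B x) \<le> (C + D) * (1 / sqrt n) ^ a * norm x)"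
      using V(1) W(1) by (intro exI[of _ "V \<union> W"]) simp
  qed
qed

text \<open>Submultiplicativity of singular values: impose the test set of \<open>B\<close> on x and
  that of \<open>A\<close> on \<open>B x\<close>. The main use is 1 + 1 = 2, two factors of order
  n^(-1/2) giving order 1/n.\<close>

lemma decay_compose:
  fixes A B :: "'a::{real_inner,complete_space} \<Rightarrow> 'a"
  assumes A: "decay a A" and B: "decay b B"
  shows "decay (a + b) (\<lambda>x. A (B x))"
proof -
  note bl = decay_bounded_linear[OF A] decay_bounded_linear[OF B]
  obtain C where C: "\<And>n. 1 \<le> n \<Longrightarrow> \<exists>V. finite V \<and> card V \<le> C * n \<and>
        (\<forall>x\<in>ocomp V. norm (A x) \<le> C * (1 / sqrt n) ^ a * norm x)"
    using decayE[OF A] by blast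
  obtain D where D: "\<And>n. 1 \<le> n \<Longrightarrow> \<exists>V. finite V \<and> card V \<le> D * n \<and>
        (\<forall>x\<in>ocomp V. norm (B x) \<le> D * (1 / sqrt n) ^ b * norm x)"
    using decayE[OF B] by blast
  show ?thesis
  proof (rule decayI[where D = "C + D" and C = "C * D"])
    show "bounded_linear (\<lambda>x. A (B x))"
      using bl by (rule bounded_linear_compose)
    fix n :: nat assume n: "1 \<le> n"
    obtain V where V: "finite V" "card V \<le> C * n"
      "\<And>x. x\<in>ocomp V \<Longrightarrow> norm (A x) \<le> C * (1 / sqrt n) ^ a * norm x" using C[OF n] by blast
    obtain W where W: "finite W" "card W \<le> D * n"
      "\<And>x. x\<in>ocomp W \<Longrightarrow> norm (B x) \<le> D * (1 / sqrt n) ^ b * norm x" using D[OF n] by blast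
    have "norm (A (B x)) \<le> (C * D) * (1 / sqrt n) ^ (a + b) * norm x"
      if "x \<in> ocomp (adjoint B ` V \<union> W)" for x
    proof -
      have "norm (A (B x)) \<le> C * (1 / sqrt n) ^ a * norm (B x)"
        using V(3) that by (simp add: ocomp_Un ocomp_image_adjoint bl)
      also have "\<dots> \<le> C * (1 / sqrt n) ^ a * (D * (1 / sqrt n) ^ b * norm x)"
        using W(3) that by (intro mult_left_mono) (auto simp: ocomp_Un)
      finally show ?thesis by (simp add: power_add mult_ac)
    qed
    moreover have "card (adjoint B ` V \<union> W) \<le> (C + D) * n"
      using card_Un_le[of "adjoint B ` V" W] card_image_le[OF V(1), of "adjoint B"] V(2) W(2)
      by (simp add: distrib_right)
    ultimately show "\<exists>V. finite V \<and> card V \<le> (C + D) * n \<and>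
        (\<forall>x\<in>ocomp V. norm (A (B x)) \<le> (C * D) * (1 / sqrt n) ^ (a + b) * norm x)"
      using V(1) W(1) by (intro exI[of _ "adjoint B ` V \<union> W"]) simp
  qed
qed

lemma decay_compose_left:
  fixes A B :: "'a::{real_inner,complete_space} \<Rightarrow> 'a"
  shows "bounded_linear A \<Longrightarrow> decay b B \<Longrightarrow> decay b (\<lambda>x. A (B x))"
  using decay_compose[OF decay_0, of A b B] by simp

lemma decay_compose_right:
  fixes A B :: "'a::{real_inner,complete_space} \<Rightarrow> 'a"
  shows "decay a A \<Longrightarrow> bounded_linear B \<Longrightarrow> decay a (\<lambda>x. A (B x))"
  using decay_compose[OF _ decay_0, of a A B] by simp

lemma decay_minus:
  fixes A :: "'a::{real_inner,complete_space} \<Rightarrow> 'a"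
  shows "decay a A \<Longrightarrow> decay a (\<lambda>x. - A x)"
  by (rule decay_compose_left) (simp add: bounded_linear_minus[OF bounded_linear_ident])

lemma decay_diff:
  fixes A B :: "'a::{real_inner,complete_space} \<Rightarrow> 'a"
  shows "decay a A \<Longrightarrow> decay a B \<Longrightarrow> decay a (\<lambda>x. A x - B x)"
  using decay_add[OF _ decay_minus, of a A B] by simp

text \<open>If y is orthogonal to the image of V under A, then A^* y is orthogonal to V; the
  estimate for A applies to A^* y and bounds |A^* y|^2 = <A A^* y, y>.\<close>

lemma decay_adjoint:
  fixes A :: "'a::{real_inner,complete_space} \<Rightarrow> 'a"
  assumes A: "decay a A"
  shows "decay a (adjoint A)"
proof -
  note bl = decay_bounded_linear[OF A]
  obtain C where C: "\<And>n. 1 \<le> n \<Longrightarrow> \<exists>V. finite V \<and> card V \<le> C * n \<and>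
        (\<forall>x\<in>ocomp V. norm (A x) \<le> C * (1 / sqrt n) ^ a * norm x)"
    using decayE[OF A] by blast
  show ?thesis
  proof (rule decayI[where D = C and C = C])
    show "bounded_linear (adjoint A)"
      by (rule bounded_linear_adjoint[OF bl])
    fix n :: nat assume n: "1 \<le> n"
    obtain V where V: "finite V" "card V \<le> C * n"
      "\<And>x. x\<in>ocomp V \<Longrightarrow> norm (A x) \<le> C * (1 / sqrt n) ^ a * norm x" using C[OF n] by blast
    have "norm (adjoint A y) \<le> C * (1 / sqrt n) ^ a * norm y" if y: "y \<in> ocomp (A ` V)" for y
    proof (cases "adjoint A y = 0")
      case False
      have *: "adjoint A y \<in> ocomp V"
        using y by (auto simp: ocomp_def inner_adjoint bl)
      have "(norm (adjoint A y))\<^sup>2 = inner (A (adjoint A y)) y"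
        by (simp add: power2_norm_eq_inner inner_adjoint[OF bl])
      also have "\<dots> \<le> norm (A (adjoint A y)) * norm y"
        by (rule norm_cauchy_schwarz)
      also have "\<dots> \<le> (C * (1 / sqrt n) ^ a * norm (adjoint A y)) * norm y"
        using V(3)[OF *] by (rule mult_right_mono) simp
      finally have "norm (adjoint A y) * norm (adjoint A y)
          \<le> (C * (1 / sqrt n) ^ a * norm y) * norm (adjoint A y)"
        by (simp add: power2_eq_square mult_ac)
      then show ?thesis
        using False by (simp only: mult_le_cancel_right) simp
    qed simp
    moreover have "card (A ` V) \<le> C * n"
      using card_image_le[OF V(1), of A] V(2) by simp
    ultimately show "\<exists>V. finite V \<and> card V \<le> C * n \<and>
        (\<forall>x\<in>ocomp V. norm (adjoint A x) \<le> C * (1 / sqrt n) ^ a * norm x)"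
      using V(1) by (intro exI[of _ "A ` V"]) simp
  qed
qed

text \<open>Since |A x|^2 = <x, A^* A x>, an estimate for A^* A bounds the square of |A x| on the
  same test set.\<close>

lemma decay_sqrt:
  fixes A :: "'a::{real_inner,complete_space} \<Rightarrow> 'a"
  assumes A: "bounded_linear A" and d: "decay 2 (\<lambda>x. adjoint A (A x))"
  shows "decay 1 A"
proof -
  obtain C where C: "\<And>n. 1 \<le> n \<Longrightarrow> \<exists>V. finite V \<and> card V \<le> C * n \<and>
        (\<forall>x\<in>ocomp V. norm (adjoint A (A x)) \<le> C * (1 / sqrt n) ^ 2 * norm x)"
    using decayE[OF d] by blast
  show ?thesis
  proof (rule decayI[where D = C and C = "sqrt C", OF A])
    fix n :: nat assume n: "1 \<le> n"
    obtain V where V: "finite V" "card V \<le> C * n"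
      "\<And>x. x\<in>ocomp V \<Longrightarrow> norm (adjoint A (A x)) \<le> C * (1 / sqrt n) ^ 2 * norm x"
      using C[OF n] by blast
    have "norm (A x) \<le> sqrt C * (1 / sqrt n) ^ 1 * norm x" if "x \<in> ocomp V" for x
    proof -
      have "(norm (A x))\<^sup>2 = inner x (adjoint A (A x))"
        by (simp add: power2_norm_eq_inner inner_adjoint[OF A])
      also have "\<dots> \<le> norm x * (C * (1 / sqrt n) ^ 2 * norm x)"
        using norm_cauchy_schwarz[of x "adjoint A (A x)"] mult_left_mono[OF V(3)[OF that], of "norm x"]
        by simp
      also have "\<dots> = (sqrt C * (1 / sqrt n) ^ 1 * norm x)\<^sup>2"
        by (simp add: power2_eq_square power_mult_distrib)
      finally show ?thesis by (rule power2_le_imp_le) simp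
    qed
    then show "\<exists>V. finite V \<and> card V \<le> C * n \<and>
        (\<forall>x\<in>ocomp V. norm (A x) \<le> sqrt C * (1 / sqrt n) ^ 1 * norm x)"
      using V(1,2) by blast
  qed
qed

text \<open>The part of compactness that the Fredholm argument consumes.\<close>

lemma decay_small:
  assumes "decay 2 A" "0 < e"
  shows "\<exists>V. finite V \<and> (\<forall>x\<in>ocomp V. norm (A x) \<le> e * norm x)"
proof -
  obtain C where C: "\<And>n. 1 \<le> n \<Longrightarrow> \<exists>V. finite V \<and> card V \<le> C * n \<and>
        (\<forall>x\<in>ocomp V. norm (A x) \<le> C * (1 / sqrt n) ^ 2 * norm x)"
    using decayE[OF assms(1)] by blast
  obtain n :: nat where n: "C / e < n"
    using reals_Archimedean2 by blast
  have "1 \<le> Suc n" by simp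
  from C[OF this] obtain V where V: "finite V"
    "\<And>x. x\<in>ocomp V \<Longrightarrow> norm (A x) \<le> C * (1 / sqrt (Suc n)) ^ 2 * norm x" by blast
  have "C * (1 / sqrt (Suc n)) ^ 2 \<le> e"
    using n \<open>0 < e\<close> by (simp add: field_simps power2_eq_square)
  then have "norm (A x) \<le> e * norm x" if "x\<in>ocomp V" for x
    using V(2)[OF that] by (meson mult_right_mono norm_ge_zero order_trans)
  with V(1) show ?thesis by blast
qed

section \<open>Essential unitarity on subspaces\<close>

text \<open>\<open>T\<close> is bounded below on a subspace of finite codimension in \<open>L\<close>, hence has closed range there;
  since the kernel of \<open>T\<^sup>*\<close> is finite-dimensional, \<open>T\<^sup>*\<close> is bounded below off finitely many
  directions, and \<open>T\<^sup>* (I - T T\<^sup>*) = (I - T\<^sup>* T) T\<^sup>*\<close> gives the claim.\<close>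

lemma fredholm_defect:
  fixes T :: "'a::{real_inner,complete_space} \<Rightarrow> 'a"
  assumes L: "subspace L" "closed L" and T: "bounded_linear T"
    and TL: "\<And>x. T x \<in> L" "\<And>x. T (oproj L x) = T x"
    and K: "decay 2 (\<lambda>x. oproj L x - adjoint T (T x))"
    and ker: "finite V0" "\<And>x. x \<in> L \<Longrightarrow> adjoint T x = 0 \<Longrightarrow> x \<in> ocomp V0 \<Longrightarrow> x = 0"
  shows "decay 2 (\<lambda>x. oproj L x - T (adjoint T x))"
proof -
  note T' = bounded_linear_adjoint[OF T]
  note R = bounded_linear_oproj[OF L]
  note [simp] = inner_adjoint[OF T] inner_adjoint_left[OF T]
  let ?K = "\<lambda>x. oproj L x - adjoint T (T x)" and ?J = "\<lambda>x. oproj L x - T (adjoint T x)"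
  have RT: "oproj L (adjoint T x) = adjoint T x" for x
    by (rule vector_eq_ldot[THEN iffD1]) (simp add: oproj_inner[OF L, symmetric] TL)
  then have T'L: "adjoint T x \<in> L" for x
    by (simp add: oproj_eq_iff[OF L])
  have T'R: "adjoint T (oproj L x) = adjoint T x" for x
    by (rule vector_eq_ldot[THEN iffD1], rule allI)
      (metis oproj_inner[OF L] oproj_eq_iff[OF L] TL(1) inner_adjoint[OF T])
  \<comment> \<open>With the constant 1/2, |u|^2 - |T u|^2 is at most |u|^2 / 2 on
    \<open>L1\<close>, so \<open>T\<close> is bounded below there and its range \<open>R1\<close> is
    closed.\<close>
  obtain V1 where V1: "finite V1" "\<And>x. x \<in> ocomp V1 \<Longrightarrow> norm (?K x) \<le> 1/2 * norm x"
    using decay_small[OF K, of "1/2"] by auto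
  define L1 where "L1 = L \<inter> ocomp V1"
  have L1: "subspace L1" "closed L1"
    unfolding L1_def using L subspace_ocomp closed_ocomp by (auto intro: subspace_inter)
  have below: "norm u \<le> 2 * norm (T u)" if u: "u \<in> L1" for u
  proof -
    have "(norm u)\<^sup>2 - (norm (T u))\<^sup>2 = inner u (?K u)"
      using u oproj_eq_iff[OF L, of u]
      by (simp add: L1_def inner_diff_right power2_norm_eq_inner)
    also have "\<dots> \<le> norm u * (1/2 * norm u)"
      using u V1(2)[of u] by (intro order_trans[OF norm_cauchy_schwarz] mult_left_mono) (auto simp: L1_def)
    finally have "(norm u)\<^sup>2 \<le> 2 * (norm (T u))\<^sup>2"
      by (simp add: power2_eq_square)
    also have "\<dots> \<le> (2 * norm (T u))\<^sup>2"
      by (simp add: power2_eq_square)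
    finally show ?thesis by (rule power2_le_imp_le) simp
  qed
  define R1 where "R1 = T ` L1"
  have R1: "subspace R1" "closed R1"
  proof -
    show "subspace R1"
      unfolding R1_def using L1(1) bounded_linear.linear[OF T] by (intro linear_subspace_image)
    have "complete R1"
      unfolding R1_def using below L1 T
      by (intro complete_isometric_image[where e = "1/2"]) (auto simp: complete_eq_closed mult.commute)
    then show "closed R1"
      by (simp add: complete_eq_closed)
  qed
  have R1L: "R1 \<subseteq> L"
    using TL by (auto simp: R1_def)
  \<comment> \<open>The cokernel of \<open>T\<close> on \<open>L1\<close>. It is finite-dimensional:
    if x in \<open>F\<close> is orthogonal to \<open>V3\<close>, then T^* x lies in
    \<open>L1\<close>, so <T^* x, T^* x> = <T T^* x, x> = 0, and x is a kernel vector of T^*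
    orthogonal to \<open>V0\<close>.\<close>
  define F where "F = L \<inter> ocomp R1"
  have F: "subspace F" "closed F"
    unfolding F_def using L subspace_ocomp closed_ocomp by (auto intro: subspace_inter)
  define V3 where "V3 = T ` oproj L ` V1 \<union> V0"
  have F0: "x = 0" if x: "x \<in> F" "x \<in> ocomp V3" for x
  proof -
    have "inner v (adjoint T x) = 0" if "v \<in> V1" for v
    proof -
      have "inner (T (oproj L v)) x = 0"
        using x(2) that unfolding V3_def ocomp_def by blast
      then show ?thesis by (simp add: TL)
    qed
    then have "adjoint T x \<in> L1"
      using T'L by (auto simp: L1_def ocomp_def)
    then have "inner (adjoint T x) (adjoint T x) = 0"
      using x(1) by (auto simp: F_def ocomp_def R1_def)
    then have "adjoint T x = 0"
      using inner_eq_zero_iff by blast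
    then show ?thesis
      using ker(2)[of x] x by (auto simp: F_def V3_def ocomp_Un)
  qed
  \<comment> \<open>Orthogonality of y to \<open>V\<close> is orthogonality of its
    \<open>F\<close>-component to \<open>V3\<close>. That component therefore vanishes, which puts y
    into the range \<open>R1\<close>.\<close>
  define V where "V = oproj F ` V3"
  have bound: "norm y \<le> 2 * norm (adjoint T y)" if y: "y \<in> L" "y \<in> ocomp V" for y
  proof -
    have "oproj F y \<in> ocomp V3"
      using y(2) by (auto simp: V_def ocomp_def oproj_inner[OF F])
    then have "oproj F y = 0"
      using F0 oproj_in[OF F] by blast
    then have yF: "y \<in> ocomp F"
      by (simp add: oproj_eq_0_iff[OF F] ocomp_def)
    define z where "z = y - oproj R1 y"
    have "oproj R1 y \<in> R1"
      by (rule oproj_in[OF R1])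
    then have "z \<in> F"
      using y(1) R1L L(1) oproj_orth[OF R1] unfolding F_def z_def
      by (auto simp: ocomp_def inner_commute intro: subspace_diff)
    then have "inner z y = 0"
      using yF by (auto simp: ocomp_def)
    moreover have "inner z (oproj R1 y) = 0"
      unfolding z_def using oproj_orth[OF R1 oproj_in[OF R1]] .
    ultimately have "inner z z = 0"
      by (simp add: z_def inner_diff_right)
    then have "y \<in> R1"
      using oproj_in[OF R1, of y] by (simp add: z_def)
    then obtain u where u: "u \<in> L1" "y = T u"
      by (auto simp: R1_def)
    have "norm y * norm y = inner u (adjoint T y)"
      by (simp add: u(2) flip: power2_norm_eq_inner power2_eq_square)
    also have "\<dots> \<le> (2 * norm y) * norm (adjoint T y)"
      using below[OF u(1)] u(2) by (intro order_trans[OF norm_cauchy_schwarz] mult_right_mono) auto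
    finally show ?thesis
      by (cases "y = 0") (auto simp: mult_ac)
  qed
  have V_fin: "finite V"
    by (simp add: V_def V3_def V1 ker)
  have J: "bounded_linear ?J"
    using bounded_linear_compose[OF T T'] R by (rule bounded_linear_sub[rotated])
  have KT: "decay 2 (\<lambda>x. ?K (adjoint T x))"
    by (rule decay_compose_right[OF K T'])
  show ?thesis
  proof (rule decay_dominated[OF J KT, of "adjoint ?J ` V" 2])
    show "finite (adjoint ?J ` V)"
      using V_fin by simp
    fix x assume "x \<in> ocomp (adjoint ?J ` V)"
    then have "?J x \<in> ocomp V"
      by (simp add: ocomp_image_adjoint[OF J])
    moreover have "?J x \<in> L"
      using L(1) oproj_in[OF L] TL(1) by (intro subspace_diff)
    \<comment> \<open>Both sides are T^* x - T^* T T^* x. This intertwining carries the decay of I -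
      T^* T over to I - T T^*.\<close>
    moreover have "adjoint T (?J x) = ?K (adjoint T x)"
      by (simp add: linear_simps[OF T'] T'R RT)
    ultimately show "norm (?J x) \<le> 2 * norm (?K (adjoint T x))"
      using bound by metis
  qed
qed

section \<open>Compressions of an isometry to the complement of an invariant subspace\<close>

lemma csubspace_ocomp': "csubspace M \<Longrightarrow> csubspace (ocomp M)"
  by (rule csubspace_ocomp) (rule csubspace_scaleC)

text \<open>For an isometry this is the orthogonal projection onto the kernel of the adjoint; for a
  coordinate shift, onto the functions independent of that coordinate.\<close>

definition defect :: "('a::real_inner \<Rightarrow> 'a) \<Rightarrow> 'a \<Rightarrow> 'a" where
  "defect Z x = x - Z (adjoint Z x)"

text \<open>For the compression \<open>S\<close> of \<open>Z\<close> to the orthogonal complement of an invariant subspace,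
  \<open>I - S S\<^sup>*\<close> is the compression of \<open>I - Z Z\<^sup>*\<close>.\<close>

definition ess_unitary_on :: "('a::real_inner \<Rightarrow> 'a) \<Rightarrow> 'a set \<Rightarrow> bool" where
  "ess_unitary_on Z N \<longleftrightarrow> decay 2 (\<lambda>x. oproj N (defect Z (oproj N x))) \<and>
     decay 2 (\<lambda>x. oproj N x - oproj N (adjoint Z (oproj N (Z (oproj N x)))))"

lemma cop_defect: "cop Z \<Longrightarrow> cop (defect Z)"
  unfolding defect_def by (rule cop_minus_op[OF cop_id cop_compose[OF _ cop_adjoint]])

context
  fixes Z :: "'a::chilbert \<Rightarrow> 'a"
  assumes Z: "cop Z" and iso: "\<And>x. norm (Z x) = norm x"
begin

lemma adjoint_Z_Z: "adjoint Z (Z x) = x"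
  by (rule adjoint_isometry[OF cop_bounded_linear[OF Z] iso])

lemma norm_adjoint_Z: "norm (adjoint Z x) \<le> norm x"
  using norm_adjoint_le[OF cop_bounded_linear[OF Z], of 1 x] iso by simp

lemma defect_Z: "defect Z (Z x) = 0"
  by (simp add: defect_def adjoint_Z_Z)

lemma adjoint_Z_defect: "adjoint Z (defect Z x) = 0"
  by (simp add: defect_def adjoint_Z_Z cop_simps[OF cop_adjoint[OF Z]])

lemma defect_eq_iff: "defect Z x = x \<longleftrightarrow> adjoint Z x = 0"
  using adjoint_Z_defect[of x] by (auto simp: defect_def cop_simps[OF Z])

lemma defect_self_adjoint: "inner (defect Z x) y = inner x (defect Z y)"
  by (simp add: defect_def inner_diff_left inner_diff_right
      inner_adjoint[OF cop_bounded_linear[OF Z]] flip: inner_adjoint_left[OF cop_bounded_linear[OF Z]])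

lemma norm_defect: "(norm (defect Z x))\<^sup>2 = (norm x)\<^sup>2 - (norm (adjoint Z x))\<^sup>2"
proof -
  have "(norm (defect Z x))\<^sup>2 = inner x (defect Z (defect Z x))"
    by (simp add: power2_norm_eq_inner defect_self_adjoint)
  also have "\<dots> = inner x (defect Z x)"
    using adjoint_Z_defect[of x] by (simp add: defect_def cop_simps[OF Z])
  also have "\<dots> = (norm x)\<^sup>2 - (norm (adjoint Z x))\<^sup>2"
    by (simp add: defect_def inner_diff_right power2_norm_eq_inner
      inner_adjoint_left[OF cop_bounded_linear[OF Z]])
  finally show ?thesis .
qed

lemma norm_defect_le: "norm (defect Z x) \<le> norm x"
proof (rule power2_le_imp_le)
  show "(norm (defect Z x))\<^sup>2 \<le> (norm x)\<^sup>2" by (simp add: norm_defect)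
qed simp

lemma adjoint_Z_ocomp:
  assumes M: "\<And>x. x \<in> M \<Longrightarrow> Z x \<in> M" and x: "x \<in> ocomp M"
  shows "adjoint Z x \<in> ocomp M"
  using x M by (auto simp: ocomp_def inner_adjoint[OF cop_bounded_linear[OF Z]])

text \<open>\<open>fredholm_defect\<close> is applied to the adjoint \<open>T\<close> of the
  compression S, since I - S S^* is the known quantity: with D the defect and Q the projection onto
  N it equals (D Q)^* (D Q), the square of an operator of rate n^(-1/2). Injectivity of S makes the
  kernel condition hold with no exceptional directions.\<close>

lemma ess_unitary_on_principal:
  assumes M: "csubspace M" "\<And>x. x \<in> M \<Longrightarrow> Z x \<in> M"
    and d: "decay 1 (\<lambda>x. defect Z (oproj (ocomp M) x))"
    and inj: "\<And>x. x \<in> ocomp M \<Longrightarrow> Z x \<in> M \<Longrightarrow> x = 0"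
  shows "ess_unitary_on Z (ocomp M)"
proof -
  define N where "N = ocomp M"
  have N: "csubspace N" "subspace N" "closed N"
    using M(1) using csubspace_ocomp'[of M] by (auto simp: N_def subspace_ocomp closed_ocomp)
  note P = cop_oproj[OF N(1)] and P' = oproj_idem[OF N(2,3)] oproj_in[OF N(2,3)]
  note bl = cop_bounded_linear[OF Z] cop_bounded_linear[OF P] cop_bounded_linear[OF cop_defect[OF Z]]
  have "decay 2 (\<lambda>x. oproj N (defect Z (defect Z (oproj N x))))"
  proof -
    have "adjoint (\<lambda>x. defect Z (oproj N x)) = (\<lambda>x. oproj N (defect Z x))"
      by (rule adjoint_eqI) (simp add: defect_self_adjoint oproj_inner[OF N(2,3)])
    then show ?thesis
      using decay_compose[OF decay_adjoint[OF d] d] by (simp add: N_def numeral_2_eq_2)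
  qed
  then have d2: "decay 2 (\<lambda>x. oproj N (defect Z (oproj N x)))"
    using adjoint_Z_defect by (simp add: defect_def cop_simps[OF Z])
  define T where "T = (\<lambda>x. adjoint Z (oproj N x))"
  have TN: "T x \<in> N" for x
    unfolding T_def using adjoint_Z_ocomp M(2) P' N_def by blast
  have T: "bounded_linear T"
    unfolding T_def by (intro bounded_linear_compose[OF bounded_linear_adjoint] bl)
  have T': "adjoint T = (\<lambda>x. oproj N (Z x))"
    unfolding T_def
    by (rule adjoint_eqI) (simp add: inner_adjoint_left[OF bl(1)] oproj_inner[OF N(2,3)])
  have d3: "decay 2 (\<lambda>x. oproj N x - T (adjoint T x))"
  proof (rule fredholm_defect[OF N(2,3) T TN, of "{}"])
    show "T (oproj N x) = T x" for x
      by (simp add: T_def P')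
    have "(\<lambda>x. oproj N x - adjoint T (T x)) = (\<lambda>x. oproj N (defect Z (oproj N x)))"
      unfolding T' by (rule ext) (simp add: T_def defect_def cop_simps[OF P] P')
    then show "decay 2 (\<lambda>x. oproj N x - adjoint T (T x))"
      using d2 by simp
    show "x = 0" if "x \<in> N" "adjoint T x = 0" for x
    proof -
      have "oproj M (Z x) = Z x"
        using that(2) oproj_ocomp[of M "Z x"] M(1) by (simp add: T' N_def csubspace_def)
      then show ?thesis
        using inj[of x] that(1) M(1) oproj_eq_iff[of M "Z x"] by (simp add: N_def csubspace_def)
    qed
  qed simp
  have "decay 2 (\<lambda>x. oproj N x - T (adjoint T (oproj N x)))"
    using decay_compose_right[OF d3 bl(2)] by (simp add: P')
  moreover have "T (adjoint T (oproj N x)) = oproj N (adjoint Z (oproj N (Z (oproj N x))))" for x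
  proof -
    have "oproj N (T (Z (oproj N x))) = T (Z (oproj N x))"
      using TN oproj_eq_iff[OF N(2,3)] by blast
    then show ?thesis unfolding T' by (simp add: T_def P')
  qed
  ultimately show ?thesis
    using d2 by (simp add: ess_unitary_on_def N_def)
qed

text \<open>Split N0 orthogonally into L = M \<inter> N0 and N. As Z maps M into M, the compression
  to N0 is triangular for this splitting, with diagonal block \<open>T\<close> on L and corner
  \<open>adjoint X\<close>. The Fredholm lemma for \<open>T\<close> controls I - T T^*; this
  controls X^* X and hence X; and X X^* is exactly the error between I - S^* S on N and the
  compression of its analogue on N0. The set \<open>F\<close> bounds the cokernel of
  \<open>T\<close>.\<close>

lemma ess_unitary_on_larger:
  assumes M0: "csubspace M0" "\<And>x. x \<in> M0 \<Longrightarrow> Z x \<in> M0"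
    and M: "csubspace M" "\<And>x. x \<in> M \<Longrightarrow> Z x \<in> M" and le: "M0 \<subseteq> M"
    and eu: "ess_unitary_on Z (ocomp M0)"
    and F: "finite F" "\<And>x. x \<in> M \<Longrightarrow> x \<in> ocomp M0 \<Longrightarrow> x \<in> ocomp (Z ` M) \<Longrightarrow> x \<in> ocomp F \<Longrightarrow> x = 0"
  shows "ess_unitary_on Z (ocomp M)"
proof -
  define N0 where "N0 = ocomp M0"
  define N where "N = ocomp M"
  define L where "L = M \<inter> N0"
  have N0: "csubspace N0" "subspace N0" "closed N0"
    using M0(1) using csubspace_ocomp'[of M0] by (auto simp: N0_def subspace_ocomp closed_ocomp)
  have N: "csubspace N" "subspace N" "closed N"
    using M(1) using csubspace_ocomp'[of M] by (auto simp: N_def subspace_ocomp closed_ocomp)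
  have L: "csubspace L" "subspace L" "closed L"
    using M(1) N0(1) by (auto simp: L_def csubspace_def intro: subspace_inter)
  have NN0: "N \<subseteq> N0"
    using le by (auto simp: N_def N0_def ocomp_def)
  define P where "P = oproj N0"
  define Q where "Q = oproj N"
  define R where "R = oproj L"
  have cops: "cop P" "cop Q" "cop R" "cop Z" "cop (adjoint Z)"
    using N0 N L Z by (auto simp: P_def Q_def R_def intro: cop_oproj cop_adjoint)
  have bl: "bounded_linear P" "bounded_linear Q" "bounded_linear R" "bounded_linear Z" "bounded_linear (adjoint Z)"
    using cops cop_bounded_linear by auto
  have PQ: "P (Q x) = Q x" for x
    using NN0 oproj_in[OF N(2,3), of x] by (auto simp: P_def Q_def oproj_eq_iff[OF N0(2,3)])
  have QP: "Q (P x) = Q x" for x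
    by (rule vector_eq_ldot[THEN iffD1])
      (metis PQ P_def Q_def oproj_inner[OF N(2,3)] oproj_inner[OF N0(2,3)])
  have R_eq: "R x = P x - Q x" for x
    unfolding R_def
  proof (rule oproj_unique[OF L(2,3)])
    have "P x - Q x \<in> N0"
      using NN0 oproj_in[OF N(2,3)] oproj_in[OF N0(2,3)] N0(2)
      by (auto simp: P_def Q_def intro!: subspace_diff)
    moreover have "oproj M (P x - Q x) = P x - Q x"
      using oproj_ocomp[of M "P x - Q x"] M(1) cop_diff[OF cops(2)] QP oproj_idem[OF N(2,3)]
      by (auto simp: csubspace_def Q_def N_def)
    then have "P x - Q x \<in> M"
      using M(1) oproj_eq_iff by (auto simp: csubspace_def)
    ultimately show "P x - Q x \<in> L" by (simp add: L_def)
    fix h assume h: "h \<in> L"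
    have "inner (Q x) h = 0"
      using h oproj_in[OF N(2,3), of x] by (auto simp: L_def N_def Q_def ocomp_def inner_commute)
    moreover have "inner (x - P x) h = 0"
      using h unfolding P_def by (intro oproj_orth[OF N0(2,3)]) (auto simp: L_def)
    ultimately show "inner (x - (P x - Q x)) h = 0"
      by (simp add: inner_diff_left)
  qed
  have idem: "P (P x) = P x" "Q (Q x) = Q x" "R (R x) = R x" for x
    by (simp_all add: P_def Q_def R_def oproj_idem L N N0)
  have rel: "P (R x) = R x" "R (P x) = R x" "Q (R x) = 0" "R (Q x) = 0" for x
    by (simp_all add: R_eq cop_diff[OF cops(1)] cop_diff[OF cops(2)] PQ QP idem)
  have sa: "inner (P x) y = inner x (P y)" "inner (Q x) y = inner x (Q y)" "inner (R x) y = inner x (R y)" for x y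
    by (simp_all add: P_def Q_def R_def oproj_inner L N N0)
  have Z'P: "P (adjoint Z (P x)) = adjoint Z (P x)" for x
    using adjoint_Z_ocomp[OF M0(2), of "P x"] oproj_in[OF N0(2,3)]
    by (auto simp: P_def N0_def[symmetric] oproj_eq_iff[OF N0(2,3)])
  have Z'Q: "Q (adjoint Z (Q x)) = adjoint Z (Q x)" for x
    using adjoint_Z_ocomp[OF M(2), of "Q x"] oproj_in[OF N(2,3)]
    by (auto simp: Q_def N_def[symmetric] oproj_eq_iff[OF N(2,3)])
  have RM: "R x \<in> M" for x
    using oproj_in[OF L(2,3)] by (auto simp: R_def L_def)
  then have QZR: "Q (Z (R x)) = 0" for x
    using M(2)[of "R x"] unfolding Q_def oproj_eq_0_iff[OF N(2,3)] by (auto simp: N_def ocomp_def inner_commute)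
  have eu1: "decay 2 (\<lambda>x. P (defect Z (P x)))" and eu2: "decay 2 (\<lambda>x. P x - P (adjoint Z (P (Z (P x)))))"
    using eu by (auto simp: ess_unitary_on_def P_def N0_def)
  define T where "T = (\<lambda>x. R (Z (R x)))"
  define X where "X = (\<lambda>x. Q (adjoint Z (R x)))"
  have T: "bounded_linear T" and X: "bounded_linear X"
    using bounded_linear_compose[OF bl(3) bounded_linear_compose[OF bl(4) bl(3)]]
      bounded_linear_compose[OF bl(2) bounded_linear_compose[OF bl(5) bl(3)]]
    by (simp_all add: T_def X_def)
  have T': "adjoint T = (\<lambda>x. R (adjoint Z (R x)))"
    unfolding T_def by (rule adjoint_eqI) (simp add: sa inner_adjoint[OF bl(4), symmetric])
  have X': "adjoint X = (\<lambda>x. R (Z (Q x)))"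
    unfolding X_def by (rule adjoint_eqI) (simp add: sa inner_adjoint_left[OF bl(4)])
  have 1: "decay 2 (\<lambda>x. R x - adjoint T (T x))"
  proof -
    have "R x - adjoint T (T x) = R (P (R x) - P (adjoint Z (P (Z (P (R x))))))" for x
    proof -
      have "P (Z (R x)) = R (Z (R x))"
        using QZR[of x] by (simp add: R_eq[of "Z (R x)"])
      then show ?thesis
        unfolding T' by (simp add: T_def rel idem cop_diff[OF cops(3)])
    qed
    then show ?thesis
      using decay_compose_left[OF bl(3) decay_compose_right[OF eu2 bl(3)]] by simp
  qed
  have 2: "decay 2 (\<lambda>x. R x - T (adjoint T x))"
    unfolding R_def
  proof (rule fredholm_defect[OF L(2,3) T _ _ 1[unfolded R_def] F(1)])
    show "T x \<in> L" "T (oproj L x) = T x" for x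
      using oproj_in[OF L(2,3)] idem by (auto simp: T_def R_def)
    fix x assume x: "x \<in> L" "adjoint T x = 0" "x \<in> ocomp F"
    have Rx: "R x = x"
      using x(1) by (simp add: R_def oproj_eq_iff[OF L(2,3)])
    \<comment> \<open>An element of M is an element of M0 plus one of L. Here x is orthogonal to Z
      M0 as a member of N0, and to Z L because T^* x = 0.\<close>
    have Q0: "inner (Z y) x = 0" if y: "y \<in> M" for y
    proof -
      have "y - P y \<in> M0"
        using M0(1) oproj_ocomp[of M0 y] oproj_in[of M0 y] by (auto simp: P_def N0_def csubspace_def)
      then have "inner (Z (y - P y)) x = 0"
        using M0(2) x(1) by (auto simp: L_def N0_def ocomp_def)
      moreover have "Q y = 0"
        using y unfolding Q_def oproj_eq_0_iff[OF N(2,3)] by (auto simp: N_def ocomp_def inner_commute)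
      then have "P y = R y" by (simp add: R_eq)
      moreover have "inner (Z (R y)) x = 0"
        using x(2) Rx sa(3)[of y "adjoint Z x"] by (simp add: T' inner_adjoint[OF bl(4)])
      ultimately show ?thesis
        by (simp add: cop_diff[OF cops(4)] inner_diff_left)
    qed
    then show "x = 0"
      using F(2)[of x] x by (auto simp: L_def N0_def ocomp_def)
  qed
  have 3: "decay 1 X"
  proof (rule decay_sqrt[OF X])
    have "adjoint X (X x) = (R x - T (adjoint T x)) - R (P (defect Z (P (R x))))" for x
    proof -
      have "adjoint Z (R x) = P (adjoint Z (R x))"
        using Z'P[of "R x"] by (simp add: rel)
      then have "Q (X x) = adjoint Z (R x) - R (adjoint Z (R x))"
        by (simp add: X_def idem R_eq[of "adjoint Z (R x)"])
      then show ?thesis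
        unfolding T' X'
        by (simp add: T_def rel idem defect_def cop_diff[OF cops(3)] cop_diff[OF cops(4)])
    qed
    then show "decay 2 (\<lambda>x. adjoint X (X x))"
      using decay_diff[OF 2 decay_compose_left[OF bl(3) decay_compose_right[OF eu1 bl(3)]]] by simp
  qed
  have 4: "decay 2 (\<lambda>x. X (adjoint X x))"
    using decay_compose[OF 3 decay_adjoint[OF 3]] by (simp add: numeral_2_eq_2)
  have "Q x - Q (adjoint Z (Q (Z (Q x)))) = Q (P (Q x) - P (adjoint Z (P (Z (P (Q x)))))) + X (adjoint X x)" for x
  proof -
    have "P (Z (Q x)) = Q (Z (Q x)) + R (Z (Q x))"
      by (simp add: R_eq[of "Z (Q x)"])
    then show ?thesis
      unfolding X' by (simp add: X_def PQ QP idem cop_diff[OF cops(2)] cop_add[OF cops(2)] cop_add[OF cops(5)] rel)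
  qed
  then have "decay 2 (\<lambda>x. Q x - Q (adjoint Z (Q (Z (Q x)))))"
    using decay_add[OF decay_compose_left[OF bl(2) decay_compose_right[OF eu2 bl(2)]] 4] by simp
  moreover have "decay 2 (\<lambda>x. Q (defect Z (Q x)))"
    using decay_compose_left[OF bl(2) decay_compose_right[OF eu1 bl(2)]] by (simp add: PQ QP)
  ultimately show ?thesis
    by (simp add: ess_unitary_on_def Q_def N_def)
qed

end

section \<open>Blaschke functions of an isometry\<close>

text \<open>The inverse of I - A for a strict contraction A, obtained as a Banach fixed point
  instead of a sum of powers.\<close>

definition neumann :: "('a::chilbert \<Rightarrow> 'a) \<Rightarrow> 'a \<Rightarrow> 'a" where
  "neumann A y = (THE x. x - A x = y)"

context
  fixes A :: "'a::chilbert \<Rightarrow> 'a" and k :: real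
  assumes A: "cop A" and le: "\<And>x. norm (A x) \<le> k * norm x" and k: "0 \<le> k" "k < 1"
begin

lemma neumann_ex1: "\<exists>!x. x - A x = y"
proof -
  have "\<exists>!x. y + A x = x"
    using le by (intro banach_fix_type[OF k]) (simp add: dist_norm flip: cop_diff[OF A])
  moreover have "y + A x = x \<longleftrightarrow> x - A x = y" for x
    by (metis add_diff_cancel_right' diff_add_cancel)
  ultimately show ?thesis by simp
qed

lemma neumann_eq: "neumann A y - A (neumann A y) = y"
  unfolding neumann_def by (rule theI'[OF neumann_ex1])

lemma neumann_unique: "x - A x = y \<Longrightarrow> neumann A y = x"
  unfolding neumann_def by (rule the1_equality[OF neumann_ex1])

lemma norm_neumann: "(1 - k) * norm (neumann A y) \<le> norm y"
  using norm_triangle_ineq2[of "neumann A y" "A (neumann A y)"] le[of "neumann A y"]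
  by (simp add: neumann_eq algebra_simps)

lemma cop_neumann: "cop (neumann A)"
  unfolding cop_def
proof safe
  have add: "neumann A (x + y) = neumann A x + neumann A y" for x y
    by (rule neumann_unique) (simp add: cop_add[OF A] add_diff_add neumann_eq)
  have scale: "neumann A (c *\<^sub>C x) = c *\<^sub>C neumann A x" for c x
    by (rule neumann_unique) (simp add: cop_scaleC[OF A] neumann_eq flip: scaleC_diff_right)
  then show "neumann A (c *\<^sub>C x) = c *\<^sub>C neumann A x" for c x .
  show "bounded_linear (neumann A)"
  proof (rule bounded_linear_intro[where K = "1 / (1 - k)"])
    show "neumann A (r *\<^sub>R x) = r *\<^sub>R neumann A x" for r x
      using scale[of "of_real r" x] by (simp add: scaleC_of_real)
    show "norm (neumann A x) \<le> norm x * (1 / (1 - k))" for x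
      using norm_neumann[of x] k by (simp add: field_simps)
  qed (rule add)
qed

lemma neumann_commute:
  assumes B: "cop B" and c: "\<And>x. B (A x) = A (B x)"
  shows "B (neumann A y) = neumann A (B y)"
proof -
  have "B (neumann A y) - A (B (neumann A y)) = B y"
    by (simp add: neumann_eq flip: c cop_diff[OF B])
  then show ?thesis
    by (rule neumann_unique[symmetric])
qed

end

text \<open>The operator (Z - a)(I - cnj a Z)^(-1), a single Blaschke factor applied to Z. The
  substitution y = x - cnj a Z x removes the inverse, and most properties are proved in the variable
  x.\<close>

definition mobius :: "complex \<Rightarrow> ('a::chilbert \<Rightarrow> 'a) \<Rightarrow> 'a \<Rightarrow> 'a" where
  "mobius a Z y = (let x = neumann (\<lambda>x. cnj a *\<^sub>C Z x) y in Z x - a *\<^sub>C x)"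

context
  fixes Z :: "'a::chilbert \<Rightarrow> 'a" and a :: complex
  assumes Z: "cop Z" and iso: "\<And>x. norm (Z x) = norm x" and a: "cmod a < 1"
begin

private lemma prem:
  "cop (\<lambda>x. cnj a *\<^sub>C Z x)" "norm (cnj a *\<^sub>C Z x) \<le> cmod a * norm x" "0 \<le> cmod a" "cmod a < 1"
  using Z a iso by (simp_all add: cop_scale)

lemmas mobius_neumann_eq = neumann_eq[OF prem]
  and mobius_neumann_unique = neumann_unique[OF prem]
  and cop_mobius_neumann = cop_neumann[OF prem]
  and mobius_neumann_commute = neumann_commute[OF prem]

lemma mobius_mult: "mobius a Z (x - cnj a *\<^sub>C Z x) = Z x - a *\<^sub>C x"
  using mobius_neumann_unique[of x] by (simp add: mobius_def)

lemma cop_mobius: "cop (mobius a Z)"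
  unfolding mobius_def Let_def
  by (rule cop_minus_op[OF cop_compose[OF Z cop_mobius_neumann] cop_scale[OF cop_mobius_neumann]])

text \<open>As |Z x| = |x|, both |Z x - a x|^2 and |x - cnj a Z x|^2 expand to (1 + |a|^2) |x|^2
  minus twice the same inner product.\<close>

lemma norm_mobius: "norm (mobius a Z y) = norm y"
proof -
  define x where "x = neumann (\<lambda>x. cnj a *\<^sub>C Z x) y"
  have y: "y = x - cnj a *\<^sub>C Z x"
    by (simp add: x_def mobius_neumann_eq)
  have n: "(norm (p - q))\<^sup>2 = (norm p)\<^sup>2 + (norm q)\<^sup>2 - 2 * inner p q" for p q :: 'a
    by (simp add: power2_norm_eq_inner inner_diff_left inner_diff_right inner_commute)
  have "inner (Z x) (a *\<^sub>C x) = inner x (cnj a *\<^sub>C Z x)"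
    by (simp add: inner_scaleC_right[of "Z x"] inner_commute)
  then have "(norm (Z x - a *\<^sub>C x))\<^sup>2 = (norm (x - cnj a *\<^sub>C Z x))\<^sup>2"
    by (simp add: n iso)
  then show ?thesis
    by (simp add: y mobius_mult)
qed

lemma mobius_commute:
  assumes B: "cop B" and c: "\<And>x. B (Z x) = Z (B x)"
  shows "B (mobius a Z y) = mobius a Z (B y)"
  using mobius_neumann_commute[OF B, of y] c
  by (simp add: mobius_def Let_def cop_diff[OF B] cop_scaleC[OF B])

text \<open>The defect kills the range of Z, so of (z - a)/(1 - cnj a z) only the value -a at z = 0
  survives.\<close>

lemma defect_mobius: "defect Z (mobius a Z y) = (- a) *\<^sub>C defect Z y"
proof -
  define x where "x = neumann (\<lambda>x. cnj a *\<^sub>C Z x) y"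
  have y: "y = x - cnj a *\<^sub>C Z x"
    by (simp add: x_def mobius_neumann_eq)
  note D = cop_defect[OF Z]
  show ?thesis
    unfolding y mobius_mult
    by (simp add: cop_diff[OF D] cop_scaleC[OF D] defect_Z[OF Z iso] scaleC_minus_left)
qed

text \<open>\<open>f\<close> stands for a point evaluation: a functional that turns Z into
  multiplication by the number z.\<close>

lemma eval_mobius:
  fixes f :: "'a \<Rightarrow> complex"
  assumes "\<And>x y. f (x - y) = f x - f y" "\<And>c x. f (c *\<^sub>C x) = c * f x" "\<And>x. f (Z x) = z * f x"
    and z: "cmod z < 1"
  shows "f (mobius a Z y) = (z - a) / (1 - cnj a * z) * f y"
proof -
  define x where "x = neumann (\<lambda>x. cnj a *\<^sub>C Z x) y"
  have y: "y = x - cnj a *\<^sub>C Z x"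
    by (simp add: x_def mobius_neumann_eq)
  have "cmod (cnj a * z) < 1"
    using a z mult_strict_mono[of "cmod a" 1 "cmod z" 1] by (simp add: norm_mult)
  then have "1 - cnj a * z \<noteq> 0" by auto
  then show ?thesis
    unfolding y mobius_mult by (simp add: assms(1-3)) (simp add: field_simps)
qed

end

primrec blop :: "('a::chilbert \<Rightarrow> 'a) \<Rightarrow> complex list \<Rightarrow> 'a \<Rightarrow> 'a" where
  "blop Z [] x = x"
| "blop Z (a # as) x = mobius a Z (blop Z as x)"

context
  fixes Z :: "'a::chilbert \<Rightarrow> 'a" and as :: "complex list"
  assumes Z: "cop Z" and iso: "\<And>x. norm (Z x) = norm x" and as: "\<forall>a\<in>set as. cmod a < 1"
begin

lemma cop_blop: "cop (blop Z as)"
  using as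
proof (induction as)
  case Nil
  have "blop Z [] = (\<lambda>x. x)" by auto
  then show ?case using cop_id by simp
next
  case (Cons a as)
  have "blop Z (a # as) = (\<lambda>x. mobius a Z (blop Z as x))" by auto
  then show ?case using Cons cop_compose[OF cop_mobius[OF Z iso]] by simp
qed

lemma norm_blop: "norm (blop Z as x) = norm x"
  using as by (induction as) (auto simp: norm_mobius[OF Z iso])

lemma blop_commute:
  assumes "cop B" "\<And>x. B (Z x) = Z (B x)"
  shows "B (blop Z as y) = blop Z as (B y)"
  using as by (induction as) (auto simp: mobius_commute[OF Z iso _ assms])

lemma defect_blop: "defect Z (blop Z as y) = (\<Prod>a\<leftarrow>as. - a) *\<^sub>C defect Z y"
  using as by (induction as) (auto simp: defect_mobius[OF Z iso])

lemma eval_blop: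
  fixes f :: "'a \<Rightarrow> complex"
  assumes "\<And>x y. f (x - y) = f x - f y" "\<And>c x. f (c *\<^sub>C x) = c * f x" "\<And>x. f (Z x) = z * f x"
    and "cmod z < 1"
  shows "f (blop Z as y) = (\<Prod>a\<leftarrow>as. (z - a) / (1 - cnj a * z)) * f y"
  using as by (induction as) (auto simp: eval_mobius[OF Z iso _ assms] mult.assoc)

end

text \<open>The product is the value at 0 of the Blaschke product with zeros \<open>as\<close>.
  Being nonconstant matters here, in the form of a nonempty list.\<close>

lemma norm_prod_list_less_1:
  "as \<noteq> [] \<Longrightarrow> \<forall>a\<in>set as. cmod a < 1 \<Longrightarrow> cmod (\<Prod>a\<leftarrow>as. - a) < 1"
proof (induction as)
  case (Cons a as)
  show ?case
  proof (cases "as = []")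
    case False
    then have "cmod a * cmod (\<Prod>a\<leftarrow>as. - a) < 1 * 1"
      using Cons by (intro mult_strict_mono) auto
    then show ?thesis by (simp add: norm_mult)
  qed (use Cons in auto)
qed simp

section \<open>The defect on a homogeneous quotient\<close>

primrec gprod :: "('a::chilbert \<Rightarrow> 'a) \<Rightarrow> ('a \<Rightarrow> 'a) \<Rightarrow> complex list \<Rightarrow> 'a \<Rightarrow> 'a" where
  "gprod U V [] x = x"
| "gprod U V (\<alpha> # \<alpha>s) x = U (gprod U V \<alpha>s x) - \<alpha> *\<^sub>C V (gprod U V \<alpha>s x)"

lemma cop_gprod: "cop U \<Longrightarrow> cop V \<Longrightarrow> cop (gprod U V \<alpha>s)"
proof (induction \<alpha>s)
  case Nil
  have "gprod U V [] = (\<lambda>x. x)" by auto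
  then show ?case using cop_id by simp
next
  case (Cons \<alpha> \<alpha>s)
  have "gprod U V (\<alpha> # \<alpha>s) = (\<lambda>x. U (gprod U V \<alpha>s x) - \<alpha> *\<^sub>C V (gprod U V \<alpha>s x))" by auto
  then show ?case
    using cop_minus_op[OF cop_compose cop_scale[OF cop_compose], of U "gprod U V \<alpha>s" V "gprod U V \<alpha>s" \<alpha>] Cons
    by simp
qed

lemma gprod_commute:
  assumes B: "cop B" and c: "\<And>x. B (U x) = U (B x)" "\<And>x. B (V x) = V (B x)"
  shows "B (gprod U V \<alpha>s x) = gprod U V \<alpha>s (B x)"
  by (induction \<alpha>s) (auto simp: cop_simps[OF B] c)

text \<open>Adjoints reverse the order of the factors; commutation of U and V restores it.\<close>

lemma adjoint_gprod:
  assumes U: "cop U" and V: "cop V" and UV: "\<And>x. U (V x) = V (U x)"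
  shows "inner (gprod U V \<alpha>s x) y = inner x (gprod (adjoint U) (adjoint V) (map cnj \<alpha>s) y)"
proof (induction \<alpha>s arbitrary: y)
  case (Cons \<alpha> \<alpha>s)
  note bl = cop_bounded_linear[OF U] cop_bounded_linear[OF V]
  note U' = cop_adjoint[OF U] and V' = cop_adjoint[OF V]
  have comm: "adjoint U (adjoint V x) = adjoint V (adjoint U x)" for x
    using adjoint_commute[OF bl(2,1) bl(1,2)] UV by metis
  define B where "B = (\<lambda>y. adjoint U y - cnj \<alpha> *\<^sub>C adjoint V y)"
  have B: "cop B"
    unfolding B_def by (intro cop_minus_op cop_scale U' V')
  have "inner (gprod U V (\<alpha> # \<alpha>s) x) y = inner (gprod U V \<alpha>s x) (B y)"
    by (simp add: inner_diff_left inner_diff_right B_def inner_scaleC_left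
        inner_adjoint[OF bl(1), symmetric] inner_adjoint[OF bl(2), symmetric] cop_scaleC[OF V'])
  also have "\<dots> = inner x (gprod (adjoint U) (adjoint V) (map cnj \<alpha>s) (B y))"
    by (rule Cons)
  also have "gprod (adjoint U) (adjoint V) (map cnj \<alpha>s) (B y) =
      B (gprod (adjoint U) (adjoint V) (map cnj \<alpha>s) y)"
    by (rule gprod_commute[OF B, symmetric])
      (simp_all add: B_def comm cop_simps[OF U'] cop_simps[OF V'])
  finally show ?case by (simp add: B_def)
qed simp

text \<open>U - \<alpha> V = -\<alpha> (V - (1/\<alpha>) U): exchanging the two variables changes
  the product by a nonzero scalar only, so the argument for one coordinate serves the other.\<close>

lemma gprod_swap:
  assumes U: "cop U" and V: "cop V" and \<alpha>s: "0 \<notin> set \<alpha>s"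
  shows "\<exists>k. k \<noteq> 0 \<and> (\<forall>x. gprod U V \<alpha>s x = k *\<^sub>C gprod V U (map inverse \<alpha>s) x)"
  using \<alpha>s
proof (induction \<alpha>s)
  case (Cons \<alpha> \<alpha>s)
  then obtain k where k: "k \<noteq> 0" "\<And>x. gprod U V \<alpha>s x = k *\<^sub>C gprod V U (map inverse \<alpha>s) x"
    by auto
  have "gprod U V (\<alpha> # \<alpha>s) x = (- \<alpha> * k) *\<^sub>C gprod V U (map inverse (\<alpha> # \<alpha>s)) x" for x
  proof -
    have "\<alpha> * k * inverse \<alpha> = k"
      using Cons.prems by (simp add: field_simps)
    then have "(\<alpha> * k * inverse \<alpha>) *\<^sub>C y = k *\<^sub>C y" for y :: 'a by (simp only:)
    then show ?thesis
      by (simp add: k(2) cop_scaleC[OF U] cop_scaleC[OF V] scaleC_diff_right scaleC_minus_left)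
  qed
  moreover have "- \<alpha> * k \<noteq> 0" using k(1) Cons.prems by auto
  ultimately show ?case by blast
qed (auto intro: exI[of _ 1])

lemma range_gprod_swap:
  assumes U: "cop U" and V: "cop V" and \<alpha>s: "0 \<notin> set \<alpha>s"
  shows "range (gprod U V \<alpha>s) = range (gprod V U (map inverse \<alpha>s))"
proof -
  obtain k where k: "k \<noteq> 0" "\<And>x. gprod U V \<alpha>s x = k *\<^sub>C gprod V U (map inverse \<alpha>s) x"
    using gprod_swap[OF assms] by blast
  note G = cop_scaleC[OF cop_gprod[OF V U]]
  have "gprod U V \<alpha>s x \<in> range (gprod V U (map inverse \<alpha>s))" for x
    by (rule image_eqI[where x = "k *\<^sub>C x"]) (simp_all add: k(2) G)
  moreover have "gprod V U (map inverse \<alpha>s) x \<in> range (gprod U V \<alpha>s)" for x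
    by (rule image_eqI[where x = "inverse k *\<^sub>C x"]) (simp_all add: k G)
  ultimately show ?thesis by blast
qed

lemma sum_defect_bound:
  fixes U D :: "'a::chilbert \<Rightarrow> 'a"
  assumes U: "cop U" and iso: "\<And>x. norm (U x) = norm x"
    and D: "cop D" and D1: "\<And>x. norm (D x) \<le> norm x"
    and DU: "\<And>x. D (U x) = b *\<^sub>C D x" and b: "cmod b < 1"
  shows "\<exists>c\<ge>0. \<forall>y m. (\<Sum>j=1..m. (norm (D ((adjoint U ^^ j) y)))\<^sup>2) \<le> c * (norm y)\<^sup>2"
proof (intro exI conjI allI)
  define \<beta> where "\<beta> = cmod b"
  have \<beta>: "0 \<le> \<beta>" "\<beta> < 1" using b by (auto simp: \<beta>_def)
  \<comment> \<open>Comes from solving (1 - \<beta>) S \<le> (\<beta> + 1/(1 - \<beta>)) |y|^2 for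
    S.\<close>
  let ?c = "(\<beta> + 1 / (1 - \<beta>)) / (1 - \<beta>)"
  show "0 \<le> ?c" using \<beta> by simp
  fix y and m :: nat
  define s where "s j = norm (D ((adjoint U ^^ j) y))" for j
  define t where "t j = (norm ((adjoint U ^^ j) y))\<^sup>2" for j
  have t_dec: "t (Suc j) \<le> t j" for j
    using norm_adjoint_Z[OF U iso, of "(adjoint U ^^ j) y"] by (simp add: t_def power_mono)
  have t_le: "t j \<le> t 0" for j
    using lift_Suc_antimono_le[of t 0 j] t_dec by simp
  have s_le: "(s j)\<^sup>2 \<le> t 0" for j
    using D1[of "(adjoint U ^^ j) y"] t_le[of j] power_mono[OF D1, of "(adjoint U ^^ j) y" 2]
    by (simp add: s_def t_def)
  have step: "(s j)\<^sup>2 \<le> \<beta> * (s (Suc j))\<^sup>2 + (t j - t (Suc j)) / (1 - \<beta>)" for j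
  proof -
    define x where "x = (adjoint U ^^ j) y"
    define e where "e = norm (defect U x)"
    have "D x = b *\<^sub>C D (adjoint U x) + D (defect U x)"
      by (simp add: defect_def cop_diff[OF D] DU)
    then have "s j \<le> \<beta> * s (Suc j) + e"
      using norm_triangle_ineq[of "b *\<^sub>C D (adjoint U x)" "D (defect U x)"] D1[of "defect U x"]
      by (simp add: s_def x_def e_def \<beta>_def)
    then have "(s j)\<^sup>2 \<le> (\<beta> * s (Suc j) + e)\<^sup>2"
      by (intro power_mono) (auto simp: s_def)
    also have "\<dots> \<le> \<beta> * (s (Suc j))\<^sup>2 + e\<^sup>2 / (1 - \<beta>)"
    proof -
      \<comment> \<open>Convexity of the square with weights \<beta> and 1 - \<beta>, at the points
        \<open>s (Suc j)\<close> and e/(1 - \<beta>).\<close>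
      have "0 \<le> \<beta> * ((1 - \<beta>) * s (Suc j) - e)\<^sup>2"
        using \<beta> by simp
      also have "\<dots> = (1 - \<beta>) * (\<beta> * (s (Suc j))\<^sup>2 + e\<^sup>2 / (1 - \<beta>) - (\<beta> * s (Suc j) + e)\<^sup>2)"
        using \<beta> by (simp add: field_simps power2_eq_square)
      finally show ?thesis
        using \<beta> by (simp add: zero_le_mult_iff)
    qed
    also have "e\<^sup>2 = t j - t (Suc j)"
      by (simp add: e_def norm_defect[OF U iso] t_def x_def)
    finally show ?thesis .
  qed
  define S where "S = (\<Sum>j<Suc m. (s j)\<^sup>2)"
  have "S \<le> (\<Sum>j<Suc m. \<beta> * (s (Suc j))\<^sup>2 + (t j - t (Suc j)) / (1 - \<beta>))"
    unfolding S_def by (intro sum_mono step)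
  also have "\<dots> = \<beta> * (\<Sum>j<Suc m. (s (Suc j))\<^sup>2) + (t 0 - t (Suc m)) / (1 - \<beta>)"
    by (simp only: sum.distrib sum_distrib_left sum_divide_distrib[symmetric] sum_lessThan_telescope')
  \<comment> \<open>The index shift drops the term at 0 and adds one new term, which is at most
    \<open>t 0\<close>.\<close>
  also have "(\<Sum>j<Suc m. (s (Suc j))\<^sup>2) = S + (s (Suc m))\<^sup>2 - (s 0)\<^sup>2"
    unfolding S_def using sum.lessThan_Suc_shift[of "\<lambda>j. (s j)\<^sup>2" "Suc m"] by simp
  also have "\<beta> * (S + (s (Suc m))\<^sup>2 - (s 0)\<^sup>2) + (t 0 - t (Suc m)) / (1 - \<beta>)
      \<le> \<beta> * (S + t 0) + t 0 / (1 - \<beta>)"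
  proof -
    have "(s (Suc m))\<^sup>2 - (s 0)\<^sup>2 \<le> t 0"
      using s_le[of "Suc m"] zero_le_power2[of "s 0"] by linarith
    then show ?thesis
      using \<beta> by (intro add_mono mult_left_mono divide_right_mono) (auto simp: t_def)
  qed
  finally have "(1 - \<beta>) * S \<le> (\<beta> + 1 / (1 - \<beta>)) * t 0"
    by (simp add: algebra_simps)
  then have "S \<le> ?c * t 0"
    using \<beta> by (simp add: pos_le_divide_eq mult.commute)
  moreover have "(\<Sum>j=1..m. (s j)\<^sup>2) \<le> S"
    unfolding S_def by (intro sum_mono2) auto
  ultimately show "(\<Sum>j=1..m. (norm (D ((adjoint U ^^ j) y)))\<^sup>2) \<le> ?c * (norm y)\<^sup>2"
    by (simp add: s_def t_def)
qed

lemma funpow_commute: "(\<And>x. f (g x) = g (f x)) \<Longrightarrow> f ((g ^^ n) x) = (g ^^ n) (f x)"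
  by (induction n) auto

lemma norm_funpow_le:
  fixes f :: "'a::real_normed_vector \<Rightarrow> 'a"
  assumes "\<And>x. norm (f x) \<le> norm x"
  shows "norm ((f ^^ n) x) \<le> norm x"
proof (induction n)
  case (Suc n)
  then show ?case
    using assms[of "(f ^^ n) x"] by simp
qed simp

text \<open>Let \<open>A\<close> be the average of \<open>\<alpha>\<^sup>j u\<^sup>j v\<^bsup>m-j\<^esup>\<close> over \<open>1 \<le> j \<le> m\<close>. For \<open>\<alpha> \<beta> = 1\<close> the factor
  \<open>v\<^sup>m - A\<close> is divisible by \<open>u - \<beta> v\<close>, and \<open>D A\<close> has norm \<open>O(m\<^bsup>-1/2\<^esup>)\<close>.\<close>

lemma defect_estimate:
  fixes u v D :: "'a::chilbert \<Rightarrow> 'a"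
  assumes u: "cop u" "\<And>x. norm (u x) \<le> norm x" and v: "cop v" "\<And>x. norm (v x) \<le> norm x"
    and uv: "\<And>x. u (v x) = v (u x)" and D: "cop D" and Dv: "\<And>x. D (v x) = v (D x)"
    and c: "0 \<le> c" "\<And>y m. (\<Sum>j=1..m. (norm (D ((u ^^ j) y)))\<^sup>2) \<le> c * (norm y)\<^sup>2"
    and m: "1 \<le> m" and \<beta>s: "\<forall>\<beta>\<in>set \<beta>s. cmod \<beta> = 1" and x: "gprod u v \<beta>s x = 0"
  shows "norm (D ((v ^^ (m * length \<beta>s)) x)) \<le> (2 ^ length \<beta>s - 1) * (sqrt c / sqrt m) * norm x"
  using \<beta>s x
proof (induction \<beta>s arbitrary: x)
  case Nil
  then show ?case by (simp add: cop_zero[OF D])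
next
  case (Cons \<beta> \<beta>s)
  define \<alpha> where "\<alpha> = cnj \<beta>"
  have \<beta>: "cmod \<beta> = 1" using Cons.prems by simp
  then have \<alpha>: "cmod \<alpha> = 1" "\<alpha> * \<beta> = 1"
    using complex_norm_square[of \<beta>] by (auto simp: \<alpha>_def mult.commute)
  define l where "l = m * length \<beta>s"
  define g where "g = gprod u v \<beta>s"
  have g: "cop g" unfolding g_def by (rule cop_gprod[OF u(1) v(1)])
  have gu: "g (u y) = u (g y)" and gv: "g (v y) = v (g y)" for y
    unfolding g_def by (rule gprod_commute[symmetric]; simp add: u v uv)+
  have gun: "g ((u ^^ j) y) = (u ^^ j) (g y)" and gvn: "g ((v ^^ j) y) = (v ^^ j) (g y)" for y j
    using gu gv by (simp_all add: funpow_commute)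
  have un: "cop (u ^^ j)" and vn: "cop (v ^^ j)" for j
    using u v cop_funpow by auto
  define A where "A y = (1 / m) *\<^sub>R (\<Sum>j=1..m. \<alpha> ^ j *\<^sub>C (u ^^ j) ((v ^^ (m - j)) y))" for y
  have norm_A: "norm (A y) \<le> norm y" for y
  proof -
    have "norm (\<Sum>j=1..m. \<alpha> ^ j *\<^sub>C (u ^^ j) ((v ^^ (m - j)) y)) \<le> (\<Sum>j=1..m. norm y)"
      using \<alpha>(1) by (intro order_trans[OF norm_sum] sum_mono)
        (auto simp: norm_power intro!: order_trans[OF norm_funpow_le[of u] norm_funpow_le[of v]] u v)
    then show ?thesis
      using m by (simp add: A_def field_simps)
  qed
  \<comment> \<open>The remaining product annihilates x', so the induction hypothesis applies to it,
    and |A x| \<le> |x| gives |x'| \<le> 2 |x|. The constants thus obey k(l+1) = 2 k(l) + 1 with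
    k(0) = 0, which is 2^l - 1.\<close>
  define x' where "x' = (v ^^ m) x - A x"
  have "g x' = 0"
  proof -
    define w where "w = g x"
    \<comment> \<open>On \<open>w\<close> the vanishing of the first factor reads u w = \<beta> v w;
      with \<alpha> \<beta> = 1 every term of the average at w equals v^m w.\<close>
    have w: "u w = \<beta> *\<^sub>C v w"
      using Cons.prems by (simp add: w_def g_def)
    have uw: "(u ^^ j) w = \<beta> ^ j *\<^sub>C (v ^^ j) w" for j
    proof (induction j)
      case (Suc j)
      then show ?case
        using w funpow_commute[of u v j w] uv
        by (simp add: cop_scaleC[OF u(1)] cop_scaleC[OF vn] funpow_swap1 mult.commute)
    qed simp
    have "\<alpha> ^ j *\<^sub>C (u ^^ j) ((v ^^ (m - j)) w) = (v ^^ m) w" if "j \<le> m" for j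
    proof -
      have "(u ^^ j) ((v ^^ (m - j)) w) = (v ^^ (m - j)) ((u ^^ j) w)"
        by (intro funpow_commute[of "u ^^ j" v] funpow_commute[of v u, symmetric]) (simp add: uv)
      also have "\<dots> = \<beta> ^ j *\<^sub>C (v ^^ (m - j + j)) w"
        by (simp add: uw cop_scaleC[OF vn] funpow_add del: le_add_diff_inverse2)
      finally show ?thesis
        using that \<alpha>(2) by (simp flip: power_mult_distrib)
    qed
    then have "(\<Sum>j=1..m. \<alpha> ^ j *\<^sub>C (u ^^ j) ((v ^^ (m - j)) w)) = (\<Sum>j=1..m. (v ^^ m) w)"
      by (intro sum.cong) auto
    also have "\<dots> = real m *\<^sub>R (v ^^ m) w"
      by (simp add: sum_constant_scaleR)
    finally have "A w = (v ^^ m) w"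
      using m by (simp add: A_def)
    moreover have "g x' = (v ^^ m) w - A w"
      by (simp add: x'_def A_def w_def cop_simps[OF g] gun gvn)
    ultimately show ?thesis by simp
  qed
  then have IH: "norm (D ((v ^^ l) x')) \<le> (2 ^ length \<beta>s - 1) * (sqrt c / sqrt m) * norm x'"
    using Cons unfolding g_def l_def by simp
  have "norm x' \<le> 2 * norm x"
    using norm_triangle_ineq4[of "(v ^^ m) x" "A x"] norm_A[of x] norm_funpow_le[of v m x] v
    by (simp add: x'_def)
  then have "(2 ^ length \<beta>s - 1) * (sqrt c / sqrt m) * norm x'
      \<le> (2 ^ length \<beta>s - 1) * (sqrt c / sqrt m) * (2 * norm x)"
    using c(1) by (intro mult_left_mono) auto
  with IH have 1: "norm (D ((v ^^ l) x')) \<le> (2 ^ length \<beta>s - 1) * (sqrt c / sqrt m) * (2 * norm x)"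
    by linarith
  have 2: "norm (D ((v ^^ l) (A x))) \<le> (sqrt c / sqrt m) * norm x"
  proof -
    have Dvn: "D ((v ^^ k) y) = (v ^^ k) (D y)" for k y
      using Dv by (rule funpow_commute)
    \<comment> \<open>D commutes with the contraction v, so all powers of v can be moved to the left
      of D and dropped.\<close>
    have tm: "norm (D ((v ^^ l) ((u ^^ j) ((v ^^ (m - j)) x)))) \<le> norm (D ((u ^^ j) x))" for j
    proof -
      have "(u ^^ j) ((v ^^ (m - j)) x) = (v ^^ (m - j)) ((u ^^ j) x)"
        by (intro funpow_commute[of "u ^^ j" v] funpow_commute[of v u, symmetric]) (simp add: uv)
      then show ?thesis
        by (simp add: Dvn) (intro order_trans[OF norm_funpow_le] norm_funpow_le v)
    qed
    \<comment> \<open>Cauchy-Schwarz turns the uniform bound on the squares into order sqrt m for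
      the sum; division by m leaves 1/sqrt m.\<close>
    have "(\<Sum>j=1..m. norm (D ((u ^^ j) x)))\<^sup>2 \<le> (\<Sum>j=1..m. (norm (D ((u ^^ j) x)))\<^sup>2) * card {1..m}"
      by (rule sum_squared_le_sum_of_squares)
    also have "\<dots> \<le> c * (norm x)\<^sup>2 * m"
      using mult_right_mono[OF c(2)[where m = m and y = x], of m] by simp
    also have "\<dots> = (sqrt c * sqrt m * norm x)\<^sup>2"
      using c(1) by (simp add: power_mult_distrib)
    finally have s: "(\<Sum>j=1..m. norm (D ((u ^^ j) x))) \<le> sqrt c * sqrt m * norm x"
      by (rule power2_le_imp_le) (simp add: c)
    have "norm (D ((v ^^ l) (A x))) =
        norm (\<Sum>j=1..m. \<alpha> ^ j *\<^sub>C D ((v ^^ l) ((u ^^ j) ((v ^^ (m - j)) x)))) / m"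
      by (simp add: A_def cop_scaleR[OF vn] cop_scaleR[OF D] cop_sum[OF vn] cop_sum[OF D]
          cop_scaleC[OF vn] cop_scaleC[OF D])
    also have "\<dots> \<le> (\<Sum>j=1..m. norm (D ((u ^^ j) x))) / m"
      using \<alpha>(1) tm by (intro divide_right_mono order_trans[OF norm_sum] sum_mono) (simp_all add: norm_power)
    also have "\<dots> \<le> sqrt c * sqrt m * norm x / m"
      using s by (intro divide_right_mono) auto
    also have "\<dots> = (sqrt c / sqrt m) * norm x"
      using m by (simp add: field_simps)
    finally show ?thesis .
  qed
  have "(v ^^ (m * length (\<beta> # \<beta>s))) x = (v ^^ l) x' + (v ^^ l) (A x)"
    by (simp add: x'_def l_def cop_diff[OF vn] funpow_add add.commute[of m])
  then have "norm (D ((v ^^ (m * length (\<beta> # \<beta>s))) x)) \<le>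
      (2 ^ length \<beta>s - 1) * (sqrt c / sqrt m) * (2 * norm x) + (sqrt c / sqrt m) * norm x"
    using 1 2 norm_triangle_ineq[of "D ((v ^^ l) x')" "D ((v ^^ l) (A x))"]
    by (simp only: cop_add[OF D])
  also have "\<dots> = (2 ^ length (\<beta> # \<beta>s) - 1) * (sqrt c / sqrt m) * norm x"
    by (simp add: algebra_simps)
  finally show ?case .
qed

section \<open>Doubly commuting pairs of shifts\<close>

lemma subspace_closure:
  fixes S :: "'a::real_normed_vector set"
  assumes S: "subspace S"
  shows "subspace (closure S)"
  unfolding subspace_def
proof (intro conjI ballI allI)
  show "0 \<in> closure S"
    using subspace_0[OF S] closure_subset by blast
  fix x y assume "x \<in> closure S" "y \<in> closure S"
  then obtain f g where "\<forall>n. f n \<in> S" "f \<longlonglongrightarrow> x" "\<forall>n. g n \<in> S" "g \<longlonglongrightarrow> y"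
    unfolding closure_sequential by blast
  then show "x + y \<in> closure S"
    unfolding closure_sequential
    by (intro exI[of _ "\<lambda>n. f n + g n"]) (auto intro: tendsto_add subspace_add[OF S])
next
  fix c x assume "x \<in> closure S"
  then obtain f where "\<forall>n. f n \<in> S" "f \<longlonglongrightarrow> x"
    unfolding closure_sequential by blast
  then show "c *\<^sub>R x \<in> closure S"
    unfolding closure_sequential
    by (intro exI[of _ "\<lambda>n. c *\<^sub>R f n"]) (auto intro: tendsto_intros subspace_scale[OF S])
qed

text \<open>Abstracts multiplication by the two coordinates on the Hardy space of the bidisc. Double
  commutation reflects the tensor structure, and \<open>wandering\<close> says that the common
  kernel of the adjoints is at most a complex line. The conditions are symmetric in Z and W, by way
  of adjoints, so each result for Z has a counterpart for W.\<close>

locale shift_pair =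
  fixes Z W :: "'a::chilbert \<Rightarrow> 'a" and e :: 'a
  assumes Z: "cop Z" and iso_Z: "\<And>x. norm (Z x) = norm x"
    and W: "cop W" and iso_W: "\<And>x. norm (W x) = norm x"
    and ZW: "\<And>x. Z (W x) = W (Z x)"
    and Z'W: "\<And>x. adjoint Z (W x) = W (adjoint Z x)"
    and wandering: "\<And>x. adjoint Z x = 0 \<Longrightarrow> adjoint W x = 0 \<Longrightarrow> \<exists>c. x = c *\<^sub>C e"
begin

lemmas bl_Z = cop_bounded_linear[OF Z] and bl_W = cop_bounded_linear[OF W]
  and Z' = cop_adjoint[OF Z] and W' = cop_adjoint[OF W]
lemmas bl_Z' = cop_bounded_linear[OF Z']

lemma W'Z: "adjoint W (Z x) = Z (adjoint W x)"
  using adjoint_commute[OF bl_Z' bl_W bl_W bl_Z' Z'W, of x] by (simp add: adjoint_adjoint_hilbert[OF bl_Z])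

lemma Z'W': "adjoint Z (adjoint W x) = adjoint W (adjoint Z x)"
  using adjoint_commute[OF bl_W bl_Z bl_Z bl_W] ZW by simp

lemma swap: "shift_pair W Z e"
  using Z W iso_Z iso_W ZW W'Z wandering by unfold_locales auto

lemma defect_Z_W: "defect Z (W x) = W (defect Z x)"
  by (simp add: defect_def Z'W ZW cop_diff[OF W])

text \<open>Bounds by k the real codimension, inside the kernel of Z^*, of what \<Phi> reaches from
  that kernel. For powers of V the bound grows linearly, and this is the source of the O(m)
  exceptional directions.\<close>

definition wander_codim :: "('a \<Rightarrow> 'a) \<Rightarrow> nat \<Rightarrow> bool" where
  "wander_codim \<Phi> k \<longleftrightarrow> (\<exists>F. finite F \<and> card F \<le> k \<and>
     (\<forall>x\<in>ocomp F. adjoint Z x = 0 \<longrightarrow> (\<exists>y. adjoint Z y = 0 \<and> x = \<Phi> y)))"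

lemma wander_codim_id: "wander_codim (\<lambda>x. x) 0"
  unfolding wander_codim_def by (rule exI[of _ "{}"]) auto

text \<open>Codimensions add: the isometry \<Phi> carries the test vectors of \<Psi> along and
  preserves orthogonality to them.\<close>

lemma wander_codim_compose:
  assumes \<Phi>: "cop \<Phi>" "\<And>x. norm (\<Phi> x) = norm x" "wander_codim \<Phi> k" and \<Psi>: "wander_codim \<Psi> l"
  shows "wander_codim (\<lambda>x. \<Phi> (\<Psi> x)) (k + l)"
proof -
  obtain F where F: "finite F" "card F \<le> k"
    "\<And>x. x \<in> ocomp F \<Longrightarrow> adjoint Z x = 0 \<Longrightarrow> \<exists>y. adjoint Z y = 0 \<and> x = \<Phi> y"
    using \<Phi>(3) by (auto simp: wander_codim_def)
  obtain G where G: "finite G" "card G \<le> l"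
    "\<And>x. x \<in> ocomp G \<Longrightarrow> adjoint Z x = 0 \<Longrightarrow> \<exists>y. adjoint Z y = 0 \<and> x = \<Psi> y"
    using \<Psi> by (auto simp: wander_codim_def)
  have inner_\<Phi>: "inner (\<Phi> x) (\<Phi> y) = inner x y" for x y
    using adjoint_isometry[OF cop_bounded_linear[OF \<Phi>(1)] \<Phi>(2), of y]
    by (simp flip: inner_adjoint[OF cop_bounded_linear[OF \<Phi>(1)]])
  have "\<exists>z. adjoint Z z = 0 \<and> x = \<Phi> (\<Psi> z)"
    if x: "x \<in> ocomp (F \<union> \<Phi> ` G)" "adjoint Z x = 0" for x
  proof -
    obtain y where y: "adjoint Z y = 0" "x = \<Phi> y"
      using F(3)[of x] x by (auto simp: ocomp_Un)
    have "inner s y = 0" if "s \<in> G" for s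
    proof -
      have "inner (\<Phi> s) x = 0" using x(1) that by (auto simp: ocomp_def)
      then show ?thesis by (simp add: y(2) inner_\<Phi>)
    qed
    then have "y \<in> ocomp G"
      by (simp add: ocomp_def)
    then show ?thesis
      using G(3)[of y] y by auto
  qed
  moreover have "card (F \<union> \<Phi> ` G) \<le> k + l"
    using card_Un_le[of F "\<Phi> ` G"] card_image_le[OF G(1), of \<Phi>] F(2) G(2) by linarith
  ultimately show ?thesis
    unfolding wander_codim_def using F(1) G(1) by (intro exI[of _ "F \<union> \<Phi> ` G"]) auto
qed

lemma wander_codim_scale:
  assumes "wander_codim \<Phi> k" "c \<noteq> 0" "cop \<Phi>"
  shows "wander_codim (\<lambda>x. c *\<^sub>C \<Phi> x) k"
proof -
  obtain F where F: "finite F" "card F \<le> k"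
    "\<And>x. x \<in> ocomp F \<Longrightarrow> adjoint Z x = 0 \<Longrightarrow> \<exists>y. adjoint Z y = 0 \<and> x = \<Phi> y"
    using assms(1) by (auto simp: wander_codim_def)
  have "\<exists>y. adjoint Z y = 0 \<and> x = c *\<^sub>C \<Phi> y" if "x \<in> ocomp F" "adjoint Z x = 0" for x
  proof -
    obtain y where "adjoint Z y = 0" "x = \<Phi> y" using F(3)[OF \<open>x \<in> ocomp F\<close> \<open>adjoint Z x = 0\<close>] by blast
    then show ?thesis
      using assms(2) by (intro exI[of _ "inverse c *\<^sub>C y"]) (simp add: cop_scaleC[OF assms(3)] cop_scaleC[OF Z'])
  qed
  with F(1,2) show ?thesis unfolding wander_codim_def by blast
qed

text \<open>The part r of x missed by the range of \<Phi> satisfies W^* r = cnj b r and Z^* r = 0.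
  Hence r - cnj b W r lies in the common kernel, and r is a multiple of (I - cnj b W)^(-1) e, the
  abstract Szego kernel at b. The count 2 is for this vector and its multiple by \<i>.\<close>

lemma wander_codim_mobius:
  assumes b: "cmod b < 1"
  shows "wander_codim (mobius b W) 2"
proof -
  define \<Phi> where "\<Phi> = mobius b W"
  note \<Phi> = cop_mobius[OF W iso_W b, folded \<Phi>_def] and iso = norm_mobius[OF W iso_W b, folded \<Phi>_def]
  note bl = cop_bounded_linear[OF \<Phi>] and \<Phi>' = cop_adjoint[OF \<Phi>]
  have Z'\<Phi>: "adjoint Z (\<Phi> y) = \<Phi> (adjoint Z y)" for y
    unfolding \<Phi>_def by (rule mobius_commute[OF W iso_W b Z']) (rule Z'W)
  have Z\<Phi>: "Z (\<Phi> y) = \<Phi> (Z y)" for y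
    unfolding \<Phi>_def by (rule mobius_commute[OF W iso_W b Z]) (rule ZW)
  have Z'\<Phi>': "adjoint Z (adjoint \<Phi> y) = adjoint \<Phi> (adjoint Z y)" for y
    using adjoint_commute[OF bl bl_Z bl_Z bl] Z\<Phi> by simp
  define e' where "e' = neumann (\<lambda>x. cnj b *\<^sub>C W x) e"
  have "\<exists>y. adjoint Z y = 0 \<and> x = \<Phi> y" if x: "x \<in> ocomp {e', \<i> *\<^sub>C e'}" "adjoint Z x = 0" for x
  proof -
    define r where "r = defect \<Phi> x"
    have \<Phi>'r: "adjoint \<Phi> r = 0"
      unfolding r_def by (rule adjoint_Z_defect[OF \<Phi> iso])
    have Z'r: "adjoint Z r = 0"
      using x(2) by (simp add: r_def defect_def cop_simps[OF Z'] Z'\<Phi> Z'\<Phi>' cop_zero[OF \<Phi>'] cop_zero[OF \<Phi>])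
    have W'r: "adjoint W r = cnj b *\<^sub>C r"
    proof (rule vector_eq_ldot[THEN iffD1], rule allI)
      fix u
      have "inner (W u - b *\<^sub>C u) r = inner (\<Phi> (u - cnj b *\<^sub>C W u)) r"
        by (simp add: \<Phi>_def mobius_mult[OF W iso_W b])
      also have "\<dots> = inner (u - cnj b *\<^sub>C W u) (adjoint \<Phi> r)"
        by (simp add: inner_adjoint[OF bl])
      finally have "inner (W u - b *\<^sub>C u) r = inner (u - cnj b *\<^sub>C W u) (adjoint \<Phi> r)" .
      then show "inner u (adjoint W r) = inner u (cnj b *\<^sub>C r)"
        by (simp add: \<Phi>'r inner_adjoint[OF bl_W] inner_diff_left inner_scaleC_left)
    qed
    define q where "q = r - cnj b *\<^sub>C W r"
    have "adjoint W q = 0" "adjoint Z q = 0"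
      by (simp_all add: q_def cop_simps[OF W'] cop_simps[OF Z'] adjoint_Z_Z[OF W iso_W] W'r Z'r
          Z'W cop_zero[OF W])
    then obtain c where "q = c *\<^sub>C e"
      using wandering by blast
    then have "r = c *\<^sub>C e'"
      using mobius_neumann_unique[OF W iso_W b, of r "c *\<^sub>C e"]
        cop_scaleC[OF cop_mobius_neumann[OF W iso_W b]] by (simp add: e'_def q_def)
    then have "inner r x = 0"
      using x(1) inner_scaleC_zeroI[of e' x c] by (simp add: ocomp_def)
    moreover have "inner r (\<Phi> (adjoint \<Phi> x)) = 0"
      using \<Phi>'r inner_adjoint_left[OF bl, of r "adjoint \<Phi> x"] by simp
    ultimately have "inner r r = 0"
      by (simp add: r_def defect_def inner_diff_right)
    then have "x = \<Phi> (adjoint \<Phi> x)"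
      by (simp add: r_def defect_def)
    moreover have "adjoint Z (adjoint \<Phi> x) = 0"
      by (simp add: Z'\<Phi>' x(2) cop_zero[OF \<Phi>'])
    ultimately show ?thesis by blast
  qed
  then show ?thesis
    unfolding wander_codim_def \<Phi>_def by (intro exI[of _ "{e', \<i> *\<^sub>C e'}"]) (auto simp: card_insert_if)
qed

lemma wander_codim_blop:
  "\<forall>b\<in>set bs. cmod b < 1 \<Longrightarrow> wander_codim (blop W bs) (2 * length bs)"
proof (induction bs)
  case Nil
  have "blop W [] = (\<lambda>x. x)" by auto
  then show ?case using wander_codim_id by simp
next
  case (Cons b bs)
  have "blop W (b # bs) = (\<lambda>x. mobius b W (blop W bs x))" by auto
  moreover have b: "cmod b < 1" using Cons.prems by simp
  ultimately show ?case
    using wander_codim_compose[OF cop_mobius[OF W iso_W b] norm_mobius[OF W iso_W b]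
        wander_codim_mobius[OF b] Cons.IH] Cons.prems
    by simp
qed

lemma wander_codim_funpow:
  assumes "cop \<Phi>" "\<And>x. norm (\<Phi> x) = norm x" "wander_codim \<Phi> k"
  shows "wander_codim (\<Phi> ^^ n) (k * n)"
proof (induction n)
  case 0
  then show ?case using wander_codim_id by (simp add: id_def)
next
  case (Suc n)
  have "\<Phi> ^^ Suc n = (\<lambda>x. \<Phi> ((\<Phi> ^^ n) x))" by auto
  then show ?case
    using wander_codim_compose[OF assms Suc] by simp
qed

end

section \<open>The isometries B1(Z) and B2(W) and the submodule generated by their product\<close>

locale blaschke_pair = shift_pair +
  fixes c1 c2 :: complex and as bs \<alpha>s :: "complex list"
  assumes c1: "cmod c1 = 1" and c2: "cmod c2 = 1"
    and as: "as \<noteq> []" "\<forall>a\<in>set as. cmod a < 1" and bs: "bs \<noteq> []" "\<forall>b\<in>set bs. cmod b < 1"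
    and \<alpha>s: "\<forall>\<alpha>\<in>set \<alpha>s. cmod \<alpha> = 1"
begin

definition U :: "'a \<Rightarrow> 'a" where "U x = c1 *\<^sub>C blop Z as x"
definition V :: "'a \<Rightarrow> 'a" where "V x = c2 *\<^sub>C blop W bs x"
abbreviation G :: "'a \<Rightarrow> 'a" where "G \<equiv> gprod U V \<alpha>s"
text \<open>On the bidisc G is multiplication by p_B up to a scalar, so this is the closure of p_B
  H^2.\<close>

definition M0 :: "'a set" where "M0 = closure (range G)"

lemma U_fun: "U = (\<lambda>x. c1 *\<^sub>C blop Z as x)" and V_fun: "V = (\<lambda>x. c2 *\<^sub>C blop W bs x)"
  by (auto simp: U_def V_def)

lemma cop_U: "cop U" and cop_V: "cop V"
  unfolding U_fun V_fun by (intro cop_scale cop_blop Z W iso_Z iso_W as bs)+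

lemma iso_U: "norm (U x) = norm x" and iso_V: "norm (V x) = norm x"
  by (simp_all add: U_def V_def c1 c2 norm_blop[OF Z iso_Z as(2)] norm_blop[OF W iso_W bs(2)])

lemma commute_U: "cop B \<Longrightarrow> (\<And>x. B (Z x) = Z (B x)) \<Longrightarrow> B (U x) = U (B x)"
  by (simp add: U_def cop_scaleC blop_commute[OF Z iso_Z as(2)])

lemma commute_V: "cop B \<Longrightarrow> (\<And>x. B (W x) = W (B x)) \<Longrightarrow> B (V x) = V (B x)"
  by (simp add: V_def cop_scaleC blop_commute[OF W iso_W bs(2)])

lemma ZU: "Z (U x) = U (Z x)" and ZV: "Z (V x) = V (Z x)"
  and WU: "W (U x) = U (W x)" and WV: "W (V x) = V (W x)"
  using commute_U[OF Z] commute_V[OF Z ZW] commute_U[OF W ZW[symmetric]] commute_V[OF W] by auto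

lemma UV: "U (V x) = V (U x)"
  using commute_V[OF cop_U WU[symmetric]] by simp

lemma cop_G: "cop G"
  by (rule cop_gprod[OF cop_U cop_V])

lemma ZG: "Z (G x) = G (Z x)" and WG: "W (G x) = G (W x)"
  using gprod_commute[of Z U V] gprod_commute[of W U V] Z ZU ZV W WU WV by auto

lemma defect_V: "defect Z (V x) = V (defect Z x)"
  by (rule commute_V[OF cop_defect[OF Z] defect_Z_W])

lemma defect_V': "defect Z (adjoint V x) = adjoint V (defect Z x)"
proof -
  have "adjoint (defect Z) = defect Z"
    by (rule adjoint_eqI) (rule defect_self_adjoint[OF Z iso_Z])
  then show ?thesis
    using adjoint_commute[OF cop_bounded_linear[OF cop_V] cop_bounded_linear[OF cop_defect[OF Z]]
        cop_bounded_linear[OF cop_defect[OF Z]] cop_bounded_linear[OF cop_V] defect_V[symmetric]]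
    by simp
qed

text \<open>The value of the first Blaschke product at 0.\<close>

definition b0 :: complex where "b0 = c1 * (\<Prod>a\<leftarrow>as. - a)"

lemma b0: "cmod b0 < 1"
  using norm_prod_list_less_1[OF as] by (simp add: b0_def norm_mult c1)

lemma defect_U: "defect Z (U x) = b0 *\<^sub>C defect Z x"
  by (simp add: U_def b0_def cop_scaleC[OF cop_defect[OF Z]] defect_blop[OF Z iso_Z as(2)])

lemma csubspace_M0: "csubspace M0"
proof -
  have "subspace (range G)"
    using bounded_linear.linear[OF cop_bounded_linear[OF cop_G]] by (simp add: linear_subspace_image)
  moreover have "c *\<^sub>C x \<in> M0" if "x \<in> M0" for c x
  proof -
    have "(\<lambda>x. c *\<^sub>C x) ` closure (range G) \<subseteq> closure ((\<lambda>x. c *\<^sub>C x) ` range G)"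
      using bounded_linear_scaleC by (intro closure_bounded_linear_image_subset)
    also have "(\<lambda>x. c *\<^sub>C x) ` range G \<subseteq> range G"
      by (auto simp flip: cop_scaleC[OF cop_G])
    then have "closure ((\<lambda>x. c *\<^sub>C x) ` range G) \<subseteq> closure (range G)"
      by (rule closure_mono)
    finally show ?thesis using that by (auto simp: M0_def)
  qed
  ultimately show ?thesis
    by (auto simp: csubspace_def M0_def subspace_closure)
qed

lemma Z_M0:
  assumes "x \<in> M0"
  shows "Z x \<in> M0"
proof -
  have "Z ` closure (range G) \<subseteq> closure (Z ` range G)"
    using bl_Z by (intro closure_bounded_linear_image_subset)
  also have "\<dots> \<subseteq> closure (range G)"
    using ZG by (intro closure_mono) auto
  finally show ?thesis using assms by (auto simp: M0_def)
qed

lemma ocomp_M0: "x \<in> ocomp M0 \<longleftrightarrow> (\<forall>y. inner (G y) x = 0)"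
proof
  assume "\<forall>y. inner (G y) x = 0"
  then have "range G \<subseteq> ocomp {x}" by (auto simp: ocomp_def inner_commute)
  then have "M0 \<subseteq> ocomp {x}"
    unfolding M0_def using closed_ocomp by (rule closure_minimal)
  then show "x \<in> ocomp M0" by (auto simp: ocomp_def inner_commute)
next
  assume x: "x \<in> ocomp M0"
  have "G y \<in> M0" for y
    unfolding M0_def by (rule subsetD[OF closure_subset rangeI])
  with x show "\<forall>y. inner (G y) x = 0" by (auto simp: ocomp_def)
qed

text \<open>Off the exceptional directions the defect of y is V^k w, so V^{*k} preserves its norm;
  it also commutes with the defect. The norm is therefore that of the defect of V^{*k} y, which
  \<open>defect_estimate\<close> bounds by O(n^(-1/2)). The exponent is k = n l because each of the
  l factors spends an average of length n.\<close>

lemma decay_defect: "decay 1 (\<lambda>x. defect Z (oproj (ocomp M0) x))"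
proof -
  define N where "N = ocomp M0"
  have N: "subspace N" "closed N" by (simp_all add: N_def subspace_ocomp closed_ocomp)
  define l where "l = length \<alpha>s"
  define u where "u = adjoint U"
  define v where "v = adjoint V"
  note D = cop_defect[OF Z]
  have bl: "bounded_linear (\<lambda>x. defect Z (oproj N x))"
    by (rule bounded_linear_compose[OF cop_bounded_linear[OF D] bounded_linear_oproj[OF N]])
  have uv: "cop u" "cop v" "\<And>x. norm (u x) \<le> norm x" "\<And>x. norm (v x) \<le> norm x" "\<And>x. u (v x) = v (u x)"
    unfolding u_def v_def
    using cop_adjoint[OF cop_U] cop_adjoint[OF cop_V] norm_adjoint_Z[OF cop_U iso_U] norm_adjoint_Z[OF cop_V iso_V]
      adjoint_commute[OF cop_bounded_linear[OF cop_V] cop_bounded_linear[OF cop_U]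
        cop_bounded_linear[OF cop_U] cop_bounded_linear[OF cop_V] UV[symmetric]]
    by auto
  obtain c where c: "0 \<le> c" "\<And>y m. (\<Sum>j=1..m. (norm (defect Z ((u ^^ j) y)))\<^sup>2) \<le> c * (norm y)\<^sup>2"
    using sum_defect_bound[OF cop_U iso_U D norm_defect_le[OF Z iso_Z] defect_U b0]
    unfolding u_def by blast
  have wc: "wander_codim (V ^^ k) (2 * length bs * k)" for k
    using wander_codim_funpow[OF cop_V iso_V wander_codim_scale[OF wander_codim_blop[OF bs(2)] _ cop_blop[OF W iso_W bs(2)], of c2, folded V_fun]]
    c2 by fastforce
  show ?thesis
    unfolding N_def[symmetric]
  proof (rule decayI[OF bl, where D = "2 * length bs * l" and C = "(2 ^ l - 1) * sqrt c"])
    fix n :: nat assume n: "1 \<le> n"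
    obtain F where F: "finite F" "card F \<le> 2 * length bs * (n * l)"
      "\<And>x. x \<in> ocomp F \<Longrightarrow> adjoint Z x = 0 \<Longrightarrow> \<exists>y. adjoint Z y = 0 \<and> x = (V ^^ (n * l)) y"
      using wc[of "n * l"] unfolding wander_codim_def by blast
    let ?A = "\<lambda>x. defect Z (oproj N x)"
    have "norm (?A x) \<le> (2 ^ l - 1) * sqrt c * (1 / sqrt n) ^ 1 * norm x"
      if x: "x \<in> ocomp (adjoint ?A ` F)" for x
    proof -
      define y where "y = oproj N x"
      have "?A x \<in> ocomp F"
        using x by (simp add: ocomp_image_adjoint[OF bl])
      then obtain w where w: "defect Z y = (V ^^ (n * l)) w"
        using F(3)[of "?A x"] adjoint_Z_defect[OF Z iso_Z] by (auto simp: y_def)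
      have "(v ^^ k) ((V ^^ k) w) = w" for k w
      proof (induction k arbitrary: w)
        case (Suc k)
        have "(v ^^ Suc k) ((V ^^ Suc k) w) = (v ^^ k) (v (V ((V ^^ k) w)))"
          by (simp add: funpow_swap1)
        also have "v (V ((V ^^ k) w)) = (V ^^ k) w"
          by (simp add: v_def adjoint_Z_Z[OF cop_V iso_V])
        finally show ?case by (simp add: Suc)
      qed simp
      moreover have "norm ((V ^^ k) w) = norm w" for k w
        by (induction k) (simp_all add: iso_V)
      moreover have "defect Z ((v ^^ (n * l)) y) = (v ^^ (n * l)) (defect Z y)"
        unfolding v_def by (rule funpow_commute) (rule defect_V')
      ultimately have "norm (defect Z y) = norm (defect Z ((v ^^ (n * l)) y))"
        by (simp add: w)
      also have "\<dots> \<le> (2 ^ l - 1) * (sqrt c / sqrt n) * norm y"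
      proof -
        have "y \<in> ocomp M0"
          using oproj_in[OF N] by (simp add: y_def N_def)
        then have "inner z (gprod u v (map cnj \<alpha>s) y) = 0" for z
          unfolding ocomp_M0 using adjoint_gprod[OF cop_U cop_V UV, of \<alpha>s z y] by (simp add: u_def v_def)
        then have "gprod u v (map cnj \<alpha>s) y = 0"
          using inner_eq_zero_iff by blast
        then show ?thesis
          using defect_estimate[OF uv(1,3,2,4,5) D _ c n, of "map cnj \<alpha>s" y] defect_V' \<alpha>s
          by (simp add: l_def v_def)
      qed
      also have "\<dots> \<le> (2 ^ l - 1) * (sqrt c / sqrt n) * norm x"
        using norm_oproj_le[OF N, of x] c(1) by (intro mult_left_mono) (auto simp: y_def)
      finally show ?thesis by (simp add: y_def)
    qed
    moreover have "card (adjoint ?A ` F) \<le> 2 * length bs * l * n"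
      using card_image_le[OF F(1), of "adjoint ?A"] F(2) by (simp add: mult_ac)
    ultimately show "\<exists>F. finite F \<and> card F \<le> 2 * length bs * l * n \<and>
        (\<forall>x\<in>ocomp F. norm (?A x) \<le> (2 ^ l - 1) * sqrt c * (1 / sqrt n) ^ 1 * norm x)"
      using F(1) by (intro exI[of _ "adjoint ?A ` F"]) auto
  qed
qed

text \<open>For one factor D (U g - \<alpha> V g) = b0 D g - \<alpha> V D g, where the second term
  has norm |D g| and the first only |b0| |D g|.\<close>

lemma norm_defect_G: "(1 - cmod b0) ^ length \<alpha>s * norm (defect Z y) \<le> norm (defect Z (G y))"
  using \<alpha>s
proof (induction \<alpha>s)
  case (Cons \<alpha> \<alpha>s)
  let ?g = "gprod U V \<alpha>s y"
  note D = cop_defect[OF Z]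
  have "(1 - cmod b0) ^ length (\<alpha> # \<alpha>s) * norm (defect Z y) \<le> (1 - cmod b0) * norm (defect Z ?g)"
    using Cons b0 mult_left_mono[of _ _ "1 - cmod b0"] by (simp add: mult.assoc)
  also have "\<dots> = norm (\<alpha> *\<^sub>C V (defect Z ?g)) - norm (b0 *\<^sub>C defect Z ?g)"
    using Cons.prems by (simp add: iso_V algebra_simps)
  also have "\<dots> \<le> norm (b0 *\<^sub>C defect Z ?g - \<alpha> *\<^sub>C V (defect Z ?g))"
    by (metis norm_minus_commute norm_triangle_ineq2)
  also have "\<dots> = norm (defect Z (gprod U V (\<alpha> # \<alpha>s) y))"
    by (simp add: cop_diff[OF D] cop_scaleC[OF D] defect_U defect_V)
  finally show ?case .
qed simp

text \<open>Approximate Z x by G y. The defect kills Z x, so the lower bound for the defect of G y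
  makes the defect of y small; y is then near Z Z^* y, and x is near G (Z^* y). As x is orthogonal
  to the range of G, its norm is at most this error. The epsilon is there because \<open>M0\<close>
  is the closure of that range.\<close>

lemma compression_injective:
  assumes x: "x \<in> ocomp M0" "Z x \<in> M0"
  shows "x = 0"
proof -
  define \<delta> where "\<delta> = (1 - cmod b0) ^ length \<alpha>s"
  have \<delta>: "0 < \<delta>" using b0 by (simp add: \<delta>_def)
  obtain K where K: "0 \<le> K" "\<And>x. norm (G x) \<le> norm x * K"
    using bounded_linear.nonneg_bounded[OF cop_bounded_linear[OF cop_G]] by blast
  have "norm x \<le> \<epsilon> * (1 + K / \<delta>)" if \<epsilon>: "0 < \<epsilon>" for \<epsilon>
  proof -
    obtain y where y: "norm (G y - Z x) < \<epsilon>"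
      using x(2) \<epsilon> closure_approachable[of "Z x" "range G"] by (auto simp: M0_def dist_norm)
    have "\<delta> * norm (defect Z y) \<le> norm (defect Z (G y - Z x))"
      using norm_defect_G by (simp add: \<delta>_def cop_diff[OF cop_defect[OF Z]] defect_Z[OF Z iso_Z])
    also have "\<dots> \<le> \<epsilon>"
      using y norm_defect_le[OF Z iso_Z, of "G y - Z x"] by linarith
    finally have d: "norm (defect Z y) \<le> \<epsilon> / \<delta>"
      using \<delta> by (simp add: pos_le_divide_eq mult.commute)
    have "Z (G (adjoint Z y) - x) = (G y - Z x) - G (defect Z y)"
      by (simp add: defect_def cop_diff[OF Z] cop_diff[OF cop_G] ZG)
    then have "norm (G (adjoint Z y) - x) \<le> norm (G y - Z x) + norm (G (defect Z y))"
      using norm_triangle_ineq4[of "G y - Z x" "G (defect Z y)"] iso_Z by metis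
    also have "\<dots> \<le> \<epsilon> + \<epsilon> / \<delta> * K"
      using y K(2)[of "defect Z y"] mult_right_mono[OF d K(1)] by linarith
    finally have n: "norm (G (adjoint Z y) - x) \<le> \<epsilon> * (1 + K / \<delta>)"
      by (simp add: algebra_simps)
    have "inner x (G (adjoint Z y)) = 0"
      using x(1) by (simp add: ocomp_M0 inner_commute)
    then have "(norm x)\<^sup>2 = inner x (x - G (adjoint Z y))"
      by (simp add: power2_norm_eq_inner inner_diff_right)
    also have "\<dots> \<le> norm x * norm (G (adjoint Z y) - x)"
      using norm_cauchy_schwarz[of x "x - G (adjoint Z y)"] by (simp add: norm_minus_commute)
    finally have "norm x \<le> norm (G (adjoint Z y) - x)"
      by (cases "x = 0") (auto simp: power2_eq_square)
    with n show ?thesis by linarith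
  qed
  then have "norm x \<le> 0 + \<epsilon>" if "0 < \<epsilon>" for \<epsilon>
  proof -
    have p: "0 < 1 + K / \<delta>" using K(1) \<delta> by (simp add: add_pos_nonneg)
    show ?thesis
      using \<open>\<And>\<epsilon>. 0 < \<epsilon> \<Longrightarrow> norm x \<le> \<epsilon> * (1 + K / \<delta>)\<close>[of "\<epsilon> / (1 + K / \<delta>)"] p that by simp
  qed
  then have "norm x \<le> 0" by (rule field_le_epsilon)
  then show ?thesis by simp
qed

lemma ess_unitary_on_M0: "ess_unitary_on Z (ocomp M0)"
  by (rule ess_unitary_on_principal[OF Z iso_Z csubspace_M0 Z_M0 decay_defect compression_injective])

end

section \<open>Finitely generated submodules\<close>

definition pact :: "complex poly \<Rightarrow> ('a::chilbert \<Rightarrow> 'a) \<Rightarrow> 'a \<Rightarrow> 'a" where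
  "pact q W x = (\<Sum>i\<le>degree q. coeff q i *\<^sub>C (W ^^ i) x)"

definition num_poly :: "complex list \<Rightarrow> complex poly" where
  "num_poly as = (\<Prod>a\<leftarrow>as. [:- a, 1:])"

definition den_poly :: "complex list \<Rightarrow> complex poly" where
  "den_poly as = (\<Prod>a\<leftarrow>as. [:1, - cnj a:])"

lemma poly_num_poly: "poly (num_poly l) z = (\<Prod>a\<leftarrow>l. z - a)"
  by (induction l) (simp_all add: num_poly_def algebra_simps)

lemma poly_den_poly: "poly (den_poly l) z = (\<Prod>a\<leftarrow>l. 1 - cnj a * z)"
  by (induction l) (simp_all add: den_poly_def algebra_simps)

lemma coeff_den_poly_0: "coeff (den_poly l) 0 = 1"
  using poly_den_poly[of l 0] by (simp add: poly_0_coeff_0 map_replicate_const)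

context
  fixes W :: "'a::chilbert \<Rightarrow> 'a"
  assumes W: "cop W"
begin

lemma cop_pact: "cop (pact q W)"
proof -
  have "pact q W = (\<lambda>x. \<Sum>i\<le>degree q. coeff q i *\<^sub>C (W ^^ i) x)"
    by (auto simp: pact_def)
  then show ?thesis
    using cop_sum_op[of "{..degree q}" "\<lambda>i x. coeff q i *\<^sub>C (W ^^ i) x"] cop_scale[OF cop_funpow[OF W]]
    by simp
qed

lemma pact_bound:
  assumes "degree q \<le> n"
  shows "pact q W x = (\<Sum>i\<le>n. coeff q i *\<^sub>C (W ^^ i) x)"
  unfolding pact_def using assms
  by (intro sum.mono_neutral_left) (auto simp: coeff_eq_0)

lemma pact_pCons: "pact (pCons a q) W x = a *\<^sub>C x + W (pact q W x)"
proof -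
  have "pact (pCons a q) W x = (\<Sum>i\<le>Suc (degree q). coeff (pCons a q) i *\<^sub>C (W ^^ i) x)"
    by (rule pact_bound) (simp add: degree_pCons_le)
  also have "\<dots> = a *\<^sub>C x + (\<Sum>i\<le>degree q. W (coeff q i *\<^sub>C (W ^^ i) x))"
    by (subst sum.atMost_Suc_shift) (simp add: cop_scaleC[OF W])
  finally show ?thesis
    by (simp add: pact_def cop_sum[OF W])
qed

lemma pact_0: "pact 0 W x = 0"
  by (simp add: pact_def)

lemma pact_add: "pact (p + q) W x = pact p W x + pact q W x"
proof -
  define n where "n = max (degree p) (degree q)"
  have "degree p \<le> n" "degree q \<le> n" "degree (p + q) \<le> n"
    by (auto simp: n_def degree_add_le_max)
  then show ?thesis
    by (simp add: pact_bound[of _ n] scaleC_add_left sum.distrib)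
qed

lemma pact_smult: "pact (smult c q) W x = c *\<^sub>C pact q W x"
  by (simp add: pact_bound[OF degree_smult_le] pact_def[of q] scaleC_sum_right)

lemma pact_diff: "pact (p - q) W x = pact p W x - pact q W x"
  using pact_add[of p "- q"] pact_smult[of "- 1" q] by (simp add: scaleC_minus_left)

lemma pact_mult: "pact (p * q) W x = pact p W (pact q W x)"
proof (induction p)
  case (pCons a p)
  then show ?case
    by (simp add: pact_add pact_smult pact_pCons)
qed (simp add: pact_0)

lemma pact_monom: "pact (monom 1 n) W x = (W ^^ n) x"
  by (induction n) (simp_all add: monom_0 monom_Suc pact_pCons pact_0 cop_zero[OF W])

lemma pact_commute:
  assumes B: "cop B" and c: "\<And>x. B (W x) = W (B x)"
  shows "B (pact q W x) = pact q W (B x)"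
  using funpow_commute[of B W, OF c] by (simp add: pact_def cop_simps[OF B])

lemma pact_in:
  assumes M: "csubspace M" "\<And>x. x \<in> M \<Longrightarrow> W x \<in> M" and x: "x \<in> M"
  shows "pact q W x \<in> M"
proof (induction q)
  case 0
  then show ?case using M(1) by (simp add: pact_0 csubspace_def subspace_0)
next
  case (pCons a q)
  then show ?case
    using M x by (simp add: pact_pCons csubspace_def subspace_add)
qed

text \<open>\<open>q'\<close> is the quotient by the indeterminate: modulo the range of W only the
  constant coefficient acts. This is the tool for reducing modulo Z M.\<close>

lemma pact_decompose: "\<exists>q'. \<forall>x. pact q W x = coeff q 0 *\<^sub>C x + W (pact q' W x)"
  by (cases q) (auto simp: pact_pCons)

text \<open>Every Mobius factor contains the inverse of one linear factor of the denominator. These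
  cancel one at a time, so a rational function of W becomes a polynomial.\<close>

lemma blop_den_poly:
  assumes iso: "\<And>x. norm (W x) = norm x" and as: "\<forall>a\<in>set as. cmod a < 1"
  shows "blop W as (pact (den_poly as) W x) = pact (num_poly as) W x"
  using as
proof (induction as arbitrary: x)
  case Nil
  then show ?case by (simp add: den_poly_def num_poly_def)
next
  case (Cons a as)
  have "den_poly (a # as) = den_poly as * [:1, - cnj a:]"
    by (simp only: den_poly_def list.map prod_list.Cons mult.commute)
  then have "pact (den_poly (a # as)) W x = pact (den_poly as) W (x - cnj a *\<^sub>C W x)"
    by (simp only: pact_mult)
      (simp add: pact_pCons pact_0 cop_zero[OF W] scaleC_minus_left cop_minus[OF W] cop_scaleC[OF W])
  then have "blop W as (pact (den_poly (a # as)) W x) = pact (num_poly as) W (x - cnj a *\<^sub>C W x)"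
    using Cons by (simp only: list.set) simp
  also have "\<dots> = pact (num_poly as) W x - cnj a *\<^sub>C W (pact (num_poly as) W x)"
    by (simp only: pact_commute[OF W] cop_diff[OF cop_pact] cop_scaleC[OF cop_pact])
  finally have "blop W (a # as) (pact (den_poly (a # as)) W x) =
      mobius a W (pact (num_poly as) W x - cnj a *\<^sub>C W (pact (num_poly as) W x))"
    by simp
  also have "\<dots> = pact (num_poly (a # as)) W x"
    using Cons.prems by (simp add: mobius_mult[OF W iso] num_poly_def pact_diff pact_smult pact_pCons pact_0
        cop_zero[OF W] scaleC_minus_left)
  finally show ?case .
qed

end

section \<open>Reduction modulo Z M and finiteness of the cokernel\<close>

context blaschke_pair
begin

definition n1 where "n1 = smult c1 (num_poly as)"
definition n2 where "n2 = smult c2 (num_poly bs)"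
text \<open>Clearing denominators in B1(z) - \<alpha> B2(w) gives n1(z) d2(w) - \<alpha> d1(z)
  n2(w). This is its restriction to z = 0, where d1(0) = 1.\<close>

definition factor_mod_Z :: "complex \<Rightarrow> complex poly" where
  "factor_mod_Z \<alpha> = smult (coeff n1 0) (den_poly bs) - smult \<alpha> n2"
definition gpoly_mod_Z :: "complex list \<Rightarrow> complex poly" where "gpoly_mod_Z l = (\<Prod>\<alpha>\<leftarrow>l. factor_mod_Z \<alpha>)"

lemma U_den: "U (pact (den_poly as) Z x) = pact n1 Z x"
  and V_den: "V (pact (den_poly bs) W x) = pact n2 W x"
  by (simp_all add: U_def V_def n1_def n2_def pact_smult[OF Z] pact_smult[OF W]
      blop_den_poly[OF Z iso_Z as(2)] blop_den_poly[OF W iso_W bs(2)])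

text \<open>At a zero b of the second Blaschke product \<open>n2\<close> vanishes and the
  denominator does not, so a vanishing polynomial would have \<open>coeff n1 0 = 0\<close>. Then
  \<alpha> times \<open>n2\<close> would vanish identically, which is impossible.\<close>

lemma factor_mod_Z_nonzero:
  assumes \<alpha>: "\<alpha> \<noteq> 0"
  shows "factor_mod_Z \<alpha> \<noteq> 0"
proof
  assume q: "factor_mod_Z \<alpha> = 0"
  obtain b where b: "b \<in> set bs" "cmod b < 1" using bs by (cases bs) auto
  have n0: "poly (num_poly bs) b = 0"
    using b(1) by (auto simp: poly_num_poly prod_list_zero_iff)
  have "cnj a * b \<noteq> 1" if "a \<in> set bs" for a
  proof -
    have "cmod (cnj a * b) < 1"
      using that b bs mult_strict_mono[of "cmod a" 1 "cmod b" 1] by (simp add: norm_mult)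
    then show ?thesis by auto
  qed
  then have "poly (den_poly bs) b \<noteq> 0"
    by (auto simp: poly_den_poly prod_list_zero_iff)
  moreover have "poly (factor_mod_Z \<alpha>) b = coeff n1 0 * poly (den_poly bs) b"
    by (simp add: factor_mod_Z_def n2_def n0)
  ultimately have "coeff n1 0 = 0" using q by simp
  then have "smult (\<alpha> * c2) (num_poly bs) = 0"
    using q by (simp add: factor_mod_Z_def n2_def)
  moreover have "num_poly bs \<noteq> 0"
    by (auto simp: num_poly_def prod_list_zero_iff)
  ultimately show False using \<alpha> c2 by auto
qed

lemma gpoly_mod_Z_nonzero: "0 \<notin> set l \<Longrightarrow> gpoly_mod_Z l \<noteq> 0"
  by (induction l) (auto simp: gpoly_mod_Z_def factor_mod_Z_nonzero)

text \<open>Modulo \<open>Z M\<close>, clearing denominators turns \<open>\<Prod>(U - \<alpha> V)\<close> into a nonzero polynomial in \<open>W\<close>.\<close>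

lemma gprod_mod_Z:
  assumes M: "csubspace M" "\<And>x. x \<in> M \<Longrightarrow> Z x \<in> M" "\<And>x. x \<in> M \<Longrightarrow> W x \<in> M" and y: "y \<in> M"
  shows "\<exists>y'. \<exists>m\<in>M. gprod U V l y' = pact (gpoly_mod_Z l) W y + Z m"
proof (induction l)
  case Nil
  then show ?case
    using M(1) cop_zero[OF Z]
    by (intro exI[of _ y] bexI[of _ 0]) (auto simp: gpoly_mod_Z_def csubspace_def subspace_0 pact_pCons[OF W] pact_0[OF W] cop_zero[OF W] one_pCons)
next
  case (Cons \<alpha> l)
  then obtain y' m where m: "m \<in> M" "gprod U V l y' = pact (gpoly_mod_Z l) W y + Z m" by blast
  let ?d1 = "pact (den_poly as) Z" and ?d2 = "pact (den_poly bs) W"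
  \<comment> \<open>The common denominator d1(Z) d2(W). Applying U - \<alpha> V after it gives the
    polynomial operator \<open>C\<close>, which maps M into M, whereas nothing is assumed about U
    and V on M.\<close>
  define B where "B = (\<lambda>x. ?d1 (?d2 x))"
  note d1 = cop_pact[OF Z, of "den_poly as"] and d2 = cop_pact[OF W, of "den_poly bs"]
  have in_Z: "pact q Z x \<in> M" and in_W: "pact q W x \<in> M" if "x \<in> M" for q x
    by (rule pact_in; use Z W M that in simp)+
  have sM: "subspace M" using M(1) by (rule csubspace_subspace)
  have B: "cop B" unfolding B_def by (rule cop_compose[OF d1 d2])
  have d1U: "?d1 (U x) = U (?d1 x)" and d1V: "?d1 (V x) = V (?d1 x)"
    and d2U: "?d2 (U x) = U (?d2 x)" and d2V: "?d2 (V x) = V (?d2 x)" for x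
    using pact_commute[OF Z cop_U ZU[symmetric]] pact_commute[OF Z cop_V ZV[symmetric]]
      pact_commute[OF W cop_U WU[symmetric]] pact_commute[OF W cop_V WV[symmetric]] by auto
  have d12: "?d1 (pact q W x) = pact q W (?d1 x)" for x q
    by (rule pact_commute[OF W d1]) (rule pact_commute[OF Z W ZW[symmetric], symmetric])
  define C where "C x = pact n1 Z (?d2 x) - \<alpha> *\<^sub>C ?d1 (pact n2 W x)" for x
  have CM: "C x \<in> M" if "x \<in> M" for x
    unfolding C_def using that in_Z in_W csubspace_scaleC[OF M(1)] sM by (intro subspace_diff) auto
  have UVB: "U (B x) - \<alpha> *\<^sub>C V (B x) = C x" for x
    by (simp add: B_def C_def U_den V_den d1V[symmetric])
  have CZ: "C (Z x) = Z (C x)" for x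
  proof -
    have 1: "Z (pact q Z x) = pact q Z (Z x)" "Z (pact q W x) = pact q W (Z x)" for q x
      using pact_commute[OF Z Z] pact_commute[OF W Z ZW] by auto
    show ?thesis by (simp add: C_def cop_diff[OF Z] cop_scaleC[OF Z] 1)
  qed
  obtain r1 where r1: "\<And>x. pact n1 Z x = coeff n1 0 *\<^sub>C x + Z (pact r1 Z x)"
    using pact_decompose[OF Z] by blast
  obtain r2 where r2: "\<And>x. ?d1 x = x + Z (pact r2 Z x)"
    using pact_decompose[OF Z, of "den_poly as"] by (auto simp: coeff_den_poly_0)
  \<comment> \<open>Modulo Z M only the constant coefficients in Z remain: \<open>coeff n1 0\<close>
    from the numerator and 1 from the denominator.\<close>
  have Cq: "\<exists>m'\<in>M. C x = pact (factor_mod_Z \<alpha>) W x + Z m'" if "x \<in> M" for x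
  proof
    show "pact r1 Z (?d2 x) - \<alpha> *\<^sub>C pact r2 Z (pact n2 W x) \<in> M"
      using that in_Z in_W csubspace_scaleC[OF M(1)] sM by (intro subspace_diff) auto
    show "C x = pact (factor_mod_Z \<alpha>) W x + Z (pact r1 Z (?d2 x) - \<alpha> *\<^sub>C pact r2 Z (pact n2 W x))"
      by (simp add: C_def factor_mod_Z_def r1 r2[of "pact n2 W x"] pact_diff[OF W] pact_smult[OF W] cop_diff[OF Z]
          cop_scaleC[OF Z] scaleC_add_right)
  qed
  have "gprod U V (\<alpha> # l) (B y') = C (gprod U V l y')"
  proof -
    have "gprod U V l (B y') = B (gprod U V l y')"
      by (rule gprod_commute[OF B, symmetric]) (simp_all add: B_def d1U d1V d2U d2V)
    then show ?thesis by (simp add: UVB)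
  qed
  also have "\<dots> = C (pact (gpoly_mod_Z l) W y) + Z (C m)"
  proof -
    have "C (x + x') = C x + C x'" for x x'
      by (simp add: C_def cop_add[OF cop_pact[OF Z]] cop_add[OF cop_pact[OF W]] scaleC_add_right)
    then show ?thesis by (simp add: m(2) CZ)
  qed
  also have "\<exists>m'\<in>M. \<dots> = pact (gpoly_mod_Z (\<alpha> # l)) W y + Z m'"
  proof -
    obtain m' where m': "m' \<in> M" "C (pact (gpoly_mod_Z l) W y) = pact (factor_mod_Z \<alpha>) W (pact (gpoly_mod_Z l) W y) + Z m'"
      using Cq in_W[OF y] by blast
    then have "C (pact (gpoly_mod_Z l) W y) + Z (C m) = pact (gpoly_mod_Z (\<alpha> # l)) W y + Z (m' + C m)"
      by (simp add: gpoly_mod_Z_def pact_mult[OF W] cop_add[OF Z])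
    moreover have "m' + C m \<in> M"
      using m'(1) CM[OF m(1)] sM by (rule subspace_add[rotated])
    ultimately show ?thesis by blast
  qed
  finally show ?case by blast
qed

text \<open>Divide any polynomial r(w) by q, the reduction of G modulo Z. The multiple of q maps f
  into range G + Z M, to which x is orthogonal, and the remainder involves only W^j f with j \<le>
  deg q. Orthogonality to these finitely many vectors thus makes x orthogonal to all monomial
  multiples of the generators.\<close>

lemma finite_cokernel:
  assumes M: "csubspace M" "\<And>x. x \<in> M \<Longrightarrow> Z x \<in> M" "\<And>x. x \<in> M \<Longrightarrow> W x \<in> M"
    and F: "finite F" "F \<subseteq> M"
    and gen: "\<And>x. x \<in> M \<Longrightarrow> (\<And>i j f c. f \<in> F \<Longrightarrow> inner (c *\<^sub>C (Z ^^ i) ((W ^^ j) f)) x = 0) \<Longrightarrow> x = 0"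
  shows "\<exists>F'. finite F' \<and> (\<forall>x\<in>M. x \<in> ocomp M0 \<longrightarrow> x \<in> ocomp (Z ` M) \<longrightarrow> x \<in> ocomp F' \<longrightarrow> x = 0)"
proof -
  define q where "q = gpoly_mod_Z \<alpha>s"
  have q0: "q \<noteq> 0"
    unfolding q_def using \<alpha>s by (intro gpoly_mod_Z_nonzero) auto
  \<comment> \<open>The factors 1 and \<i> turn real orthogonality into complex
    orthogonality.\<close>
  define F' where "F' = (\<lambda>(c, j, f). c *\<^sub>C (W ^^ j) f) ` ({1, \<i>} \<times> {..degree q} \<times> F)"
  have "x = 0" if x: "x \<in> M" "x \<in> ocomp M0" "x \<in> ocomp (Z ` M)" "x \<in> ocomp F'" for x
  proof (rule gen[OF x(1)])
    fix i j f c assume f: "f \<in> F"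
    have fM: "f \<in> M" using f F(2) by blast
    have ZM: "inner (c *\<^sub>C Z m) x = 0" if "m \<in> M" for c m
      using x(3) csubspace_scaleC[OF M(1) that, of c] by (auto simp: ocomp_def simp flip: cop_scaleC[OF Z])
    have GM: "inner (c *\<^sub>C G m) x = 0" for c m
      using x(2) unfolding ocomp_M0 by (simp flip: cop_scaleC[OF cop_G])
    have low: "inner (c *\<^sub>C (W ^^ j) f) x = 0" if "j \<le> degree q" for c j
    proof (rule inner_scaleC_zeroI)
      have "k *\<^sub>C (W ^^ j) f \<in> F'" if "k \<in> {1, \<i>}" for k
        unfolding F'_def using that \<open>j \<le> degree q\<close> f
        by (intro image_eqI[where x = "(k, j, f)"]) auto
      from this[of 1] this[of \<i>] have "(W ^^ j) f \<in> F'" "\<i> *\<^sub>C (W ^^ j) f \<in> F'"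
        by simp_all
      then show "inner ((W ^^ j) f) x = 0" "inner (\<i> *\<^sub>C (W ^^ j) f) x = 0"
        using x(4) by (auto simp: ocomp_def)
    qed
    have "inner (c *\<^sub>C pact r W f) x = 0" for c r
    proof -
      have "pact r W f = pact q W (pact (r div q) W f) + pact (r mod q) W f"
        by (simp flip: pact_mult[OF W] pact_add[OF W])
      moreover have "inner (c *\<^sub>C pact q W y) x = 0" if y: "y \<in> M" for y
      proof -
        obtain y' m where m: "m \<in> M" "G y' = pact q W y + Z m"
          using gprod_mod_Z[OF M y, of \<alpha>s] by (auto simp: q_def)
        then have "pact q W y = G y' - Z m" by simp
        then show ?thesis
          using ZM[OF m(1)] GM by (simp add: scaleC_diff_right inner_diff_left)
      qed
      moreover have "inner (c *\<^sub>C pact (r mod q) W f) x = 0"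
      proof -
        have "degree (r mod q) \<le> degree q"
          using degree_mod_less'[of q r] q0 by (cases "r mod q = 0") auto
        then show ?thesis
          by (simp add: pact_def scaleC_sum_right inner_sum_left low)
      qed
      moreover have "pact (r div q) W f \<in> M"
        by (rule pact_in) (use W M fM in simp_all)
      ultimately show ?thesis
        by (simp add: scaleC_add_right inner_add_left)
    qed
    from this[where r = "monom 1 j"] have W0: "inner (c *\<^sub>C (W ^^ j) f) x = 0" for c
      by (simp add: pact_monom[OF W])
    show "inner (c *\<^sub>C (Z ^^ i) ((W ^^ j) f)) x = 0"
    proof (cases i)
      case 0
      then show ?thesis using W0 by simp
    next
      case (Suc k)
      have "(W ^^ j) f \<in> M" by (induction j) (auto simp: fM M)
      then have "(Z ^^ k) ((W ^^ j) f) \<in> M" by (induction k) (auto simp: M)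
      then show ?thesis using ZM Suc by simp
    qed
  qed
  moreover have "finite F'" using F(1) by (simp add: F'_def)
  ultimately show ?thesis by blast
qed

lemma ess_unitary_on_Z:
  assumes M: "csubspace M" "\<And>x. x \<in> M \<Longrightarrow> Z x \<in> M" "\<And>x. x \<in> M \<Longrightarrow> W x \<in> M"
    and F: "finite F" "F \<subseteq> M"
    and gen: "\<And>x. x \<in> M \<Longrightarrow> (\<And>i j f c. f \<in> F \<Longrightarrow> inner (c *\<^sub>C (Z ^^ i) ((W ^^ j) f)) x = 0) \<Longrightarrow> x = 0"
    and le: "range G \<subseteq> M"
  shows "ess_unitary_on Z (ocomp M)"
proof -
  obtain F' where F': "finite F'"
    "\<And>x. x \<in> M \<Longrightarrow> x \<in> ocomp M0 \<Longrightarrow> x \<in> ocomp (Z ` M) \<Longrightarrow> x \<in> ocomp F' \<Longrightarrow> x = 0"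
    using finite_cokernel[OF M F gen] by blast
  have "M0 \<subseteq> M"
    unfolding M0_def using le csubspace_closed[OF M(1)] by (rule closure_minimal)
  from ess_unitary_on_larger[OF Z iso_Z csubspace_M0 Z_M0 M(1,2) this ess_unitary_on_M0 F']
  show ?thesis .
qed

lemma swap_blaschke: "blaschke_pair W Z e c2 c1 bs as (map inverse \<alpha>s)"
proof -
  interpret sw: shift_pair W Z e by (rule swap)
  show ?thesis
    using c1 c2 as bs \<alpha>s by unfold_locales (auto simp: norm_inverse)
qed

text \<open>The second claim is the first one for the exchanged pair: inverses of unimodular numbers
  are unimodular, and the range of G is unchanged.\<close>

lemma ess_unitary_on_ZW:
  assumes M: "csubspace M" "\<And>x. x \<in> M \<Longrightarrow> Z x \<in> M" "\<And>x. x \<in> M \<Longrightarrow> W x \<in> M"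
    and F: "finite F" "F \<subseteq> M"
    and gen: "\<And>x. x \<in> M \<Longrightarrow> (\<And>i j f c. f \<in> F \<Longrightarrow> inner (c *\<^sub>C (Z ^^ i) ((W ^^ j) f)) x = 0) \<Longrightarrow> x = 0"
    and le: "range G \<subseteq> M"
  shows "ess_unitary_on Z (ocomp M)" "ess_unitary_on W (ocomp M)"
proof -
  show "ess_unitary_on Z (ocomp M)"
    by (rule ess_unitary_on_Z[OF assms])
  interpret sw: blaschke_pair W Z e c2 c1 bs as "map inverse \<alpha>s" by (rule swap_blaschke)
  have "sw.U = V" "sw.V = U"
    by (auto simp: fun_eq_iff sw.U_def sw.V_def U_def V_def)
  moreover have "range G = range (gprod V U (map inverse \<alpha>s))"
    using \<alpha>s by (intro range_gprod_swap cop_U cop_V) auto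
  ultimately have "range sw.G \<subseteq> M" using le by simp
  moreover have "(W ^^ j) ((Z ^^ i) f) = (Z ^^ i) ((W ^^ j) f)" for i j f
    by (rule funpow_commute[symmetric], rule funpow_commute[symmetric], rule ZW[symmetric])
  ultimately show "ess_unitary_on W (ocomp M)"
    using gen by (intro sw.ess_unitary_on_Z[OF M(1,3,2) F]) (auto simp: \<open>\<And>i j f. (W ^^ j) ((Z ^^ i) f) = (Z ^^ i) ((W ^^ j) f)\<close>)
qed

end

section \<open>The core operator and commutators\<close>

context shift_pair
begin

text \<open>The two defects are commuting projections. Their product has range in the common kernel
  of the adjoints, hence in the complex line through e.\<close>

lemma defect_defect_finite_rank: "decay a (\<lambda>x. defect Z (defect W x))"
proof (rule decay_finite_rank)
  show "bounded_linear (\<lambda>x. defect Z (defect W x))"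
    by (rule cop_bounded_linear[OF cop_compose[OF cop_defect[OF Z] cop_defect[OF W]]])
  show "finite {e, \<i> *\<^sub>C e}" by simp
  fix x assume x: "x \<in> ocomp {e, \<i> *\<^sub>C e}"
  define r where "r = defect Z (defect W x)"
  have comm: "adjoint W (defect Z y) = defect Z (adjoint W y)" for y
    by (simp add: defect_def cop_diff[OF W'] W'Z Z'W'[symmetric])
  have Zr: "adjoint Z r = 0"
    unfolding r_def by (rule adjoint_Z_defect[OF Z iso_Z])
  have Wr: "adjoint W r = 0"
    by (simp add: r_def comm adjoint_Z_defect[OF W iso_W] cop_zero[OF cop_defect[OF Z]])
  obtain c where c: "r = c *\<^sub>C e"
    using wandering[OF Zr Wr] by blast
  have "inner r r = inner x (defect W (defect Z r))"
    by (subst (1) r_def) (simp add: defect_self_adjoint[OF Z iso_Z] defect_self_adjoint[OF W iso_W])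
  also have "defect Z r = r" "defect W r = r"
    using Zr Wr defect_eq_iff[OF Z iso_Z] defect_eq_iff[OF W iso_W] by auto
  then have "inner x (defect W (defect Z r)) = inner x r" by simp
  also have "\<dots> = 0"
    using x inner_scaleC_zeroI[of e x c] by (simp add: c ocomp_def inner_commute)
  finally show "r = 0" by simp
qed

text \<open>For the corner A = P Z Q one has A^* A = Q - Q Z^* Q Z Q because Z^* Z = I: the corner
  is exactly what the compression of Z lacks to be isometric.\<close>

lemma decay_off_diagonal:
  assumes M: "csubspace M"
    and d: "decay 2 (\<lambda>x. oproj (ocomp M) x - oproj (ocomp M) (adjoint Z (oproj (ocomp M) (Z (oproj (ocomp M) x)))))"
  shows "decay 1 (\<lambda>x. oproj M (Z (oproj (ocomp M) x)))"
proof -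
  have M': "subspace M" "closed M" using M by (auto simp: csubspace_def)
  have N': "subspace (ocomp M)" "closed (ocomp M)" by (simp_all add: subspace_ocomp closed_ocomp)
  let ?P = "oproj M" and ?Q = "oproj (ocomp M)"
  define A where "A = (\<lambda>x. ?P (Z (?Q x)))"
  have A: "bounded_linear A"
    unfolding A_def
    by (rule bounded_linear_compose[OF bounded_linear_oproj[OF M'] bounded_linear_compose[OF bl_Z bounded_linear_oproj[OF N']]])
  have "adjoint A = (\<lambda>x. ?Q (adjoint Z (?P x)))"
    unfolding A_def by (rule adjoint_eqI) (simp add: oproj_inner[OF M'] oproj_inner[OF N'] inner_adjoint[OF bl_Z, symmetric])
  moreover have P: "?P x = x - ?Q x" for x
    using oproj_ocomp[OF M', of x] by simp
  note Qc = cop_oproj[OF csubspace_ocomp'[OF M]]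
  have "?Q (adjoint Z (?P (A x))) = ?Q x - ?Q (adjoint Z (?Q (Z (?Q x))))" for x
  proof -
    have "?P (A x) = Z (?Q x) - ?Q (Z (?Q x))"
      by (simp add: A_def oproj_idem[OF M']) (rule P)
    then show ?thesis
      by (simp add: cop_diff[OF Z'] cop_diff[OF Qc] adjoint_Z_Z[OF Z iso_Z] oproj_idem[OF N'])
  qed
  ultimately have "decay 2 (\<lambda>x. adjoint A (A x))"
    using d by simp
  from decay_sqrt[OF A this] show ?thesis by (simp add: A_def)
qed

text \<open>Let A, B, C be the corners of Z, W and ZW from the complement of M into M. Replacing
  inner projections P by I - Q gives core = P D_Z D_W P + A A^* + B B^* - C C^*, with D_Z, D_W the
  two defects. The first summand has finite rank, and the corners have rate n^(-1/2); for C this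
  follows from C = Z B + A W Q.\<close>

lemma core_decay:
  assumes M: "csubspace M" and MZ: "\<And>x. x \<in> M \<Longrightarrow> Z x \<in> M" and MW: "\<And>x. x \<in> M \<Longrightarrow> W x \<in> M"
    and eZ: "ess_unitary_on Z (ocomp M)" and eW: "ess_unitary_on W (ocomp M)"
  shows "decay 2 (\<lambda>x. oproj M x - Z (oproj M (adjoint Z (oproj M x))) - W (oproj M (adjoint W (oproj M x)))
     + Z (W (oproj M (adjoint W (adjoint Z (oproj M x))))))"
proof -
  have M': "subspace M" "closed M" using M by (auto simp: csubspace_def)
  have N': "subspace (ocomp M)" "closed (ocomp M)" by (simp_all add: subspace_ocomp closed_ocomp)
  define P where "P = oproj M"
  define Q where "Q = oproj (ocomp M)"
  interpret sw: shift_pair W Z e by (rule swap)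
  have Pc: "cop P" and Qc: "cop Q"
    unfolding P_def Q_def by (intro cop_oproj M csubspace_ocomp')+
  have bl: "bounded_linear P" "bounded_linear Q" using Pc Qc cop_bounded_linear by auto
  have Q: "Q x = x - P x" for x
    unfolding P_def Q_def by (rule oproj_ocomp[OF M'])
  have PM: "P x = x" if "x \<in> M" for x
    using that oproj_eq_iff[OF M'] by (simp add: P_def)
  have PP: "P x \<in> M" for x unfolding P_def by (rule oproj_in[OF M'])
  define A where "A = (\<lambda>x. P (Z (Q x)))"
  define B where "B = (\<lambda>x. P (W (Q x)))"
  define C where "C = (\<lambda>x. P (Z (W (Q x))))"
  have dA: "decay 1 A" and dB: "decay 1 B"
    unfolding A_def B_def P_def Q_def
    using decay_off_diagonal[OF M] sw.decay_off_diagonal[OF M] eZ eW by (auto simp: ess_unitary_on_def)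
  have "C x = Z (B x) + A (W (Q x))" for x
  proof -
    have "P (Z (P (W (Q x)))) = Z (P (W (Q x)))" using PM MZ PP by blast
    then show ?thesis
      unfolding A_def B_def C_def by (simp add: Q[of "W (Q x)"] cop_diff[OF Z] cop_diff[OF Pc])
  qed
  then have C: "C = (\<lambda>x. Z (B x) + A (W (Q x)))" by auto
  have dC: "decay 1 C"
    unfolding C
    using decay_add[OF decay_compose_left[OF bl_Z dB]
        decay_compose_right[OF dA bounded_linear_compose[OF bl_W bl(2)]]] .
  have sa: "inner (P x) y = inner x (P y)" "inner (Q x) y = inner x (Q y)" for x y
    by (simp_all add: P_def Q_def oproj_inner[OF M'] oproj_inner[OF N'])
  have A': "adjoint A = (\<lambda>x. Q (adjoint Z (P x)))" and B': "adjoint B = (\<lambda>x. Q (adjoint W (P x)))"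
    unfolding A_def B_def
    by (rule adjoint_eqI, simp add: sa inner_adjoint[OF bl_Z, symmetric] inner_adjoint[OF bl_W, symmetric])+
  have C': "adjoint C = (\<lambda>x. Q (adjoint W (adjoint Z (P x))))"
    unfolding C_def
    by (rule adjoint_eqI, simp add: sa inner_adjoint[OF bl_Z, symmetric] inner_adjoint[OF bl_W, symmetric])
  define K where "K = (\<lambda>x. P (defect Z (defect W (P x))) + A (adjoint A x) + B (adjoint B x) - C (adjoint C x))"
  have "decay 2 K"
    unfolding K_def
    using decay_compose[OF dA decay_adjoint[OF dA]] decay_compose[OF dB decay_adjoint[OF dB]]
      decay_compose[OF dC decay_adjoint[OF dC]]
    by (intro decay_diff decay_add decay_compose_left[OF bl(1)] decay_compose_right[OF _ bl(1)] defect_defect_finite_rank)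
      (simp_all add: numeral_2_eq_2)
  moreover have "K = (\<lambda>x. P x - Z (P (adjoint Z (P x))) - W (P (adjoint W (P x))) + Z (W (P (adjoint W (adjoint Z (P x))))))"
  proof
    fix x
    have QQ: "Q (Q x) = Q x" for x unfolding Q_def by (rule oproj_idem[OF N'])
    have inM: "P (Z (P y)) = Z (P y)" "P (W (P y)) = W (P y)" "P (Z (W (P y))) = Z (W (P y))" "P (P y) = P y" for y
      using PM MZ MW PP by blast+
    have 1: "A (adjoint A x) = P (Z (adjoint Z (P x))) - Z (P (adjoint Z (P x)))"
      unfolding A' unfolding A_def QQ by (simp add: Q[of "adjoint Z (P x)"] cop_diff[OF Z] cop_diff[OF Pc] inM)
    have 2: "B (adjoint B x) = P (W (adjoint W (P x))) - W (P (adjoint W (P x)))"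
      unfolding B' unfolding B_def QQ by (simp add: Q[of "adjoint W (P x)"] cop_diff[OF W] cop_diff[OF Pc] inM)
    have 3: "C (adjoint C x) = P (Z (W (adjoint W (adjoint Z (P x))))) - Z (W (P (adjoint W (adjoint Z (P x)))))"
      unfolding C' unfolding C_def QQ
      by (simp add: Q[of "adjoint W (adjoint Z (P x))"] cop_diff[OF W] cop_diff[OF Z] cop_diff[OF Pc] inM)
    have 4: "defect Z (defect W y) = y - W (adjoint W y) - Z (adjoint Z y) + Z (W (adjoint W (adjoint Z y)))" for y
      by (simp add: defect_def cop_diff[OF Z] cop_diff[OF Z'] Z'W Z'W')
    show "K x = P x - Z (P (adjoint Z (P x))) - W (P (adjoint W (P x))) + Z (W (P (adjoint W (adjoint Z (P x)))))"
      unfolding K_def 1 2 3 4 by (simp add: cop_diff[OF Pc] cop_add[OF Pc] inM)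
  qed
  ultimately show ?thesis by (simp add: P_def)
qed

end

text \<open>Commutators \<open>[A\<^sup>*, B]\<close> in the ideal: for fixed \<open>A\<close> such \<open>B\<close> form an algebra.\<close>

definition ess_commute :: "('a::{real_inner,complete_space} \<Rightarrow> 'a) \<Rightarrow> ('a \<Rightarrow> 'a) \<Rightarrow> bool" where
  "ess_commute A B \<longleftrightarrow> decay 2 (\<lambda>x. adjoint A (B x) - B (adjoint A x))"

lemma ess_commute_sym:
  assumes A: "bounded_linear A" and B: "bounded_linear B" and c: "ess_commute A B"
  shows "ess_commute B A"
proof -
  have "adjoint (\<lambda>x. adjoint A (B x) - B (adjoint A x)) = (\<lambda>x. adjoint B (A x) - A (adjoint B x))"
  proof (rule adjoint_eqI)
    fix x y
    have "inner (B (adjoint A x)) y = inner x (A (adjoint B y))"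
      by (simp flip: inner_adjoint[OF B] inner_adjoint_left[OF A])
    then show "inner (adjoint A (B x) - B (adjoint A x)) y = inner x (adjoint B (A y) - A (adjoint B y))"
      by (simp add: inner_diff_left inner_diff_right inner_adjoint[OF B] inner_adjoint_left[OF A])
  qed
  then show ?thesis
    using decay_adjoint[OF c[unfolded ess_commute_def]] by (simp add: ess_commute_def)
qed

lemma ess_commute_compose:
  assumes A: "bounded_linear A" and B: "bounded_linear B" "bounded_linear C"
    and c: "ess_commute A B" "ess_commute A C"
  shows "ess_commute A (\<lambda>x. B (C x))"
  using decay_add[OF decay_compose_right[OF c(1)[unfolded ess_commute_def] B(2)]
      decay_compose_left[OF B(1) c(2)[unfolded ess_commute_def]]]
  by (simp add: ess_commute_def linear_simps[OF B(1)])

lemma ess_commute_id: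
  fixes A :: "'a::{real_inner,complete_space} \<Rightarrow> 'a"
  shows "ess_commute A (\<lambda>x. x)"
  by (auto simp: ess_commute_def intro: decay_finite_rank[where F = "{}"])

lemma ess_commute_funpow:
  assumes "bounded_linear A" "bounded_linear B" "ess_commute A B"
  shows "ess_commute A (B ^^ n) \<and> bounded_linear (B ^^ n)"
proof (induction n)
  case 0
  then show ?case using ess_commute_id by (simp add: id_def bounded_linear_ident)
next
  case (Suc n)
  have "B ^^ Suc n = (\<lambda>x. B ((B ^^ n) x))" by auto
  then show ?case
    using ess_commute_compose[OF assms(1,2) _ assms(3), of "B ^^ n"] Suc
      bounded_linear_compose[OF assms(2), of "B ^^ n"] by metis
qed

lemma ess_commute_scale_sum:
  fixes A :: "'a::chilbert \<Rightarrow> 'a"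
  assumes A: "cop A" and c: "\<And>k. k \<in> S \<Longrightarrow> ess_commute A (B k)"
  shows "ess_commute A (\<lambda>x. \<Sum>k\<in>S. c k *\<^sub>C B k x)"
proof -
  note A' = cop_adjoint[OF A]
  have "decay 2 (\<lambda>x. \<Sum>k\<in>S. c k *\<^sub>C (adjoint A (B k x) - B k (adjoint A x)))"
    using c
  proof (induction S rule: infinite_finite_induct)
    case (insert k S)
    have "decay 2 (\<lambda>x. c k *\<^sub>C (adjoint A (B k x) - B k (adjoint A x)))"
      using insert.prems by (intro decay_compose_left[OF bounded_linear_scaleC]) (simp add: ess_commute_def)
    from decay_add[OF this insert.IH] insert show ?case by simp
  qed (auto intro: decay_finite_rank[where F = "{}"])
  then show ?thesis
    by (simp add: ess_commute_def cop_sum[OF A'] cop_scaleC[OF A'] scaleC_diff_right sum_subtractf)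
qed

text \<open>The set named is the one compressed away: the operator acts on the orthogonal complement
  of \<open>M\<close> and, for linear \<open>A\<close>, is zero on \<open>M\<close>.\<close>

definition compression :: "'a::real_inner set \<Rightarrow> ('a \<Rightarrow> 'a) \<Rightarrow> 'a \<Rightarrow> 'a" where
  "compression M A x = oproj (ocomp M) (A (oproj (ocomp M) x))"

definition mult_op :: "('a::chilbert \<Rightarrow> 'a) \<Rightarrow> ('a \<Rightarrow> 'a) \<Rightarrow> (nat \<times> nat \<Rightarrow> complex) \<Rightarrow> (nat \<times> nat) set \<Rightarrow> 'a \<Rightarrow> 'a" where
  "mult_op Z W c S x = (\<Sum>k\<in>S. c k *\<^sub>C (Z ^^ fst k) ((W ^^ snd k) x))"

context shift_pair
begin

context
  fixes M :: "'a set"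
  assumes M: "csubspace M" "\<And>x. x \<in> M \<Longrightarrow> Z x \<in> M" "\<And>x. x \<in> M \<Longrightarrow> W x \<in> M"
    and eZ: "ess_unitary_on Z (ocomp M)" and eW: "ess_unitary_on W (ocomp M)"
begin

private abbreviation Q where "Q \<equiv> oproj (ocomp M)"

private lemma N: "csubspace (ocomp M)" "subspace (ocomp M)" "closed (ocomp M)"
  using M(1) by (auto simp: subspace_ocomp closed_ocomp csubspace_ocomp')

private lemma Q: "cop Q" "bounded_linear Q" "Q (Q x) = Q x" "inner (Q x) y = inner x (Q y)"
  using cop_oproj[OF N(1)] cop_bounded_linear by (auto simp: oproj_idem[OF N(2,3)] oproj_inner[OF N(2,3)])

lemma cop_compression: "cop A \<Longrightarrow> cop (compression M A)"
  unfolding compression_def by (rule cop_compose[OF Q(1) cop_compose[OF _ Q(1)]])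

lemma adjoint_compression:
  assumes "bounded_linear A"
  shows "adjoint (compression M A) = compression M (adjoint A)"
  unfolding compression_def
  by (rule adjoint_eqI) (simp add: Q inner_adjoint[OF assms, symmetric])

lemma compression_mult:
  assumes "cop A" "\<And>x. x \<in> M \<Longrightarrow> A x \<in> M"
  shows "Q (A (Q x)) = Q (A x)"
proof -
  have "x - Q x \<in> M"
    using oproj_ocomp[of M x] oproj_in[of M x] M(1) by (simp add: csubspace_def)
  moreover have "Q m = 0" if "m \<in> M" for m
    using that by (simp add: oproj_eq_0_iff[OF N(2,3)]) (simp add: ocomp_def inner_commute)
  ultimately have "Q (A (x - Q x)) = 0"
    using assms(2) by blast
  then show ?thesis
    by (simp add: cop_diff[OF assms(1)] cop_diff[OF Q(1)])
qed

lemma ess_commute_compression: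
  assumes Y: "cop Y" and YY: "\<And>x. norm (Y x) = norm x" "\<And>x. x \<in> M \<Longrightarrow> Y x \<in> M"
    and eY: "ess_unitary_on Y (ocomp M)"
    and X: "cop X" "\<And>x. x \<in> M \<Longrightarrow> X x \<in> M" "\<And>x. X (Y x) = Y (X x)"
  shows "ess_commute (compression M Y) (compression M X)"
proof -
  define S where "S = compression M Y"
  define T where "T = compression M X"
  have S: "cop S" and T: "cop T" unfolding S_def T_def by (intro cop_compression Y X)+
  note S' = cop_adjoint[OF S]
  note bl = cop_bounded_linear[OF S] cop_bounded_linear[OF T] cop_bounded_linear[OF S']
  have S'_eq: "adjoint S x = Q (adjoint Y (Q x))" for x
    unfolding S_def adjoint_compression[OF cop_bounded_linear[OF Y]] by (simp add: compression_def)
  have QS: "Q (S x) = S x" "S (Q x) = S x" "Q (T x) = T x" "T (Q x) = T x" "adjoint S (Q x) = adjoint S x" "Q (adjoint S x) = adjoint S x" for x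
    by (simp_all add: S'_eq) (simp_all add: S_def T_def compression_def Q)
  have ST: "S (T x) = T (S x)" for x
    using compression_mult[OF Y YY(2)] compression_mult[OF X(1,2)] X(3)
    by (simp add: S_def T_def compression_def Q)
  have d1: "decay 2 (\<lambda>x. Q x - S (adjoint S x))"
  proof -
    have "Q x - S (adjoint S x) = Q (defect Y (Q x))" for x
      using compression_mult[OF Y YY(2), of "adjoint Y (Q x)"]
      by (simp add: S'_eq defect_def cop_diff[OF Q(1)] Q) (simp add: S_def compression_def Q)
    then show ?thesis using eY by (simp add: ess_unitary_on_def)
  qed
  have d2: "decay 2 (\<lambda>x. Q x - adjoint S (S x))"
  proof -
    have "Q x - adjoint S (S x) = Q x - Q (adjoint Y (Q (Y (Q x))))" for x
      by (simp add: S'_eq) (simp add: S_def compression_def Q)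
    then show ?thesis using eY by (simp add: ess_unitary_on_def)
  qed
  have "adjoint S (T x) - T (adjoint S x) =
     adjoint S (T (Q x - S (adjoint S x))) - (Q (T (adjoint S x)) - adjoint S (S (T (adjoint S x))))" for x
    by (simp add: cop_diff[OF T] cop_diff[OF S'] QS ST)
  moreover have "decay 2 (\<lambda>x. adjoint S (T (Q x - S (adjoint S x))) - (Q (T (adjoint S x)) - adjoint S (S (T (adjoint S x)))))"
    by (intro decay_diff decay_compose_left[OF bl(3)] decay_compose_left[OF bl(2)] d1
        decay_compose_right[OF d2 bounded_linear_compose[OF bl(2,3)]])
  ultimately show ?thesis
    by (simp add: ess_commute_def S_def T_def)
qed

text \<open>Compression is multiplicative on operators that preserve M. The inner \<open>Q x\<close>
  makes the case i = j = 0 correct, where the compression of the identity is the projection.\<close>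

lemma compression_monomial:
  "compression M (\<lambda>x. (Z ^^ i) ((W ^^ j) x)) x = (compression M Z ^^ i) ((compression M W ^^ j) (Q x))"
proof -
  have 1: "(compression M W ^^ j) (Q x) = Q ((W ^^ j) x)" for x
  proof (induction j)
    case (Suc j)
    then show ?case
      by (simp add: compression_def Q compression_mult[OF W M(3)])
  qed simp
  have 2: "(compression M Z ^^ i) (Q x) = Q ((Z ^^ i) x)" for x
  proof (induction i)
    case (Suc i)
    then show ?case
      by (simp add: compression_def Q compression_mult[OF Z M(2)])
  qed simp
  have Wj: "(W ^^ j) x \<in> M" if "x \<in> M" for x using that by (induction j) (auto simp: M)
  have "(Z ^^ i) x \<in> M" if "x \<in> M" for x using that by (induction i) (auto simp: M)
  then have "Q ((Z ^^ i) (Q y)) = Q ((Z ^^ i) y)" for y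
    by (rule compression_mult[OF cop_funpow[OF Z]])
  then show ?thesis
    using compression_mult[OF cop_funpow[OF W], OF Wj]
    by (simp add: 1 2 compression_def) (metis (no_types) \<open>\<And>y. Q ((Z ^^ i) (Q y)) = Q ((Z ^^ i) y)\<close>)
qed

lemma ess_commute_generated:
  assumes A: "cop A" and "ess_commute A (compression M Z)" "ess_commute A (compression M W)" "ess_commute A Q"
  shows "ess_commute A (compression M (mult_op Z W c S))"
proof -
  note bl = cop_bounded_linear[OF A] cop_bounded_linear[OF cop_compression[OF Z]]
    cop_bounded_linear[OF cop_compression[OF W]]
  have "compression M (mult_op Z W c S) = (\<lambda>x. \<Sum>k\<in>S. c k *\<^sub>C compression M (\<lambda>x. (Z ^^ fst k) ((W ^^ snd k) x)) x)"
    by (simp add: fun_eq_iff compression_def mult_op_def cop_sum[OF Q(1)] cop_scaleC[OF Q(1)])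
  moreover have "ess_commute A (\<lambda>x. (compression M Z ^^ i) ((compression M W ^^ j) (Q x)))" for i j
  proof -
    note i = ess_commute_funpow[OF bl(1,2) assms(2), of i]
    note j = ess_commute_funpow[OF bl(1,3) assms(3), of j]
    from ess_commute_compose[OF bl(1) conjunct2[OF j] Q(2) conjunct1[OF j] assms(4)]
    show ?thesis
      by (rule ess_commute_compose[OF bl(1) conjunct2[OF i] bounded_linear_compose[OF conjunct2[OF j] Q(2)] conjunct1[OF i]])
  qed
  ultimately show ?thesis
    using ess_commute_scale_sum[OF A, of S "\<lambda>k x. compression M (\<lambda>x. (Z ^^ fst k) ((W ^^ snd k) x)) x" c]
    by (simp add: compression_monomial)
qed

lemma ess_commute_Q: "ess_commute (compression M X) Q" if "cop X" for X
proof -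
  have "adjoint (compression M X) (Q x) = Q (adjoint (compression M X) x)" for x
    by (simp add: adjoint_compression[OF cop_bounded_linear[OF that]]) (simp add: compression_def Q)
  then show ?thesis
    by (auto simp: ess_commute_def intro: decay_finite_rank[where F = "{}"])
qed

lemma cop_mult_op: "cop (mult_op Z W c S)"
proof -
  have "mult_op Z W c S = (\<lambda>x. \<Sum>k\<in>S. c k *\<^sub>C (Z ^^ fst k) ((W ^^ snd k) x))"
    by (simp add: fun_eq_iff mult_op_def)
  then show ?thesis
    using cop_sum_op[of S "\<lambda>k x. c k *\<^sub>C (Z ^^ fst k) ((W ^^ snd k) x)"]
      cop_scale[OF cop_compose[OF cop_funpow[OF Z] cop_funpow[OF W]]] by simp
qed

text \<open>Commutators whose starred operator is a coordinate come first. Passing to adjoints puts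
  a polynomial into the starred slot, and the algebra property is then used a second time.\<close>

theorem ess_commute_mult_op:
  "ess_commute (compression M (mult_op Z W c S)) (compression M (mult_op Z W d T))"
proof -
  interpret sw: shift_pair W Z e by (rule swap)
  note cZ = cop_compression[OF Z] and cW = cop_compression[OF W] and cM = cop_compression[OF cop_mult_op]
  note bl = cop_bounded_linear
  have "ess_commute (compression M Z) (compression M (mult_op Z W c S))"
    by (intro ess_commute_generated cZ ess_commute_Q Z ess_commute_compression M iso_Z iso_W eZ W ZW[symmetric] refl)
  moreover have "ess_commute (compression M W) (compression M (mult_op Z W c S))"
    by (intro ess_commute_generated cW ess_commute_Q W ess_commute_compression M iso_Z iso_W eW Z ZW refl)
  ultimately show ?thesis
    using ess_commute_generated[OF cM ess_commute_sym[OF bl[OF cZ] bl[OF cM]]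
        ess_commute_sym[OF bl[OF cW] bl[OF cM]] ess_commute_Q[OF cop_mult_op]] by blast
qed

end

end

section \<open>The Hardy space of the bidisc as a Hilbert space\<close>

lemma H2_abs_summable:
  assumes "f \<in> H2" "g \<in> H2"
  shows "(\<lambda>k. norm (f k * cnj (g k))) summable_on UNIV"
proof (rule summable_on_comparison_test)
  show "(\<lambda>k. (cmod (f k))\<^sup>2 + (cmod (g k))\<^sup>2) summable_on UNIV"
    using assms by (auto simp: H2_def intro: summable_on_add)
  show "norm (f k * cnj (g k)) \<le> (cmod (f k))\<^sup>2 + (cmod (g k))\<^sup>2" for k
  proof -
    have "norm (f k * cnj (g k)) \<le> 2 * (cmod (f k) * cmod (g k))"
      by (simp add: norm_mult)
    also have "\<dots> \<le> (cmod (f k))\<^sup>2 + (cmod (g k))\<^sup>2"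
      using zero_le_power2[of "cmod (f k) - cmod (g k)"] by (simp add: power2_diff)
    finally show ?thesis .
  qed
qed simp

lemma H2_summable: "f \<in> H2 \<Longrightarrow> g \<in> H2 \<Longrightarrow> (\<lambda>k. f k * cnj (g k)) summable_on UNIV"
  by (rule abs_summable_summable[OF H2_abs_summable])

lemma H2_zero: "0 \<in> H2"
  by (simp add: H2_def zero_fun_def)

lemma H2_add: "f \<in> H2 \<Longrightarrow> g \<in> H2 \<Longrightarrow> f + g \<in> H2"
proof -
  assume "f \<in> H2" "g \<in> H2"
  then have "(\<lambda>k. 2 * (cmod (f k))\<^sup>2 + 2 * (cmod (g k))\<^sup>2) summable_on UNIV"
    by (intro summable_on_add summable_on_cmult_right) (auto simp: H2_def)
  moreover have "(cmod ((f + g) k))\<^sup>2 \<le> 2 * (cmod (f k))\<^sup>2 + 2 * (cmod (g k))\<^sup>2" for k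
  proof -
    have "(cmod ((f + g) k))\<^sup>2 \<le> (cmod (f k) + cmod (g k))\<^sup>2"
      using norm_triangle_ineq[of "f k" "g k"] by (intro power_mono) (auto simp: plus_fun_def)
    also have "\<dots> \<le> 2 * (cmod (f k))\<^sup>2 + 2 * (cmod (g k))\<^sup>2"
      using zero_le_power2[of "cmod (f k) - cmod (g k)"] by (simp add: power2_diff power2_sum)
    finally show ?thesis .
  qed
  ultimately show "f + g \<in> H2"
    unfolding H2_def by (auto intro: summable_on_comparison_test)
qed

lemma H2_scale: "f \<in> H2 \<Longrightarrow> (\<lambda>k. c * f k) \<in> H2"
  by (simp add: H2_def norm_mult power_mult_distrib summable_on_cmult_right)

lemma H2_minus: "f \<in> H2 \<Longrightarrow> - f \<in> H2"
  by (simp add: H2_def fun_Compl_def)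

lemma H2_diff: "f \<in> H2 \<Longrightarrow> g \<in> H2 \<Longrightarrow> f - g \<in> H2"
  using H2_add[OF _ H2_minus, of f g] by simp

text \<open>A type of square-summable coefficient functions, so that the class-based Hilbert space
  theory applies; \<open>rep_h2\<close> leads back to the sets of functions in the
  statement.\<close>

typedef h2 = H2 morphisms rep_h2 Abs_h2
  using H2_zero by blast

lemma rep_h2_in [simp]: "rep_h2 x \<in> H2"
  by (rule rep_h2)

lemma rep_h2_eqI: "(\<And>m n. rep_h2 x (m, n) = rep_h2 y (m, n)) \<Longrightarrow> x = y"
  by (auto simp: rep_h2_inject[symmetric] fun_eq_iff)

instantiation h2 :: ab_group_add
begin

definition "0 = Abs_h2 0"
definition "x + y = Abs_h2 (rep_h2 x + rep_h2 y)"
definition "- x = Abs_h2 (- rep_h2 x)"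
definition "x - y = Abs_h2 (rep_h2 x - rep_h2 y)"

lemma rep_zero [simp]: "rep_h2 0 = 0"
  and rep_add [simp]: "rep_h2 (x + y) = rep_h2 x + rep_h2 y"
  and rep_minus [simp]: "rep_h2 (- x) = - rep_h2 x"
  and rep_diff [simp]: "rep_h2 (x - y) = rep_h2 x - rep_h2 y"
  by (simp_all add: zero_h2_def plus_h2_def uminus_h2_def minus_h2_def Abs_h2_inverse
      H2_zero H2_add H2_minus H2_diff)

instance
  by standard (simp_all add: rep_h2_inject[symmetric] algebra_simps)

end

instantiation h2 :: real_inner
begin

definition "scaleR r x = Abs_h2 (\<lambda>k. of_real r * rep_h2 x k)"
definition "inner x y = Re (h2inner (rep_h2 x) (rep_h2 y))" for x y :: h2
definition "norm x = sqrt (inner x x)" for x :: h2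
definition "dist x y = norm (x - y)" for x y :: h2
definition "sgn x = inverse (norm x) *\<^sub>R x" for x :: h2
definition "(uniformity :: (h2 \<times> h2) filter) = (INF e\<in>{0<..}. principal {(x, y). dist x y < e})"
definition "open U \<longleftrightarrow> (\<forall>x\<in>U. eventually (\<lambda>(x', y). x' = x \<longrightarrow> y \<in> U) uniformity)" for U :: "h2 set"

lemma rep_scaleR [simp]: "rep_h2 (r *\<^sub>R x) = (\<lambda>k. of_real r * rep_h2 x k)"
  by (simp add: scaleR_h2_def Abs_h2_inverse H2_scale)

lemma h2inner_self: "h2inner (rep_h2 x) (rep_h2 x) = of_real (\<Sum>\<^sub>\<infinity>k. (cmod (rep_h2 x k))\<^sup>2)"
proof -
  have "((\<lambda>k. (cmod (rep_h2 x k))\<^sup>2) has_sum (\<Sum>\<^sub>\<infinity>k. (cmod (rep_h2 x k))\<^sup>2)) UNIV"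
    using rep_h2_in[of x] by (simp add: H2_def del: rep_h2_in)
  then have "((\<lambda>k. complex_of_real ((cmod (rep_h2 x k))\<^sup>2)) has_sum of_real (\<Sum>\<^sub>\<infinity>k. (cmod (rep_h2 x k))\<^sup>2)) UNIV"
    by (rule has_sum_of_real)
  then show ?thesis
    unfolding h2inner_def complex_norm_square[symmetric] by (rule infsumI)
qed

lemma h2inner_commute: "h2inner g f = cnj (h2inner f g)"
  unfolding h2inner_def infsum_cnj[symmetric] by (simp add: mult.commute)

lemma h2inner_add_left: "f \<in> H2 \<Longrightarrow> g \<in> H2 \<Longrightarrow> h \<in> H2 \<Longrightarrow> h2inner (f + g) h = h2inner f h + h2inner g h"
  unfolding h2inner_def plus_fun_def distrib_right by (intro infsum_add H2_summable)

lemma h2inner_scale_left: "h2inner (\<lambda>k. c * f k) g = c * h2inner f g"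
  unfolding h2inner_def mult.assoc by (rule infsum_cmult_right')

instance
proof
  fix x y z :: h2 and r s :: real
  show "dist x y = norm (x - y)" by (rule dist_h2_def)
  show "r *\<^sub>R (x + y) = r *\<^sub>R x + r *\<^sub>R y" "(r + s) *\<^sub>R x = r *\<^sub>R x + s *\<^sub>R x"
    "r *\<^sub>R s *\<^sub>R x = (r * s) *\<^sub>R x" "1 *\<^sub>R x = x"
    by (simp_all add: rep_h2_inject[symmetric] fun_eq_iff algebra_simps)
  show "sgn x = inverse (norm x) *\<^sub>R x" by (rule sgn_h2_def)
  show "(uniformity :: (h2 \<times> h2) filter) = (INF e\<in>{0<..}. principal {(x, y). dist x y < e})"
    by (rule uniformity_h2_def)
  show "open U \<longleftrightarrow> (\<forall>x\<in>U. eventually (\<lambda>(x', y). x' = x \<longrightarrow> y \<in> U) uniformity)" for U :: "h2 set"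
    by (rule open_h2_def)
  show "inner x y = inner y x"
    using h2inner_commute[of "rep_h2 x" "rep_h2 y"] by (simp add: inner_h2_def)
  show "inner (x + y) z = inner x z + inner y z"
    by (simp add: inner_h2_def h2inner_add_left)
  show "inner (r *\<^sub>R x) y = r * inner x y"
    by (simp add: inner_h2_def h2inner_scale_left)
  show "0 \<le> inner x x"
    by (simp add: inner_h2_def h2inner_self infsum_nonneg)
  show "inner x x = 0 \<longleftrightarrow> x = 0"
  proof
    assume "inner x x = 0"
    then have "(\<Sum>\<^sub>\<infinity>k. (cmod (rep_h2 x k))\<^sup>2) \<le> 0"
      by (simp add: inner_h2_def h2inner_self)
    then have "(cmod (rep_h2 x k))\<^sup>2 = 0" for k
      using rep_h2_in[of x] by (intro nonneg_infsum_le_0D[where A = UNIV]) (auto simp: H2_def simp del: rep_h2_in)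
    then show "x = 0" by (simp add: rep_h2_inject[symmetric] fun_eq_iff)
  qed (simp add: inner_h2_def h2inner_def)
  show "norm x = sqrt (inner x x)" by (rule norm_h2_def)
qed

end

lemma norm_h2_eq: "norm x = h2norm (rep_h2 x)"
  by (simp add: norm_h2_def inner_h2_def h2inner_self h2norm_def)

lemma power2_norm_h2: "(norm x)\<^sup>2 = (\<Sum>\<^sub>\<infinity>k. (cmod (rep_h2 x k))\<^sup>2)" for x :: h2
  by (simp add: norm_h2_eq h2norm_def infsum_nonneg)

lemma sum_le_norm_h2: "finite S \<Longrightarrow> (\<Sum>k\<in>S. (cmod (rep_h2 x k))\<^sup>2) \<le> (norm x)\<^sup>2"
  unfolding power2_norm_h2 using rep_h2_in[of x]
  by (intro finite_sum_le_infsum) (auto simp: H2_def simp del: rep_h2_in)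

lemma cmod_rep_le_norm: "cmod (rep_h2 x k) \<le> norm x"
  using sum_le_norm_h2[of "{k}" x] by (simp add: power2_le_iff_abs_le)

text \<open>Coefficients of a Cauchy sequence converge. Passing to the limit in finite partial sums
  shows that the coefficientwise limit is square-summable and is also the limit in norm.\<close>

instance h2 :: complete_space
proof
  fix X :: "nat \<Rightarrow> h2" assume X: "Cauchy X"
  have "Cauchy (\<lambda>n. rep_h2 (X n) k)" for k
  proof (rule CauchyI)
    fix e :: real assume "0 < e"
    then obtain N where N: "\<And>m n. m \<ge> N \<Longrightarrow> n \<ge> N \<Longrightarrow> norm (X m - X n) < e"
      using CauchyD[OF X] by blast
    have "norm (rep_h2 (X m) k - rep_h2 (X n) k) < e" if "m \<ge> N" "n \<ge> N" for m n
      using cmod_rep_le_norm[of "X m - X n" k] N[OF that] by simp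
    then show "\<exists>N. \<forall>m\<ge>N. \<forall>n\<ge>N. norm (rep_h2 (X m) k - rep_h2 (X n) k) < e" by blast
  qed
  then have "\<exists>l. (\<lambda>n. rep_h2 (X n) k) \<longlonglongrightarrow> l" for k
    using Cauchy_convergent convergent_def by blast
  then obtain g where g: "\<And>k. (\<lambda>n. rep_h2 (X n) k) \<longlonglongrightarrow> g k" by metis
  have tail: "(rep_h2 (X n) - g) \<in> H2 \<and> (\<Sum>\<^sub>\<infinity>k. (cmod ((rep_h2 (X n) - g) k))\<^sup>2) \<le> e\<^sup>2"
    if N: "\<And>m n. m \<ge> N \<Longrightarrow> n \<ge> N \<Longrightarrow> norm (X m - X n) < e" and n: "n \<ge> N" for N n e
  proof -
    have fin: "(\<Sum>k\<in>S. (cmod ((rep_h2 (X n) - g) k))\<^sup>2) \<le> e\<^sup>2" if "finite S" for S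
    proof (rule LIMSEQ_le_const2)
      show "(\<lambda>m. \<Sum>k\<in>S. (cmod (rep_h2 (X n) k - rep_h2 (X m) k))\<^sup>2) \<longlonglongrightarrow> (\<Sum>k\<in>S. (cmod ((rep_h2 (X n) - g) k))\<^sup>2)"
        by (simp, intro tendsto_intros g)
      show "\<exists>N. \<forall>m\<ge>N. (\<Sum>k\<in>S. (cmod (rep_h2 (X n) k - rep_h2 (X m) k))\<^sup>2) \<le> e\<^sup>2"
      proof (intro exI allI impI)
        fix m assume m: "N \<le> m"
        have "(\<Sum>k\<in>S. (cmod (rep_h2 (X n) k - rep_h2 (X m) k))\<^sup>2) \<le> (norm (X n - X m))\<^sup>2"
          using sum_le_norm_h2[OF that, of "X n - X m"] by simp
        also have "\<dots> \<le> e\<^sup>2"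
          using N[OF n m] by (intro power_mono) auto
        finally show "(\<Sum>k\<in>S. (cmod (rep_h2 (X n) k - rep_h2 (X m) k))\<^sup>2) \<le> e\<^sup>2" .
      qed
    qed
    have s: "(\<lambda>k. (cmod ((rep_h2 (X n) - g) k))\<^sup>2) summable_on UNIV"
      using fin by (intro nonneg_bdd_above_summable_on bdd_aboveI[of _ "e\<^sup>2"]) auto
    moreover have "(\<Sum>\<^sub>\<infinity>k. (cmod ((rep_h2 (X n) - g) k))\<^sup>2) \<le> e\<^sup>2"
      by (rule infsum_le_finite_sums[OF s fin])
    ultimately show ?thesis by (simp add: H2_def)
  qed
  obtain N where N: "\<And>m n. m \<ge> N \<Longrightarrow> n \<ge> N \<Longrightarrow> norm (X m - X n) < 1"
    using CauchyD[OF X, of 1] by auto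
  have "rep_h2 (X N) - (rep_h2 (X N) - g) \<in> H2"
    by (rule H2_diff[OF rep_h2_in conjunct1[OF tail[OF N order_refl]]])
  then have g_H2: "g \<in> H2" by simp
  define L where "L = Abs_h2 g"
  have repL: "rep_h2 L = g" by (simp add: L_def Abs_h2_inverse g_H2)
  have "X \<longlonglongrightarrow> L"
  proof (rule LIMSEQ_I)
    fix e :: real assume e: "0 < e"
    then obtain N where N: "\<And>m n. m \<ge> N \<Longrightarrow> n \<ge> N \<Longrightarrow> norm (X m - X n) < e / 2"
      using CauchyD[OF X, of "e/2"] by auto
    have "norm (X n - L) < e" if "n \<ge> N" for n
    proof -
      have "(norm (X n - L))\<^sup>2 \<le> (e/2)\<^sup>2"
        using tail[OF N that] by (simp add: power2_norm_h2 repL)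
      then have "norm (X n - L) \<le> e / 2"
        by (rule power2_le_imp_le) (use e in simp)
      then show ?thesis using e by simp
    qed
    then show "\<exists>N. \<forall>n\<ge>N. norm (X n - L) < e" by blast
  qed
  then show "convergent X" by (auto simp: convergent_def)
qed

instantiation h2 :: chilbert
begin

definition "scaleC c x = Abs_h2 (\<lambda>k. c * rep_h2 x k)"

lemma rep_scaleC [simp]: "rep_h2 (c *\<^sub>C x) = (\<lambda>k. c * rep_h2 x k)"
  by (simp add: scaleC_h2_def Abs_h2_inverse H2_scale)

instance
proof
  fix x y :: h2 and b c :: complex and r :: real
  show "c *\<^sub>C (x + y) = c *\<^sub>C x + c *\<^sub>C y" "(b + c) *\<^sub>C x = b *\<^sub>C x + c *\<^sub>C x"
    "b *\<^sub>C c *\<^sub>C x = (b * c) *\<^sub>C x" "of_real r *\<^sub>C x = r *\<^sub>R x"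
    by (simp_all add: rep_h2_inject[symmetric] fun_eq_iff algebra_simps)
  show "inner (c *\<^sub>C x) y = inner x (cnj c *\<^sub>C y)"
    by (simp add: inner_h2_def h2inner_def mult_ac)
qed

end

text \<open>The imaginary part is recovered by placing \<i> in the second, conjugate-linear
  slot.\<close>

lemma h2inner_rep: "h2inner (rep_h2 x) (rep_h2 y) = Complex (inner x y) (inner x (\<i> *\<^sub>C y))"
proof -
  have "h2inner (rep_h2 x) (rep_h2 (\<i> *\<^sub>C y)) = - \<i> * h2inner (rep_h2 x) (rep_h2 y)"
    using h2inner_scale_left[of "\<i>" "rep_h2 y" "rep_h2 x"] h2inner_commute[of "rep_h2 x" "\<lambda>k. \<i> * rep_h2 y k"]
      h2inner_commute[of "rep_h2 x" "rep_h2 y"]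
    by simp
  then show ?thesis
    by (simp add: inner_h2_def complex_eq_iff)
qed

text \<open>Transport of coefficients along an injection of index pairs. Both coordinate shifts are
  instances, and the adjoint is the corresponding \<open>pull\<close>.\<close>

definition push :: "(nat \<times> nat \<Rightarrow> nat \<times> nat) \<Rightarrow> h2 \<Rightarrow> h2" where
  "push h x = Abs_h2 (\<lambda>k. if k \<in> range h then rep_h2 x (inv h k) else 0)"

definition pull :: "(nat \<times> nat \<Rightarrow> nat \<times> nat) \<Rightarrow> h2 \<Rightarrow> h2" where
  "pull h x = Abs_h2 (\<lambda>k. rep_h2 x (h k))"

context
  fixes h :: "nat \<times> nat \<Rightarrow> nat \<times> nat"
  assumes h: "inj h"
begin

private lemma push_in: "(\<lambda>k. if k \<in> range h then rep_h2 x (inv h k) else 0) \<in> H2"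
proof -
  let ?f = "\<lambda>k. (cmod (if k \<in> range h then rep_h2 x (inv h k) else 0))\<^sup>2"
  have "?f summable_on UNIV \<longleftrightarrow> ?f summable_on range h"
    by (rule summable_on_cong_neutral) auto
  also have "\<dots> \<longleftrightarrow> (?f \<circ> h) summable_on UNIV"
    by (rule summable_on_reindex[OF h])
  also have "?f \<circ> h = (\<lambda>k. (cmod (rep_h2 x k))\<^sup>2)"
    using h by auto
  finally show ?thesis
    using rep_h2_in[of x] by (simp add: H2_def del: rep_h2_in)
qed

private lemma pull_in: "(\<lambda>k. rep_h2 x (h k)) \<in> H2"
proof -
  have "(\<lambda>k. (cmod (rep_h2 x k))\<^sup>2) summable_on UNIV"
    using rep_h2_in[of x] by (simp add: H2_def del: rep_h2_in)
  then have "(\<lambda>k. (cmod (rep_h2 x k))\<^sup>2) summable_on range h"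
    by (rule summable_on_subset_banach) simp
  then show ?thesis
    by (simp add: H2_def summable_on_reindex[OF h] o_def)
qed

lemma rep_push: "rep_h2 (push h x) (h k) = rep_h2 x k" "k \<notin> range h \<Longrightarrow> rep_h2 (push h x) k = 0"
  using h by (simp_all add: push_def Abs_h2_inverse push_in)

lemma rep_pull: "rep_h2 (pull h x) k = rep_h2 x (h k)"
  by (simp add: pull_def Abs_h2_inverse pull_in)

lemma pull_push: "pull h (push h x) = x"
  by (rule rep_h2_eqI) (simp add: rep_push rep_pull)

lemma inner_push: "inner (push h x) y = inner x (pull h y)"
proof -
  let ?f = "\<lambda>k. rep_h2 (push h x) k * cnj (rep_h2 y k)"
  have "infsum ?f UNIV = infsum ?f (range h)"
    by (rule infsum_cong_neutral) (auto simp: rep_push)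
  also have "\<dots> = infsum (?f \<circ> h) UNIV"
    by (rule infsum_reindex[OF h])
  finally show ?thesis
    by (simp add: inner_h2_def h2inner_def o_def rep_push rep_pull)
qed

lemma norm_push: "norm (push h x) = norm x"
  by (simp add: norm_eq_sqrt_inner inner_push pull_push)

lemma cop_push: "cop (push h)"
proof -
  have eq: "u = v" if "\<And>k. rep_h2 u (h k) = rep_h2 v (h k)" "\<And>k. k \<notin> range h \<Longrightarrow> rep_h2 u k = rep_h2 v k" for u v
  proof (rule rep_h2_eqI)
    show "rep_h2 u (m, n) = rep_h2 v (m, n)" for m n
      by (cases "(m, n) \<in> range h") (use that in auto)
  qed
  have add: "push h (x + y) = push h x + push h y" and scale: "push h (c *\<^sub>C x) = c *\<^sub>C push h x" for x y c
    by (rule eq; simp add: rep_push)+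
  have "bounded_linear (push h)"
  proof (rule bounded_linear_intro[where K = 1])
    show "push h (r *\<^sub>R x) = r *\<^sub>R push h x" for r x
      using scale[of "of_real r"] by (simp add: scaleC_of_real)
  qed (simp_all add: add norm_push)
  then show ?thesis by (simp add: cop_def scale)
qed

lemma adjoint_push: "adjoint (push h) = pull h"
  by (rule adjoint_eqI) (rule inner_push)

end

section \<open>The coordinate shifts and multiplication by polynomials\<close>

definition Zop :: "h2 \<Rightarrow> h2" where "Zop = push (\<lambda>(m, n). (Suc m, n))"
definition Wop :: "h2 \<Rightarrow> h2" where "Wop = push (\<lambda>(m, n). (m, Suc n))"
definition one_h2 :: h2 where "one_h2 = Abs_h2 (\<lambda>k. if k = (0, 0) then 1 else 0)"

lemma inj_Suc_pair: "inj (\<lambda>(m, n). (Suc m, n))" "inj (\<lambda>(m, n). (m, Suc n))"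
  by (auto simp: inj_def)

lemma not_in_range_Suc_pair:
  "(0, n) \<notin> range (\<lambda>(m, n). (Suc m, n))" "(m, 0) \<notin> range (\<lambda>(m, n). (m, Suc n))"
  by auto

lemma rep_Zop: "rep_h2 (Zop x) (m, n) = (if m = 0 then 0 else rep_h2 x (m - 1, n))"
  using rep_push(1)[OF inj_Suc_pair(1), of x "(m - 1, n)"] rep_push(2)[OF inj_Suc_pair(1), of "(m, n)" x]
  by (cases m) (simp_all add: Zop_def not_in_range_Suc_pair)

lemma rep_Wop: "rep_h2 (Wop x) (m, n) = (if n = 0 then 0 else rep_h2 x (m, n - 1))"
  using rep_push(1)[OF inj_Suc_pair(2), of x "(m, n - 1)"] rep_push(2)[OF inj_Suc_pair(2), of "(m, n)" x]
  by (cases n) (simp_all add: Wop_def not_in_range_Suc_pair)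

lemma rep_adjoint_Zop: "rep_h2 (adjoint Zop x) (m, n) = rep_h2 x (Suc m, n)"
  by (simp add: Zop_def adjoint_push[OF inj_Suc_pair(1)] rep_pull[OF inj_Suc_pair(1)])

lemma rep_adjoint_Wop: "rep_h2 (adjoint Wop x) (m, n) = rep_h2 x (m, Suc n)"
  by (simp add: Wop_def adjoint_push[OF inj_Suc_pair(2)] rep_pull[OF inj_Suc_pair(2)])

lemma delta_in_H2: "(\<lambda>k. if k = l then c else 0) \<in> H2"
proof -
  have "(\<lambda>k. (cmod (if k = l then c else 0))\<^sup>2) summable_on UNIV \<longleftrightarrow>
      (\<lambda>k. (cmod (if k = l then c else 0))\<^sup>2) summable_on {l}"
    by (rule summable_on_cong_neutral) auto
  then show ?thesis by (simp add: H2_def)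
qed

lemma rep_one: "rep_h2 one_h2 k = (if k = (0, 0) then 1 else 0)"
  by (simp add: one_h2_def Abs_h2_inverse delta_in_H2)

interpretation bidisc: shift_pair Zop Wop one_h2
proof
  show "cop Zop" "cop Wop" "norm (Zop x) = norm x" "norm (Wop x) = norm x" for x
    by (simp_all add: Zop_def Wop_def cop_push norm_push inj_Suc_pair)
  show "Zop (Wop x) = Wop (Zop x)" for x
    by (rule rep_h2_eqI) (simp add: rep_Zop rep_Wop)
  show "adjoint Zop (Wop x) = Wop (adjoint Zop x)" for x
    by (rule rep_h2_eqI) (simp add: rep_adjoint_Zop rep_Wop)
  fix x assume "adjoint Zop x = 0" "adjoint Wop x = 0"
  then have 0: "rep_h2 x (Suc m, n) = 0" "rep_h2 x (m, Suc n) = 0" for m n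
    using rep_adjoint_Zop[of x m n] rep_adjoint_Wop[of x m n] by simp_all
  have "x = rep_h2 x (0, 0) *\<^sub>C one_h2"
  proof (rule rep_h2_eqI)
    show "rep_h2 x (m, n) = rep_h2 (rep_h2 x (0, 0) *\<^sub>C one_h2) (m, n)" for m n
      using 0 by (cases m; cases n) (auto simp: rep_one)
  qed
  then show "\<exists>c. x = c *\<^sub>C one_h2" by blast
qed

lemma rep_Zop_funpow: "rep_h2 ((Zop ^^ i) x) (m, n) = (if m < i then 0 else rep_h2 x (m - i, n))"
  by (induction i arbitrary: m) (auto simp: rep_Zop)

lemma rep_Wop_funpow: "rep_h2 ((Wop ^^ j) x) (m, n) = (if n < j then 0 else rep_h2 x (m, n - j))"
  by (induction j arbitrary: n) (auto simp: rep_Wop)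

lemma rep_sum_h2: "rep_h2 (sum f S) = (\<lambda>k. \<Sum>i\<in>S. rep_h2 (f i) k)"
  by (induction S rule: infinite_finite_induct) (auto simp: fun_eq_iff)

definition pmul_op :: "coef \<Rightarrow> h2 \<Rightarrow> h2" where
  "pmul_op p = mult_op Zop Wop p {k. p k \<noteq> 0}"

text \<open>The Cauchy product, summed below (m, n), is regrouped as a sum over the support of p,
  which is a polynomial in the two shifts.\<close>

lemma pmul_rep:
  assumes p: "p \<in> poly2"
  shows "pmul p (rep_h2 x) = rep_h2 (pmul_op p x)"
proof (rule ext, clarify)
  fix m n
  let ?S = "{k. p k \<noteq> 0}"
  let ?g = "\<lambda>(i, j). p (i, j) * rep_h2 x (m - i, n - j)"
  have S: "finite ?S" using p by (simp add: poly2_def)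
  have "pmul p (rep_h2 x) (m, n) = (\<Sum>k\<in>{..m} \<times> {..n}. ?g k)"
    by (simp add: pmul_def sum.cartesian_product)
  also have "\<dots> = (\<Sum>k\<in>?S \<inter> ({..m} \<times> {..n}). ?g k)"
    by (rule sum.mono_neutral_right) auto
  also have "\<dots> = (\<Sum>k\<in>?S. if k \<in> {..m} \<times> {..n} then ?g k else 0)"
    by (rule sum.inter_restrict[OF S])
  also have "\<dots> = (\<Sum>k\<in>?S. p k * rep_h2 ((Zop ^^ fst k) ((Wop ^^ snd k) x)) (m, n))"
    by (intro sum.cong) (auto simp: rep_Zop_funpow rep_Wop_funpow)
  also have "\<dots> = rep_h2 (pmul_op p x) (m, n)"
    by (simp add: pmul_op_def mult_op_def rep_sum_h2)
  finally show "pmul p (rep_h2 x) (m, n) = rep_h2 (pmul_op p x) (m, n)" .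
qed

lemma cop_pmul_op: "cop (pmul_op p)"
proof -
  have "pmul_op p = (\<lambda>x. \<Sum>k\<in>{k. p k \<noteq> 0}. p k *\<^sub>C (Zop ^^ fst k) ((Wop ^^ snd k) x))"
    by (simp add: fun_eq_iff pmul_op_def mult_op_def)
  then show ?thesis
    using cop_sum_op[of "{k. p k \<noteq> 0}" "\<lambda>k x. p k *\<^sub>C (Zop ^^ fst k) ((Wop ^^ snd k) x)"]
      cop_scale[OF cop_compose[OF cop_funpow[OF bidisc.Z] cop_funpow[OF bidisc.W]]] by simp
qed

lemma monomials_poly2: "mono_z \<in> poly2" "mono_w \<in> poly2" "mono_zw \<in> poly2"
  by (simp_all add: poly2_def mono_z_def mono_w_def mono_zw_def)

lemma pmul_op_mono: "pmul_op mono_z = Zop" "pmul_op mono_w = Wop" "pmul_op mono_zw = (\<lambda>x. Zop (Wop x))"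
  by (auto simp: fun_eq_iff pmul_op_def mult_op_def mono_z_def mono_w_def mono_zw_def)

section \<open>Subspaces and operators as coefficient sets\<close>

lemma H2_eq_rep: "g \<in> H2 \<longleftrightarrow> (\<exists>y. g = rep_h2 y)"
  using Abs_h2_inverse[of g] rep_h2_in by metis

lemma closed_subspace_imp_csubspace:
  assumes K: "closed_subspace K"
  shows "csubspace {x. rep_h2 x \<in> K}" "rep_h2 ` {x. rep_h2 x \<in> K} = K"
proof -
  have K': "K \<subseteq> H2" "0 \<in> K" "\<And>f g. f \<in> K \<Longrightarrow> g \<in> K \<Longrightarrow> f + g \<in> K"
    "\<And>c f. f \<in> K \<Longrightarrow> (\<lambda>k. c * f k) \<in> K"
    "\<And>s f. \<lbrakk>\<forall>n. s n \<in> K; f \<in> H2; (\<lambda>n. h2norm (s n - f)) \<longlonglongrightarrow> 0\<rbrakk> \<Longrightarrow> f \<in> K"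
    using K unfolding closed_subspace_def by blast+
  have scale: "rep_h2 (c *\<^sub>C x) \<in> K" if "rep_h2 x \<in> K" for c x
    using K'(4)[OF that] by simp
  have "closed {x. rep_h2 x \<in> K}"
    unfolding closed_sequential_limits
  proof safe
    fix s l assume s: "\<forall>n. s n \<in> {x. rep_h2 x \<in> K}" "s \<longlonglongrightarrow> l"
    have "(\<lambda>n. norm (s n - l)) \<longlonglongrightarrow> 0"
      using s(2) tendsto_dist_iff[of s l sequentially] by (simp add: dist_norm)
    then have "(\<lambda>n. h2norm (rep_h2 (s n) - rep_h2 l)) \<longlonglongrightarrow> 0"
      by (simp add: norm_h2_eq)
    with s(1) show "rep_h2 l \<in> K"
      by (intro K'(5)[of "\<lambda>n. rep_h2 (s n)"]) auto
  qed
  moreover have "rep_h2 (r *\<^sub>R x) \<in> K" if "rep_h2 x \<in> K" for r x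
    using scale[OF that, of "of_real r"] unfolding scaleC_of_real .
  ultimately show "csubspace {x. rep_h2 x \<in> K}"
    unfolding csubspace_def subspace_def using K'(2,3) scale
    by (simp del: rep_scaleR rep_scaleC)
  show "rep_h2 ` {x. rep_h2 x \<in> K} = K"
    using K'(1) H2_eq_rep by (auto simp: image_iff subset_iff)
qed

lemma csubspace_imp_closed_subspace:
  assumes S: "csubspace S"
  shows "closed_subspace (rep_h2 ` S)"
proof -
  have sub: "subspace S" "closed S" using S by (auto simp: csubspace_def)
  have add: "rep_h2 x + rep_h2 y \<in> rep_h2 ` S" if "x \<in> S" "y \<in> S" for x y
    by (rule image_eqI[where x = "x + y"]) (simp_all add: subspace_add[OF sub(1) that])
  have scale: "(\<lambda>k. c * rep_h2 x k) \<in> rep_h2 ` S" if "x \<in> S" for c x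
    by (rule image_eqI[where x = "c *\<^sub>C x"]) (simp_all add: csubspace_scaleC[OF S that])
  have zero: "0 \<in> rep_h2 ` S"
    by (rule image_eqI[where x = 0]) (simp_all add: subspace_0[OF sub(1)])
  have lim: "f \<in> rep_h2 ` S" if s: "\<forall>n. s n \<in> rep_h2 ` S" "f \<in> H2" "(\<lambda>n. h2norm (s n - f)) \<longlonglongrightarrow> 0" for s f
  proof -
    have "\<forall>n. \<exists>x. x \<in> S \<and> s n = rep_h2 x" using s(1) by blast
    then obtain t where t: "\<And>n. t n \<in> S" "\<And>n. s n = rep_h2 (t n)" by metis
    obtain l where l: "f = rep_h2 l" using s(2) H2_eq_rep by blast
    have "(\<lambda>n. norm (t n - l)) \<longlonglongrightarrow> 0"
      using s(3) by (simp add: t l norm_h2_eq)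
    then have "t \<longlonglongrightarrow> l" using tendsto_dist_iff[of t l sequentially] by (simp add: dist_norm)
    then have "l \<in> S" using closed_sequentially[OF sub(2), of t l] t(1) by blast
    then show ?thesis using l by blast
  qed
  have "rep_h2 ` S \<subseteq> H2" by auto
  then show ?thesis
    unfolding closed_subspace_def using add scale zero lim by blast
qed

text \<open>On a set closed under complex scalars the imaginary part of the product is again a real
  product with a member of the set.\<close>

lemma h2inner_eq_0_iff:
  assumes "\<And>c x. x \<in> S \<Longrightarrow> c *\<^sub>C x \<in> S"
  shows "(\<forall>x\<in>S. h2inner (rep_h2 y) (rep_h2 x) = 0) \<longleftrightarrow> (\<forall>x\<in>S. inner y x = 0)"
  using assms by (auto simp: h2inner_rep complex_eq_iff)

lemma h2inner_eq_0_commute: "h2inner f g = 0 \<longleftrightarrow> h2inner g f = 0"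
  using h2inner_commute[of f g] by simp

lemma orth_rep:
  assumes S: "csubspace S"
  shows "orth (rep_h2 ` S) = rep_h2 ` ocomp S"
proof -
  have "(\<forall>x\<in>S. h2inner (rep_h2 x) (rep_h2 y) = 0) \<longleftrightarrow> y \<in> ocomp S" for y
    using h2inner_eq_0_iff[of S y] csubspace_scaleC[OF S] h2inner_eq_0_commute
    by (auto simp: ocomp_def inner_commute)
  then show ?thesis
    by (auto simp: orth_def H2_eq_rep)
qed

lemma proj_rep:
  assumes S: "csubspace S"
  shows "proj (rep_h2 ` S) (rep_h2 x) = rep_h2 (oproj S x)"
proof -
  have sub: "subspace S" "closed S" using S by (auto simp: csubspace_def)
  have eq: "(\<forall>h\<in>rep_h2 ` S. h2inner (rep_h2 x - rep_h2 y) h = 0) \<longleftrightarrow> (\<forall>h\<in>S. inner (x - y) h = 0)" for y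
    using h2inner_eq_0_iff[of S "x - y"] csubspace_scaleC[OF S] by auto
  show ?thesis
    unfolding proj_def
  proof (rule the_equality)
    show "rep_h2 (oproj S x) \<in> rep_h2 ` S \<and> (\<forall>h\<in>rep_h2 ` S. h2inner (rep_h2 x - rep_h2 (oproj S x)) h = 0)"
      unfolding eq using oproj_in[OF sub] oproj_orth[OF sub] by blast
    fix g assume g: "g \<in> rep_h2 ` S \<and> (\<forall>h\<in>rep_h2 ` S. h2inner (rep_h2 x - g) h = 0)"
    then obtain z where z: "g = rep_h2 z" "z \<in> S" by blast
    have "oproj S x = z"
      using g eq[of z] z by (intro oproj_unique[OF sub]) auto
    then show "g = rep_h2 (oproj S x)" using z by simp
  qed
qed

lemma h2inner_adjoint:
  assumes B: "cop B"
  shows "h2inner (rep_h2 (B x)) (rep_h2 y) = h2inner (rep_h2 x) (rep_h2 (adjoint B y))"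
proof -
  note bl = cop_bounded_linear[OF B]
  have "\<i> *\<^sub>C adjoint B y = adjoint B (\<i> *\<^sub>C y)"
    by (simp add: cop_scaleC[OF cop_adjoint[OF B]])
  then show ?thesis
    by (simp only: h2inner_rep inner_adjoint[OF bl])
qed

text \<open>The adjoint on a subspace is the projection of an adjoint on the whole space, computed
  from any extension \<open>B\<close> of \<open>A\<close>.\<close>

lemma adj_rep:
  assumes S: "csubspace S" and B: "cop B" and A: "\<And>x. x \<in> S \<Longrightarrow> A (rep_h2 x) = rep_h2 (B x)"
  shows "adj (rep_h2 ` S) A (rep_h2 y) = rep_h2 (oproj S (adjoint B y))"
proof -
  have sub: "subspace S" "closed S" using S by (auto simp: csubspace_def)
  have eq: "(\<forall>x\<in>rep_h2 ` S. h2inner (A x) (rep_h2 y) = h2inner x (rep_h2 z)) \<longleftrightarrow> (\<forall>x\<in>S. inner (adjoint B y - z) x = 0)" for z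
  proof -
    have "h2inner (rep_h2 x) (rep_h2 (adjoint B y - z)) = h2inner (A (rep_h2 x)) (rep_h2 y) - h2inner (rep_h2 x) (rep_h2 z)"
      if "x \<in> S" for x
      using that A h2inner_adjoint[OF B, of x y]
      by (simp add: h2inner_rep inner_diff_right scaleC_diff_right complex_eq_iff del: rep_diff)
    then have "(\<forall>x\<in>rep_h2 ` S. h2inner (A x) (rep_h2 y) = h2inner x (rep_h2 z)) \<longleftrightarrow>
        (\<forall>x\<in>S. h2inner (rep_h2 x) (rep_h2 (adjoint B y - z)) = 0)"
      by auto
    also have "\<dots> \<longleftrightarrow> (\<forall>x\<in>S. h2inner (rep_h2 (adjoint B y - z)) (rep_h2 x) = 0)"
      using h2inner_eq_0_commute by blast
    also have "\<dots> \<longleftrightarrow> (\<forall>x\<in>S. inner (adjoint B y - z) x = 0)"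
      by (rule h2inner_eq_0_iff[OF csubspace_scaleC[OF S]])
    finally show ?thesis .
  qed
  show ?thesis
    unfolding adj_def
  proof (rule the_equality)
    show "rep_h2 (oproj S (adjoint B y)) \<in> rep_h2 ` S \<and>
        (\<forall>x\<in>rep_h2 ` S. h2inner (A x) (rep_h2 y) = h2inner x (rep_h2 (oproj S (adjoint B y))))"
      unfolding eq using oproj_in[OF sub] oproj_orth[OF sub] by blast
    fix h assume h: "h \<in> rep_h2 ` S \<and> (\<forall>x\<in>rep_h2 ` S. h2inner (A x) (rep_h2 y) = h2inner x h)"
    then obtain z where z: "h = rep_h2 z" "z \<in> S" by blast
    have "oproj S (adjoint B y) = z"
      using h eq[of z] z by (intro oproj_unique[OF sub]) auto
    then show "h = rep_h2 (oproj S (adjoint B y))" using z by simp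
  qed
qed

section \<open>Singular values\<close>

text \<open>Complex Gram-Schmidt: u' and x' are the residuals of u and x against the smaller set,
  and x' is then corrected along u'. It exhibits a projection as a complex combination of the
  vectors of \<open>V\<close>, the form of finite rank that \<open>bdd_rank_lt\<close> asks
  for.\<close>

lemma complex_orthogonal_decomposition:
  fixes V :: "'a::chilbert set"
  assumes "finite V"
  shows "\<exists>c. x - (\<Sum>v\<in>V. c v *\<^sub>C v) \<in> ocomp {c *\<^sub>C v |c v. v \<in> V}"
  using assms
proof (induction V arbitrary: x)
  case empty
  then show ?case by (simp add: ocomp_def)
next
  case (insert u V)
  obtain cu where cu: "u - (\<Sum>v\<in>V. cu v *\<^sub>C v) \<in> ocomp {c *\<^sub>C v |c v. v \<in> V}"
    using insert.IH by blast
  obtain cx where cx: "x - (\<Sum>v\<in>V. cx v *\<^sub>C v) \<in> ocomp {c *\<^sub>C v |c v. v \<in> V}"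
    using insert.IH by blast
  define u' where "u' = u - (\<Sum>v\<in>V. cu v *\<^sub>C v)"
  define x' where "x' = x - (\<Sum>v\<in>V. cx v *\<^sub>C v)"
  \<comment> \<open>Coordinates of x' along the real orthogonal pair u', \<i> u'. For u' = 0
    division by zero makes them 0, which does no harm.\<close>
  define \<mu> where "\<mu> = Complex (inner u' x' / inner u' u') (inner (\<i> *\<^sub>C u') x' / inner u' u')"
  define r where "r = x' - \<mu> *\<^sub>C u'"
  have iu: "inner u' (\<i> *\<^sub>C u') = 0" "inner (\<i> *\<^sub>C u') u' = 0" "inner (\<i> *\<^sub>C u') (\<i> *\<^sub>C u') = inner u' u'"
  proof -
    have "inner u' (\<i> *\<^sub>C u') = inner (- (\<i> *\<^sub>C u')) u'"
      using inner_scaleC_right[of u' \<i> u'] by (simp add: scaleC_minus_left)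
    then show "inner u' (\<i> *\<^sub>C u') = 0" by (simp add: inner_commute)
    then show "inner (\<i> *\<^sub>C u') u' = 0" by (simp add: inner_commute)
    show "inner (\<i> *\<^sub>C u') (\<i> *\<^sub>C u') = inner u' u'"
      by (simp add: inner_scaleC_left)
  qed
  have ru': "inner (c *\<^sub>C u') r = 0" for c
  proof (cases "u' = 0")
    case False
    have \<mu>: "\<mu> *\<^sub>C u' = Re \<mu> *\<^sub>R u' + Im \<mu> *\<^sub>R \<i> *\<^sub>C u'"
      by (rule scaleC_complex)
    show ?thesis
      by (rule inner_scaleC_zeroI)
        (use False in \<open>simp_all add: r_def \<mu> inner_diff_right inner_add_right iu\<close>, simp_all add: \<mu>_def)
  qed simp
  have rV: "inner (c *\<^sub>C v) r = 0" if "v \<in> V" for c v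
  proof -
    have "inner (c *\<^sub>C v) x' = 0"
      using cx that by (auto simp: x'_def ocomp_def)
    moreover have "inner (c *\<^sub>C v) (\<mu> *\<^sub>C u') = inner ((cnj \<mu> * c) *\<^sub>C v) u'"
      using inner_scaleC_right[of "c *\<^sub>C v" \<mu> u'] by simp
    moreover have "inner ((cnj \<mu> * c) *\<^sub>C v) u' = 0"
      using cu that by (auto simp: u'_def ocomp_def)
    ultimately show ?thesis by (simp add: r_def inner_diff_right)
  qed
  have ru: "inner (c *\<^sub>C u) r = 0" for c
  proof -
    have "c *\<^sub>C u = c *\<^sub>C u' + (\<Sum>v\<in>V. (c * cu v) *\<^sub>C v)"
      by (simp add: u'_def scaleC_diff_right scaleC_sum_right)
    then show ?thesis
      using ru' rV by (simp add: inner_add_left inner_sum_left)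
  qed
  define d where "d v = (if v = u then \<mu> else cx v - \<mu> * cu v)" for v
  have "(\<Sum>v\<in>insert u V. d v *\<^sub>C v) = \<mu> *\<^sub>C u + (\<Sum>v\<in>V. (cx v - \<mu> * cu v) *\<^sub>C v)"
    using insert.hyps by (simp add: d_def) (intro sum.cong, auto)
  also have "x - \<dots> = r"
    by (simp add: r_def x'_def u'_def scaleC_diff_left scaleC_diff_right scaleC_sum_right sum_subtractf)
  finally have "x - (\<Sum>v\<in>insert u V. d v *\<^sub>C v) = r" .
  moreover have "r \<in> ocomp {c *\<^sub>C v |c v. v \<in> insert u V}"
    using ru rV by (auto simp: ocomp_def)
  ultimately show ?case by (intro exI[of _ d]) (simp only:)
qed

lemma opnorm_bounds:
  fixes T :: "coef \<Rightarrow> coef"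
  assumes S: "csubspace S" and le: "\<And>x. x \<in> S \<Longrightarrow> h2norm (T (rep_h2 x)) \<le> c * norm x"
    and T: "\<And>x. x \<in> S \<Longrightarrow> T (rep_h2 x) \<in> H2"
  shows "0 \<le> opnorm (rep_h2 ` S) T" "0 \<le> c \<Longrightarrow> opnorm (rep_h2 ` S) T \<le> c"
proof -
  let ?X = "{h2norm (T x) | x. x \<in> rep_h2 ` S \<and> h2norm x \<le> 1}"
  have 0: "0 \<in> S" using S by (simp add: csubspace_def subspace_0)
  have mem: "h2norm (T (rep_h2 0)) \<in> ?X"
    using 0 by (auto simp flip: norm_h2_eq intro!: exI[of _ "rep_h2 0"] simp del: rep_zero)
  have ub: "y \<le> \<bar>c\<bar>" if "y \<in> ?X" for y
  proof -
    obtain x where x: "x \<in> S" "norm x \<le> 1" "y = h2norm (T (rep_h2 x))"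
      using \<open>y \<in> ?X\<close> by (auto simp: norm_h2_eq)
    have "y \<le> \<bar>c\<bar> * norm x"
      using le[OF x(1)] x(3) mult_right_mono[OF abs_ge_self[of c], of "norm x"] by simp
    also have "\<dots> \<le> \<bar>c\<bar>"
      using x(2) by (simp add: mult_left_le)
    finally show ?thesis .
  qed
  have "0 \<le> h2norm (T (rep_h2 0))"
    by (simp add: h2norm_def infsum_nonneg)
  also have "\<dots> \<le> opnorm (rep_h2 ` S) T"
    unfolding opnorm_def using mem ub by (intro cSup_upper bdd_aboveI) auto
  finally show "0 \<le> opnorm (rep_h2 ` S) T" .
  show "opnorm (rep_h2 ` S) T \<le> c" if "0 \<le> c"
    unfolding opnorm_def using mem ub that by (intro cSup_least) auto
qed

text \<open>From Gelfand to approximation numbers. Let P project onto the complement of the complex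
  span of V. Then A (I - P) has rank at most \<open>card V\<close>, and the difference A P is
  bounded by c because P maps into \<open>ocomp V\<close>. The complex span is taken since
  competitors have to be complex-linear.\<close>

lemma sv_le:
  fixes T :: "coef \<Rightarrow> coef"
  assumes S: "csubspace S" and A: "cop A" and AS: "\<And>x. A x \<in> S"
    and T: "\<And>x. x \<in> S \<Longrightarrow> T (rep_h2 x) = rep_h2 (A x)"
    and V: "finite V" "card V < n" and c: "0 \<le> c" "\<And>x. x \<in> ocomp V \<Longrightarrow> norm (A x) \<le> c * norm x"
  shows "0 \<le> sv (rep_h2 ` S) T n" "sv (rep_h2 ` S) T n \<le> c"
proof -
  let ?K = "rep_h2 ` S"
  let ?X = "{opnorm ?K (\<lambda>x. T x - F x) | F. bdd_rank_lt ?K F n}"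
  obtain CA where CA: "\<And>x. norm (A x) \<le> norm x * CA"
    using bounded_linear.bounded[OF cop_bounded_linear[OF A]] by blast
  \<comment> \<open>A lower bound is needed for the infimum to be below each candidate. Competitors
    are bounded by definition, so each operator norm is a supremum of a bounded set and is
    nonnegative.\<close>
  have pos: "0 \<le> y" if "y \<in> ?X" for y
  proof -
    obtain F where F: "bdd_rank_lt ?K F n" "y = opnorm ?K (\<lambda>x. T x - F x)" using \<open>y \<in> ?X\<close> by blast
    note F1 = F(1)[unfolded bdd_rank_lt_def]
    obtain CF where CF: "\<forall>x\<in>?K. h2norm (F x) \<le> CF * h2norm x"
      using conjunct1[OF conjunct2[OF conjunct2[OF conjunct2[OF F1]]]] by (elim exE)
    have F': "\<exists>z. F (rep_h2 x) = rep_h2 z \<and> norm z \<le> CF * norm x" if "x \<in> S" for x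
    proof -
      have "F (rep_h2 x) \<in> ?K"
        using conjunct1[OF F1] \<open>x \<in> S\<close> by (rule bspec[OF _ imageI])
      then obtain z where z: "F (rep_h2 x) = rep_h2 z" by (elim imageE)
      have "norm z \<le> CF * norm x"
        using bspec[OF CF imageI[OF \<open>x \<in> S\<close>]] unfolding z norm_h2_eq .
      with z show ?thesis by blast
    qed
    have b: "h2norm (T (rep_h2 x) - F (rep_h2 x)) \<le> (CA + CF) * norm x \<and> T (rep_h2 x) - F (rep_h2 x) \<in> H2"
      if x: "x \<in> S" for x
    proof -
      obtain z where z: "F (rep_h2 x) = rep_h2 z" "norm z \<le> CF * norm x" using F'[OF x] by blast
      have eq: "T (rep_h2 x) - F (rep_h2 x) = rep_h2 (A x - z)"
        by (simp add: T[OF x] z)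
      have "norm (A x - z) \<le> norm (A x) + norm z"
        by (rule norm_triangle_ineq4)
      also have "\<dots> \<le> norm x * CA + CF * norm x"
        by (rule add_mono[OF CA z(2)])
      also have "\<dots> = (CA + CF) * norm x"
        by (simp only: distrib_right mult.commute[of "norm x" CA])
      finally show ?thesis unfolding eq norm_h2_eq by (intro conjI rep_h2_in)
    qed
    show ?thesis
      unfolding F(2) by (rule opnorm_bounds(1)[OF S conjunct1[OF b] conjunct2[OF b]])
  qed
  define Vc where "Vc = {c *\<^sub>C v |c v. v \<in> V}"
  have Vc: "csubspace (ocomp Vc)"
  proof (rule csubspace_ocomp)
    fix c s assume "s \<in> Vc"
    then obtain a v where "s = a *\<^sub>C v" "v \<in> V" unfolding Vc_def by blast
    then show "c *\<^sub>C s \<in> Vc"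
      unfolding Vc_def by (intro CollectI exI[of _ "c * a"] exI[of _ v]) simp
  qed
  have sub: "subspace (ocomp Vc)" "closed (ocomp Vc)" using Vc by (auto simp: csubspace_def)
  define P where "P = oproj (ocomp Vc)"
  have P: "cop P" unfolding P_def by (rule cop_oproj[OF Vc])
  have PV: "P x \<in> ocomp V" for x
  proof -
    have "P x \<in> ocomp Vc" unfolding P_def by (rule oproj_in[OF sub])
    moreover have "v \<in> Vc" if "v \<in> V" for v
      unfolding Vc_def using that by (intro CollectI exI[of _ 1] exI[of _ v]) simp
    ultimately show ?thesis by (auto simp: ocomp_def)
  qed
  have span: "\<exists>c. x - P x = (\<Sum>v\<in>V. c v *\<^sub>C v)" for x
  proof -
    obtain c where c: "x - (\<Sum>v\<in>V. c v *\<^sub>C v) \<in> ocomp Vc"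
      using complex_orthogonal_decomposition[OF V(1)] unfolding Vc_def by blast
    have "P x = x - (\<Sum>v\<in>V. c v *\<^sub>C v)"
      unfolding P_def
    proof (rule oproj_unique[OF sub c])
      fix h assume "h \<in> ocomp Vc"
      then have "inner (c v *\<^sub>C v) h = 0" if "v \<in> V" for v
        using that by (auto simp: ocomp_def Vc_def)
      then show "inner (x - (x - (\<Sum>v\<in>V. c v *\<^sub>C v))) h = 0"
        by (simp add: inner_sum_left)
    qed
    then show ?thesis by (intro exI[of _ c]) simp
  qed
  define B where "B = (\<lambda>x. A (x - P x))"
  have B: "cop B"
    unfolding B_def by (rule cop_compose[OF A cop_minus_op[OF cop_id P]])
  define F where "F = (\<lambda>f. rep_h2 (B (Abs_h2 f)))"
  have F: "F (rep_h2 x) = rep_h2 (B x)" for x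
    by (simp add: F_def rep_h2_inverse)
  have "bdd_rank_lt ?K F n"
    unfolding bdd_rank_lt_def
  proof (intro conjI ballI allI)
    fix x y assume "x \<in> ?K" "y \<in> ?K"
    then obtain x' y' where xy: "x' \<in> S" "y' \<in> S" "x = rep_h2 x'" "y = rep_h2 y'" by blast
    show "F x \<in> ?K" using AS by (auto simp: xy F B_def)
    show "F (x + y) = F x + F y"
      unfolding xy rep_add[symmetric] F by (simp add: cop_add[OF B])
    show "F (\<lambda>k. c * x k) = (\<lambda>k. c * F x k)" for c
      unfolding xy rep_scaleC[symmetric] F by (simp add: cop_scaleC[OF B])
  next
    obtain CB where "\<And>x. norm (B x) \<le> norm x * CB"
      using bounded_linear.bounded[OF cop_bounded_linear[OF B]] by blast
    then show "\<exists>C. \<forall>x\<in>?K. h2norm (F x) \<le> C * h2norm x"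
      by (intro exI[of _ CB]) (auto simp: F norm_h2_eq mult.commute)
    obtain w where w: "bij_betw w {0..<card V} V"
      using ex_bij_betw_nat_finite[OF V(1)] by blast
    show "\<exists>r<n. \<exists>v :: nat \<Rightarrow> coef. \<forall>x\<in>?K. \<exists>c :: nat \<Rightarrow> complex. F x = (\<lambda>k. \<Sum>i<r. c i * v i k)"
    proof (intro exI[of _ "card V"] conjI V(2) exI[of _ "\<lambda>i. rep_h2 (A (w i))"] ballI)
      fix x assume "x \<in> ?K"
      then obtain x' where x': "x = rep_h2 x'" by blast
      obtain c where c: "x' - P x' = (\<Sum>v\<in>V. c v *\<^sub>C v)" using span by blast
      also have "\<dots> = (\<Sum>i<card V. c (w i) *\<^sub>C w i)"
        using sum.reindex_bij_betw[OF w, of "\<lambda>v. c v *\<^sub>C v"] by (simp add: atLeast0LessThan)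
      finally have "B x' = (\<Sum>i<card V. c (w i) *\<^sub>C A (w i))"
        by (simp add: B_def cop_sum[OF A] cop_scaleC[OF A])
      then show "\<exists>c. F x = (\<lambda>k. \<Sum>i<card V. c i * rep_h2 (A (w i)) k)"
        by (intro exI[of _ "\<lambda>i. c (w i)"]) (simp add: x' F rep_sum_h2)
    qed
  qed
  then have mem: "opnorm ?K (\<lambda>x. T x - F x) \<in> ?X" by blast
  have TF: "T (rep_h2 x) - F (rep_h2 x) = rep_h2 (A (P x))" if "x \<in> S" for x
    by (simp add: T[OF that] F B_def cop_diff[OF A])
  have "norm (A (P x)) \<le> c * norm x" for x
    using c(2)[OF PV, of x] mult_left_mono[OF norm_oproj_le[OF sub, of x] c(1)] by (simp add: P_def)
  then have "opnorm ?K (\<lambda>x. T x - F x) \<le> c"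
    using c(1) by (intro opnorm_bounds(2)[OF S]) (auto simp: TF simp flip: norm_h2_eq)
  moreover have "sv ?K T n \<le> opnorm ?K (\<lambda>x. T x - F x)"
    unfolding sv_def by (rule cInf_lower[OF mem]) (rule bdd_belowI[of _ 0], rule pos)
  ultimately show "sv ?K T n \<le> c" by simp
  show "0 \<le> sv ?K T n"
    unfolding sv_def by (rule cInf_greatest[OF _ pos]) (use mem in blast)
qed

lemma decay_sv:
  fixes T :: "coef \<Rightarrow> coef"
  assumes S: "csubspace S" and A: "cop A" "decay 2 A" and AS: "\<And>x. A x \<in> S"
    and T: "\<And>x. x \<in> S \<Longrightarrow> T (rep_h2 x) = rep_h2 (A x)"
  shows "\<exists>C\<ge>0. \<forall>n\<ge>1. 0 \<le> sv (rep_h2 ` S) T n \<and> sv (rep_h2 ` S) T n \<le> C / n"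
proof -
  obtain D where D: "\<And>n. 1 \<le> n \<Longrightarrow> \<exists>V. finite V \<and> card V \<le> D * n \<and>
        (\<forall>x\<in>ocomp V. norm (A x) \<le> D * (1 / sqrt n) ^ 2 * norm x)"
    using decayE[OF A(2)] by blast
  obtain b where b: "0 \<le> b" "\<And>x. norm (A x) \<le> norm x * b"
    using bounded_linear.nonneg_bounded[OF cop_bounded_linear[OF A(1)]] by blast
  \<comment> \<open>The first summand serves m \<ge> 1, where n \<le> 2 (D + 1) m; the second serves
    m = 0, where n \<le> D + 1 and the operator bound b suffices.\<close>
  define C where "C = 2 * real D * (real D + 1) + b * (real D + 1)"
  have C: "0 \<le> C" using b(1) by (simp add: C_def)
  have "\<exists>V. finite V \<and> card V < n \<and> (\<forall>x\<in>ocomp V. norm (A x) \<le> C / n * norm x)" if n: "1 \<le> n" for n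
  proof -
    \<comment> \<open>The largest m with (D + 1) m < n, so that D m directions are admissible for
      the n-th singular value.\<close>
    define m where "m = (n - 1) div (D + 1)"
    have nm: "n \<le> (D + 1) * (m + 1)"
      using dividend_less_div_times[of "D + 1" "n - 1"] n by (simp add: m_def algebra_simps)
    show ?thesis
    proof (cases "m = 0")
      case True
      then have "real n \<le> real D + 1" using nm by simp
      then have "b * n \<le> b * (real D + 1)" using b(1) by (intro mult_left_mono)
      also have "\<dots> \<le> C" by (simp add: C_def)
      finally have "b \<le> C / n" using n by (simp add: field_simps)
      then have "norm (A x) \<le> C / n * norm x" for x
        using b(2)[of x] mult_right_mono[of b "C / n" "norm x"] by (simp add: mult.commute)
      then show ?thesis using n by (intro exI[of _ "{}"]) auto
    next
      case False
      then obtain V where V: "finite V" "card V \<le> D * m"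
        "\<And>x. x \<in> ocomp V \<Longrightarrow> norm (A x) \<le> D * (1 / sqrt m) ^ 2 * norm x"
        using D[of m] by (auto simp: Suc_le_eq)
      have "(D + 1) * m \<le> n - 1" unfolding m_def by (rule times_div_less_eq_dividend)
      then have "card V < n" using V(2) n False by (simp add: algebra_simps)
      moreover have "D * (1 / sqrt m) ^ 2 \<le> C / n"
      proof -
        have "real n \<le> (real D + 1) * (real m + 1)"
          using of_nat_mono[OF nm, where 'a = real] by (simp add: algebra_simps)
        also have "\<dots> \<le> (real D + 1) * (2 * real m)"
          using False by (intro mult_left_mono) auto
        finally have "real D * n \<le> real D * ((real D + 1) * (2 * real m))"
          by (intro mult_left_mono) auto
        also have "\<dots> \<le> C * m"
          using b(1) by (simp add: C_def algebra_simps)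
        finally show ?thesis
          using n False by (simp add: field_simps power2_eq_square)
      qed
      then have "norm (A x) \<le> C / n * norm x" if "x \<in> ocomp V" for x
        using V(3)[OF that] mult_right_mono[of "D * (1 / sqrt m) ^ 2" "C / n" "norm x"] by simp
      ultimately show ?thesis using V(1) by blast
    qed
  qed
  then have "0 \<le> sv (rep_h2 ` S) T n \<and> sv (rep_h2 ` S) T n \<le> C / n" if n: "1 \<le> n" for n
  proof -
    obtain V where V: "finite V" "card V < n" "\<And>x. x \<in> ocomp V \<Longrightarrow> norm (A x) \<le> C / n * norm x"
      using \<open>\<And>n. 1 \<le> n \<Longrightarrow> \<exists>V. finite V \<and> card V < n \<and> (\<forall>x\<in>ocomp V. norm (A x) \<le> C / n * norm x)\<close>[OF n]
      by blast
    have "0 \<le> C / n" using C by simp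
    from sv_le[OF S A(1) AS T V(1,2) this V(3)] show ?thesis by blast
  qed
  with C show ?thesis by blast
qed

text \<open>By 1/(n+1) \<le> 2/(n+2) and 1/(n+2) \<le> ln (n+2) - ln (n+1) the sum telescopes; the
  factor 2 pays for the shift of index.\<close>

lemma sum_inverse_le_ln: "(\<Sum>k=1..n. 1 / real k) \<le> 2 * ln (real n + 1)"
proof (induction n)
  case (Suc n)
  have "ln (real n + 1) - ln (real n + 2) \<le> (real n + 1 - (real n + 2)) / (real n + 2)"
    by (rule ln_diff_le) auto
  moreover have "1 / (real n + 1) \<le> 2 / (real n + 2)"
    by (simp add: field_simps)
  ultimately have "1 / real (Suc n) \<le> 2 * (ln (real n + 2) - ln (real n + 1))"
    by (simp add: add.commute)
  with Suc show ?case by (simp add: add.commute)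
qed simp

text \<open>The rate C/n gives partial sums of at most 2 C ln (n + 1) and summable squares.\<close>

lemma
  fixes T :: "coef \<Rightarrow> coef"
  assumes S: "csubspace S" and A: "cop A" "decay 2 A" and AS: "\<And>x. A x \<in> S"
    and T: "\<And>x. x \<in> S \<Longrightarrow> T (rep_h2 x) = rep_h2 (A x)"
  shows macaev_decay: "macaev (rep_h2 ` S) T"
    and hilbert_schmidt_decay: "hilbert_schmidt (rep_h2 ` S) T"
proof -
  let ?s = "sv (rep_h2 ` S) T"
  obtain C where C: "0 \<le> C" "\<And>n. 1 \<le> n \<Longrightarrow> 0 \<le> ?s n" "\<And>n. 1 \<le> n \<Longrightarrow> ?s n \<le> C / n"
    using decay_sv[OF assms] by blast
  have compact: "compact_op (rep_h2 ` S) T"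
    unfolding compact_op_def
  proof (rule tendsto_sandwich[where f = "\<lambda>_. 0" and h = "\<lambda>n. C / real (Suc n)"])
    have "(\<lambda>n. C * (1 / real (Suc n))) \<longlonglongrightarrow> C * 0"
      by (intro tendsto_intros LIMSEQ_Suc[OF lim_inverse_n'])
    then show "(\<lambda>n. C / real (Suc n)) \<longlonglongrightarrow> 0" by simp
    show "\<forall>\<^sub>F n in sequentially. 0 \<le> ?s (Suc n)" "\<forall>\<^sub>F n in sequentially. ?s (Suc n) \<le> C / real (Suc n)"
      using C(2,3)[of "Suc _"] by (auto intro!: always_eventually)
  qed simp
  have "(\<Sum>k=1..n. ?s k) / ln (real n + 1) \<le> 2 * C" if "1 \<le> n" for n
  proof -
    have "(\<Sum>k=1..n. ?s k) \<le> (\<Sum>k=1..n. C * (1 / k))"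
      using C(3) by (intro sum_mono) simp
    also have "\<dots> \<le> C * (2 * ln (real n + 1))"
      unfolding sum_distrib_left[symmetric] using C(1) by (intro mult_left_mono sum_inverse_le_ln)
    finally show ?thesis
      using that by (simp add: pos_divide_le_eq mult_ac)
  qed
  with compact show "macaev (rep_h2 ` S) T" by (auto simp: macaev_def)
  have "summable (\<lambda>n. C\<^sup>2 * inverse ((real (Suc n))\<^sup>2))"
    using inverse_power_summable[of 2, where 'a = real]
      summable_Suc_iff[of "\<lambda>n. inverse ((real n)\<^sup>2)"] by (intro summable_mult) simp
  then have "summable (\<lambda>n. (?s (Suc n))\<^sup>2)"
  proof (rule summable_comparison_test'[where N = 0])
    fix n :: nat
    have "(?s (Suc n))\<^sup>2 \<le> (C / Suc n)\<^sup>2"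
      using C(2,3)[of "Suc n"] by (intro power_mono) auto
    then show "norm ((?s (Suc n))\<^sup>2) \<le> C\<^sup>2 * inverse ((real (Suc n))\<^sup>2)"
      by (simp add: divide_inverse power_mult_distrib power_inverse)
  qed
  with compact show "hilbert_schmidt (rep_h2 ` S) T" by (simp add: hilbert_schmidt_def)
qed

section \<open>Point evaluations\<close>

lemma kernel_in_H2:
  assumes "cmod z < 1" "cmod w < 1"
  shows "(\<lambda>(m, n). cnj z ^ m * cnj w ^ n) \<in> H2"
proof -
  have "(\<lambda>k. (cmod z ^ 2) ^ fst k * (cmod w ^ 2) ^ snd k) summable_on (UNIV \<times> UNIV)"
  proof (rule summable_on_SigmaI)
    have g: "((\<lambda>n. (cmod v ^ 2) ^ n) has_sum (1 / (1 - cmod v ^ 2))) UNIV" if "cmod v < 1" for v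
      using that by (intro sums_nonneg_imp_has_sum geometric_sums) (auto simp: abs_square_less_1)
    show "((\<lambda>n. (cmod z ^ 2) ^ fst (m, n) * (cmod w ^ 2) ^ snd (m, n)) has_sum
        ((cmod z ^ 2) ^ m * (1 / (1 - cmod w ^ 2)))) UNIV" for m
      using has_sum_cmult_right[OF g[OF assms(2)], of "(cmod z ^ 2) ^ m"] by simp
    show "(\<lambda>m. (cmod z ^ 2) ^ m * (1 / (1 - cmod w ^ 2))) summable_on UNIV"
      using g[OF assms(1)] by (intro summable_on_cmult_left) (auto simp: summable_on_def)
  qed simp
  then show ?thesis
    by (simp add: H2_def case_prod_unfold norm_mult norm_power power_mult_distrib power_mult[symmetric] mult.commute)
qed

definition eval_h2 :: "complex \<Rightarrow> complex \<Rightarrow> h2 \<Rightarrow> complex" where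
  "eval_h2 z w x = (\<Sum>\<^sub>\<infinity>(m, n). rep_h2 x (m, n) * z ^ m * w ^ n)"

context
  fixes z w :: complex
  assumes zw: "cmod z < 1" "cmod w < 1"
begin

text \<open>The Szego kernel at (z, w). Evaluation is the inner product with it, and it is a common
  eigenvector of the adjoint shifts, so evaluation is multiplicative on the shifts.\<close>

definition kernel_h2 :: h2 where "kernel_h2 = Abs_h2 (\<lambda>(m, n). cnj z ^ m * cnj w ^ n)"

lemma rep_kernel: "rep_h2 kernel_h2 (m, n) = cnj z ^ m * cnj w ^ n"
  by (simp add: kernel_h2_def Abs_h2_inverse kernel_in_H2 zw)

lemma eval_eq_inner: "eval_h2 z w x = h2inner (rep_h2 x) (rep_h2 kernel_h2)"
  unfolding eval_h2_def h2inner_def by (rule infsum_cong) (auto simp: rep_kernel)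

lemma has_sum_eval: "((\<lambda>(m, n). rep_h2 x (m, n) * z ^ m * w ^ n) has_sum eval_h2 z w x) UNIV"
proof -
  have "((\<lambda>k. rep_h2 x k * cnj (rep_h2 kernel_h2 k)) has_sum h2inner (rep_h2 x) (rep_h2 kernel_h2)) UNIV"
    unfolding h2inner_def by (rule has_sum_infsum[OF H2_summable]) auto
  moreover have "(\<lambda>k. rep_h2 x k * cnj (rep_h2 kernel_h2 k)) = (\<lambda>(m, n). rep_h2 x (m, n) * z ^ m * w ^ n)"
    by (auto simp: rep_kernel)
  ultimately show ?thesis by (simp add: eval_eq_inner)
qed

lemma eval_scaleC: "eval_h2 z w (c *\<^sub>C x) = c * eval_h2 z w x"
  by (simp add: eval_eq_inner h2inner_scale_left)

lemma eval_add: "eval_h2 z w (x + y) = eval_h2 z w x + eval_h2 z w y"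
  by (simp add: eval_eq_inner h2inner_add_left)

lemma eval_diff: "eval_h2 z w (x - y) = eval_h2 z w x - eval_h2 z w y"
  using eval_add[of "x - y" y] by simp

lemma eval_Zop: "eval_h2 z w (Zop x) = z * eval_h2 z w x"
  and eval_Wop: "eval_h2 z w (Wop x) = w * eval_h2 z w x"
proof -
  have k: "adjoint Zop kernel_h2 = cnj z *\<^sub>C kernel_h2" "adjoint Wop kernel_h2 = cnj w *\<^sub>C kernel_h2"
    by (rule rep_h2_eqI, simp add: rep_adjoint_Zop rep_adjoint_Wop rep_kernel)+
  have "h2inner f (\<lambda>k. cnj c * g k) = c * h2inner f g" for f g c
    using h2inner_scale_left[of "cnj c" g f] h2inner_commute[of f "\<lambda>k. cnj c * g k"] h2inner_commute[of g f] by simp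
  then show "eval_h2 z w (Zop x) = z * eval_h2 z w x" "eval_h2 z w (Wop x) = w * eval_h2 z w x"
    by (simp_all add: eval_eq_inner h2inner_adjoint bidisc.Z bidisc.W k)
qed

lemma eval_one: "eval_h2 z w one_h2 = 1"
proof -
  have "eval_h2 z w one_h2 = (\<Sum>\<^sub>\<infinity>k\<in>{(0::nat, 0::nat)}. 1)"
    unfolding eval_h2_def by (rule infsum_cong_neutral) (auto simp: rep_one split: if_splits)
  then show ?thesis by simp
qed

end

lemma powser_zero_coeff:
  fixes a :: "nat \<Rightarrow> complex"
  assumes "\<And>z. cmod z < 1 \<Longrightarrow> (\<lambda>n. a n * z ^ n) sums 0"
  shows "a n = 0"
proof -
  have "conv_radius a \<ge> ereal (norm (1/2 :: complex))"
    using sums_summable[OF assms[of "1/2"]] by (intro conv_radius_geI) auto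
  then have r: "fps_conv_radius (Abs_fps a) > 0"
    unfolding fps_conv_radius_def by (simp, meson ereal_less(2) half_gt_zero_iff less_le_trans zero_less_one)
  have "Abs_fps a = 0"
  proof (rule eval_fps_eqD[OF r])
    have "eval_fps (Abs_fps a) z = eval_fps 0 z" if "z \<in> ball 0 1" for z
      using sums_unique[OF assms[of z]] that by (simp add: eval_fps_def)
    then show "\<forall>\<^sub>F z in nhds 0. eval_fps (Abs_fps a) z = eval_fps 0 z"
      by (intro eventually_nhds_in_open[THEN eventually_mono, of "ball 0 1"]) auto
  qed simp
  then show ?thesis by (metis fps_nth_Abs_fps fps_zero_nth)
qed

text \<open>The one-variable identity theorem twice: for fixed w the coefficients
  \<open>g w m\<close> of the series in z vanish, and each of them is a power series in w.\<close>

lemma eval_eq_0_imp: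
  assumes "\<And>z w. cmod z < 1 \<Longrightarrow> cmod w < 1 \<Longrightarrow> eval_h2 z w x = 0"
  shows "x = 0"
proof (rule rep_h2_eqI)
  define g where "g w m = (\<Sum>\<^sub>\<infinity>n. rep_h2 x (m, n) * w ^ n)" for w m
  have g: "((\<lambda>n. rep_h2 x (m, n) * w ^ n) has_sum g w m) UNIV" if w: "cmod w < 1" for w m
    unfolding g_def
  proof (rule has_sum_infsum, rule norm_summable_imp_summable_on)
    have "norm (rep_h2 x (m, n) * w ^ n) \<le> norm x * cmod w ^ n" for n
      using cmod_rep_le_norm[of x "(m, n)"] by (simp add: norm_mult norm_power mult_right_mono)
    then show "summable (\<lambda>n. norm (rep_h2 x (m, n) * w ^ n))"
      using w by (intro summable_comparison_test'[OF summable_mult[OF summable_geometric]]) auto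
  qed
  have "g w m = 0" if w: "cmod w < 1" for w m
  proof (rule powser_zero_coeff)
    fix z :: complex assume z: "cmod z < 1"
    have "((\<lambda>(m, n). rep_h2 x (m, n) * z ^ m * w ^ n) has_sum 0) (UNIV \<times> UNIV)"
      using has_sum_eval[OF z w, of x] assms[OF z w] by simp
    then have "((\<lambda>m. g w m * z ^ m) has_sum 0) UNIV"
    proof (rule has_sum_SigmaD)
      show "((\<lambda>n. case (m, n) of (m, n) \<Rightarrow> rep_h2 x (m, n) * z ^ m * w ^ n) has_sum g w m * z ^ m) UNIV" for m
        using has_sum_cmult_left[OF g[OF w, of m], of "z ^ m"] by (simp add: mult_ac)
    qed
    then show "(\<lambda>m. g w m * z ^ m) sums 0"
      by (rule has_sum_imp_sums)
  qed
  then have "(\<lambda>n. rep_h2 x (m, n) * w ^ n) sums 0" if "cmod w < 1" for w m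
    using has_sum_imp_sums[OF g[OF that, of m]] that by simp
  from powser_zero_coeff[OF this] show "rep_h2 x (m, n) = rep_h2 0 (m, n)" for m n
    by simp
qed

section \<open>Distinguished homogeneous polynomials\<close>

lemma homogeneous_peval:
  assumes p: "p \<in> poly2" and hom: "\<forall>i j. p (i, j) \<noteq> 0 \<longrightarrow> i + j = d"
  shows "peval p z w = (\<Sum>i\<le>d. p (i, d - i) * z ^ i * w ^ (d - i))"
proof -
  have "peval p z w = (\<Sum>k\<in>(\<lambda>i. (i, d - i)) ` {..d}. p k * z ^ fst k * w ^ snd k)"
    unfolding peval_def
  proof (rule sum.mono_neutral_left)
    show "{k. p k \<noteq> 0} \<subseteq> (\<lambda>i. (i, d - i)) ` {..d}"
      using hom by (force simp: image_iff)
  qed auto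
  also have "\<dots> = (\<Sum>i\<le>d. p (i, d - i) * z ^ i * w ^ (d - i))"
    by (subst sum.reindex) (auto simp: inj_on_def)
  finally show ?thesis .
qed

text \<open>Homogeneity makes the zero set invariant under scaling, so a boundary zero (u, v) is the
  limit of the zeros t (u, v) inside the bidisc as t tends to 1; distinguishedness then puts it on
  the torus.\<close>

lemma distinguished_homogeneous_zero:
  assumes p: "p \<in> poly2" and hom: "\<forall>i j. p (i, j) \<noteq> 0 \<longrightarrow> i + j = d" and dist: "distinguished p"
    and uv: "peval p u v = 0" "cmod u \<le> 1" "cmod v \<le> 1" "cmod u = 1 \<or> cmod v = 1"
  shows "cmod u = 1 \<and> cmod v = 1"
proof -
  define t where "t n = real (Suc n) / real (Suc (Suc n))" for n
  have t: "0 < t n" "t n < 1" for n by (simp_all add: t_def)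
  have "t \<longlonglongrightarrow> 1"
    unfolding t_def using LIMSEQ_Suc[OF LIMSEQ_n_over_Suc_n] by simp
  then have lim: "(\<lambda>n. (of_real (t n) * u, of_real (t n) * v)) \<longlonglongrightarrow> (of_real 1 * u, of_real 1 * v)"
    by (intro tendsto_intros)
  have mem: "(of_real (t n) * u, of_real (t n) * v) \<in> zeroset2 p \<inter> bidisc" for n
  proof -
    have "peval p (of_real (t n) * u) (of_real (t n) * v) = of_real (t n) ^ d * peval p u v"
      unfolding homogeneous_peval[OF p hom] sum_distrib_left
    proof (rule sum.cong[OF refl])
      fix i assume "i \<in> {..d}"
      then have "complex_of_real (t n) ^ d = of_real (t n) ^ i * of_real (t n) ^ (d - i)"
        by (simp flip: power_add)
      then show "p (i, d - i) * (of_real (t n) * u) ^ i * (of_real (t n) * v) ^ (d - i) =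
          of_real (t n) ^ d * (p (i, d - i) * u ^ i * v ^ (d - i))"
        by (simp add: power_mult_distrib)
    qed
    moreover have "t n * cmod u < 1" "t n * cmod v < 1"
      using mult_left_le[OF uv(2), of "t n"] mult_left_le[OF uv(3), of "t n"] t[of n] by linarith+
    ultimately show ?thesis
      using uv(1) t[of n] by (simp add: zeroset2_def bidisc_def norm_mult)
  qed
  have "(u, v) \<in> closure (zeroset2 p \<inter> bidisc)"
    unfolding closure_sequential using mem lim
    by (intro exI[of _ "\<lambda>n. (of_real (t n) * u, of_real (t n) * v)"]) auto
  moreover have "(u, v) \<notin> bidisc"
    using uv(4) by (auto simp: bidisc_def)
  ultimately have "(u, v) \<in> torus2"
    using dist by (auto simp: distinguished_def)
  then show ?thesis by (simp add: torus2_def)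
qed

text \<open>Dehomogenise to q(x) = p(x, 1). A root \<alpha> in the closed disc gives the zero
  (\<alpha>, 1), a root outside it the zero (1, 1/\<alpha>). Either lies on the boundary of the
  bidisc, hence on the torus, so |\<alpha>| = 1.\<close>

lemma distinguished_homogeneous_factor:
  assumes p: "p \<in> poly2" and hom: "homogeneous2 p" and dist: "distinguished p"
  shows "\<exists>c \<alpha>s. c \<noteq> 0 \<and> (\<forall>\<alpha>\<in>set \<alpha>s. cmod \<alpha> = 1) \<and> (\<forall>z w. peval p z w = c * (\<Prod>\<alpha>\<leftarrow>\<alpha>s. z - \<alpha> * w))"
proof -
  obtain d where d: "\<forall>i j. p (i, j) \<noteq> 0 \<longrightarrow> i + j = d"
    using hom by (auto simp: homogeneous2_def)
  note pe = homogeneous_peval[OF p d] and zero = distinguished_homogeneous_zero[OF p d dist]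
  define q where "q = (\<Sum>i\<le>d. monom (p (i, d - i)) i)"
  have poly_q: "poly q x = (\<Sum>i\<le>d. p (i, d - i) * x ^ i)" for x
    by (simp add: q_def poly_sum poly_monom)
  have w0: "peval p z 0 = p (d, 0) * z ^ d" for z
  proof -
    have "peval p z 0 = (\<Sum>i\<in>{d}. p (i, d - i) * z ^ i * 0 ^ (d - i))"
      unfolding pe by (rule sum.mono_neutral_right) auto
    then show ?thesis by simp
  qed
  \<comment> \<open>A zero at (1, 0) would be a boundary zero off the torus. This rules out p = 0 as
    well and gives q full degree d, so that no factor w is split off.\<close>
  have c: "p (d, 0) \<noteq> 0"
    using zero[of 1 0] w0[of 1] by auto
  have "coeff q d = p (d, 0)" by (simp add: q_def coeff_sum if_distrib sum.delta)
  moreover have "degree q \<le> d"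
    unfolding q_def by (rule degree_sum_le) (auto intro: order_trans[OF degree_monom_le])
  ultimately have deg: "degree q = d"
    using c by (metis le_antisym le_degree)
  then have lead: "lead_coeff q = p (d, 0)" using \<open>coeff q d = p (d, 0)\<close> by simp
  then have "q \<noteq> 0" using c by auto
  then obtain A where A: "size A = degree q" "q = smult (lead_coeff q) (\<Prod>x\<in>#A. [:-x, 1:])"
    using alg_closed_imp_factorization[of q] by blast
  obtain \<alpha>s where \<alpha>s: "A = mset \<alpha>s" by (metis ex_mset)
  have q_eq: "poly q x = p (d, 0) * (\<Prod>\<alpha>\<leftarrow>\<alpha>s. x - \<alpha>)" for x
  proof -
    have "poly (\<Prod>\<alpha>\<leftarrow>l. [:-\<alpha>, 1:]) x = (\<Prod>\<alpha>\<leftarrow>l. x - \<alpha>)" for l :: "complex list"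
      using poly_num_poly[of l x] by (simp add: num_poly_def)
    then show ?thesis
      by (subst A(2)) (simp add: lead \<alpha>s prod_mset_prod_list flip: mset_map)
  qed
  have scale: "peval p z w = w ^ d * poly q (z / w)" if "w \<noteq> 0" for z w
    unfolding pe poly_q sum_distrib_left
  proof (rule sum.cong[OF refl])
    fix i assume "i \<in> {..d}"
    then have "w ^ d = w ^ i * w ^ (d - i)" by (simp flip: power_add)
    then show "p (i, d - i) * z ^ i * w ^ (d - i) = w ^ d * (p (i, d - i) * (z / w) ^ i)"
      using that by (simp add: power_divide)
  qed
  have "cmod \<alpha> = 1" if "\<alpha> \<in> set \<alpha>s" for \<alpha>
  proof -
    have r: "poly q \<alpha> = 0" using that by (auto simp: q_eq prod_list_zero_iff)
    show ?thesis
    proof (cases "cmod \<alpha> \<le> 1")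
      case True
      then show ?thesis using zero[of \<alpha> 1] scale[of 1 \<alpha>] r by simp
    next
      case False
      then have "1 < cmod \<alpha>" by simp
      then have "cmod (1 / \<alpha>) < 1" "\<alpha> \<noteq> 0" by (auto simp: norm_divide divide_less_eq_1)
      then show ?thesis using zero[of 1 "1 / \<alpha>"] scale[of "1 / \<alpha>" 1] r by simp
    qed
  qed
  moreover have "peval p z w = p (d, 0) * (\<Prod>\<alpha>\<leftarrow>\<alpha>s. z - \<alpha> * w)" for z w
  proof -
    have len: "length \<alpha>s = d" using A(1) deg \<alpha>s by simp
    show ?thesis
    proof (cases "w = 0")
      case True
      have "(\<Prod>\<alpha>\<leftarrow>\<alpha>s. z) = z ^ d" using len by (simp add: map_replicate_const)
      then show ?thesis by (simp add: True w0)
    next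
      case False
      have "w ^ length l * (\<Prod>\<alpha>\<leftarrow>l. z / w - \<alpha>) = (\<Prod>\<alpha>\<leftarrow>l. z - \<alpha> * w)" for l :: "complex list"
      proof (induction l)
        case (Cons a l)
        have "w ^ length (a # l) * (\<Prod>\<alpha>\<leftarrow>a # l. z / w - \<alpha>) =
            (w * (z / w - a)) * (w ^ length l * (\<Prod>\<alpha>\<leftarrow>l. z / w - \<alpha>))"
          by (simp add: mult_ac)
        also have "w * (z / w - a) = z - a * w" using False by (simp add: field_simps)
        finally show ?case by (simp add: Cons)
      qed simp
      from this[of \<alpha>s] show ?thesis
        by (simp add: scale[OF False] q_eq len mult.left_commute)
    qed
  qed
  ultimately show ?thesis using c by blast
qed

lemma blaschke_prod_list: "blaschke c as z = c * (\<Prod>a\<leftarrow>as. (z - a) / (1 - cnj a * z))"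
proof -
  have eq: "(\<Prod>i<length as. f (as ! i)) = (\<Prod>a\<leftarrow>as. f a)" for f :: "complex \<Rightarrow> complex"
    by (induction as) (simp_all add: prod.lessThan_Suc_shift del: prod.lessThan_Suc)
  show ?thesis
    by (simp only: blaschke_def eq[of "\<lambda>a. (z - a) / (1 - cnj a * z)"])
qed

section \<open>Submodules\<close>

lemma mult_op_in:
  assumes S: "csubspace S" and Z: "\<And>x. x \<in> S \<Longrightarrow> Zop x \<in> S" and W: "\<And>x. x \<in> S \<Longrightarrow> Wop x \<in> S"
    and x: "x \<in> S"
  shows "pmul_op p x \<in> S"
proof -
  have W: "(Wop ^^ j) x \<in> S" for j by (induction j) (auto simp: x W)
  have "(Zop ^^ i) ((Wop ^^ j) x) \<in> S" for i j by (induction i) (auto simp: W Z)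
  then show ?thesis
    unfolding pmul_op_def mult_op_def
    by (intro subspace_sum csubspace_subspace[OF S] csubspace_scaleC[OF S])
qed

lemma csubspace_imp_submodule:
  assumes S: "csubspace S" and Z: "\<And>x. x \<in> S \<Longrightarrow> Zop x \<in> S" and W: "\<And>x. x \<in> S \<Longrightarrow> Wop x \<in> S"
  shows "submodule (rep_h2 ` S)"
  unfolding submodule_def
proof (intro conjI ballI)
  show "closed_subspace (rep_h2 ` S)"
    by (rule csubspace_imp_closed_subspace[OF S])
  fix p f assume p: "p \<in> poly2" and "f \<in> rep_h2 ` S"
  then obtain x where "x \<in> S" "f = rep_h2 x" by blast
  then show "pmul p f \<in> rep_h2 ` S"
    using mult_op_in[OF S Z W] by (simp add: pmul_rep[OF p])
qed

lemma submodule_imp_csubspace: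
  assumes M: "submodule M"
  obtains S where "M = rep_h2 ` S" "csubspace S" "\<And>x. x \<in> S \<Longrightarrow> Zop x \<in> S" "\<And>x. x \<in> S \<Longrightarrow> Wop x \<in> S"
proof
  have K: "closed_subspace M" and inv: "\<And>p f. p \<in> poly2 \<Longrightarrow> f \<in> M \<Longrightarrow> pmul p f \<in> M"
    using M by (auto simp: submodule_def)
  show "M = rep_h2 ` {x. rep_h2 x \<in> M}" "csubspace {x. rep_h2 x \<in> M}"
    using closed_subspace_imp_csubspace[OF K] by auto
  fix x assume x: "x \<in> {x. rep_h2 x \<in> M}"
  show "Zop x \<in> {x. rep_h2 x \<in> M}"
    using inv[OF monomials_poly2(1), of "rep_h2 x"] x pmul_rep[OF monomials_poly2(1), of x]
    by (simp add: pmul_op_mono)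
  show "Wop x \<in> {x. rep_h2 x \<in> M}"
    using inv[OF monomials_poly2(2), of "rep_h2 x"] x pmul_rep[OF monomials_poly2(2), of x]
    by (simp add: pmul_op_mono)
qed

text \<open>The y whose monomial multiples are all orthogonal to x form a closed subspace stable
  under both shifts. It contains the generators, hence the whole module and x itself, and x is
  orthogonal to x.\<close>

lemma gen_submodule_total:
  assumes S: "csubspace S" and Z: "\<And>x. x \<in> S \<Longrightarrow> Zop x \<in> S" and W: "\<And>x. x \<in> S \<Longrightarrow> Wop x \<in> S"
    and gen: "rep_h2 ` S = gen_submodule (rep_h2 ` F)"
    and x: "x \<in> S" "\<And>i j f c. f \<in> F \<Longrightarrow> inner (c *\<^sub>C (Zop ^^ i) ((Wop ^^ j) f)) x = 0"
  shows "x = 0"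
proof -
  define T where "T = {y. \<forall>c i j. inner (c *\<^sub>C (Zop ^^ i) ((Wop ^^ j) y)) x = 0}"
  have lin: "cop (\<lambda>y. c *\<^sub>C (Zop ^^ i) ((Wop ^^ j) y))" for c i j
    by (rule cop_scale[OF cop_compose[OF cop_funpow[OF bidisc.Z] cop_funpow[OF bidisc.W]]])
  have T_eq: "T = ocomp (range (\<lambda>(c, i, j). adjoint (\<lambda>y. c *\<^sub>C (Zop ^^ i) ((Wop ^^ j) y)) x))"
    by (simp add: set_eq_iff T_def ocomp_def inner_adjoint_left[OF cop_bounded_linear[OF lin]]
        inner_commute[of x])
  have T: "csubspace T"
    unfolding csubspace_def
  proof (intro conjI allI ballI)
    show "subspace T" "closed T" by (simp_all add: T_eq subspace_ocomp closed_ocomp)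
    show "c *\<^sub>C y \<in> T" if "y \<in> T" for c y
      using that by (simp add: T_def cop_scaleC[OF cop_funpow[OF bidisc.Z]] cop_scaleC[OF cop_funpow[OF bidisc.W]])
  qed
  have TZ: "Zop y \<in> T" if "y \<in> T" for y
  proof -
    have "(Zop ^^ i) ((Wop ^^ j) (Zop y)) = (Zop ^^ Suc i) ((Wop ^^ j) y)" for i j
      using funpow_commute[of Zop Wop j y] bidisc.ZW by (simp add: funpow_swap1)
    then show ?thesis using that by (simp add: T_def del: funpow.simps)
  qed
  have TW: "Wop y \<in> T" if "y \<in> T" for y
  proof -
    have "(Zop ^^ i) ((Wop ^^ j) (Wop y)) = (Zop ^^ i) ((Wop ^^ Suc j) y)" for i j
      by (simp add: funpow_swap1)
    then show ?thesis using that by (simp add: T_def del: funpow.simps)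
  qed
  have ST: "csubspace (S \<inter> T)"
    using S T by (auto simp: csubspace_def intro: subspace_inter)
  have "rep_h2 ` F \<subseteq> rep_h2 ` S"
    unfolding gen by (auto simp: gen_submodule_def)
  then have "F \<subseteq> S" by (auto simp: rep_h2_inject)
  then have "rep_h2 ` F \<subseteq> rep_h2 ` (S \<inter> T)"
    using x(2) by (auto simp: T_def)
  moreover have "submodule (rep_h2 ` (S \<inter> T))"
    by (rule csubspace_imp_submodule[OF ST]) (auto simp: Z W TZ TW)
  ultimately have "rep_h2 ` S \<subseteq> rep_h2 ` (S \<inter> T)"
    unfolding gen gen_submodule_def by blast
  then have "x \<in> T" using x(1) by (auto simp: rep_h2_inject)
  then have "inner (1 *\<^sub>C (Zop ^^ 0) ((Wop ^^ 0) x)) x = 0"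
    unfolding T_def by blast
  then show ?thesis by simp
qed

lemma monomials_total:
  assumes "\<And>c i j. inner (c *\<^sub>C (Zop ^^ i) ((Wop ^^ j) one_h2)) y = 0"
  shows "y = 0"
proof (rule rep_h2_eqI)
  fix m n
  have rep: "rep_h2 (c *\<^sub>C (Zop ^^ m) ((Wop ^^ n) one_h2)) k = (if k = (m, n) then c else 0)" for c k
    by (cases k) (auto simp: rep_Zop_funpow rep_Wop_funpow rep_one)
  have "h2inner (rep_h2 (c *\<^sub>C (Zop ^^ m) ((Wop ^^ n) one_h2))) (rep_h2 y) = c * cnj (rep_h2 y (m, n))" for c
  proof -
    have "h2inner (rep_h2 (c *\<^sub>C (Zop ^^ m) ((Wop ^^ n) one_h2))) (rep_h2 y) =
        (\<Sum>\<^sub>\<infinity>k\<in>{(m, n)}. c * cnj (rep_h2 y k))"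
      unfolding h2inner_def by (rule infsum_cong_neutral) (auto simp: rep simp del: rep_scaleC split: if_splits)
    then show ?thesis by simp
  qed
  from this[of "rep_h2 y (m, n)"] have "Re (rep_h2 y (m, n) * cnj (rep_h2 y (m, n))) = 0"
    using assms[of "rep_h2 y (m, n)" m n] by (simp add: inner_h2_def del: rep_scaleC)
  then have "(cmod (rep_h2 y (m, n)))\<^sup>2 = 0"
    by (simp flip: complex_norm_square)
  then show "rep_h2 y (m, n) = rep_h2 0 (m, n)" by simp
qed

section \<open>The quotient module\<close>

lemma Sop_rep:
  assumes N: "csubspace N" and f: "f \<in> poly2"
  shows "Sop f (rep_h2 ` N) (rep_h2 x) = rep_h2 (oproj N (pmul_op f x))"
  by (simp add: Sop_def pmul_rep[OF f] proj_rep[OF N])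

context
  fixes S :: "h2 set"
  assumes S: "csubspace S" and SZ: "\<And>x. x \<in> S \<Longrightarrow> Zop x \<in> S" and SW: "\<And>x. x \<in> S \<Longrightarrow> Wop x \<in> S"
    and eZ: "ess_unitary_on Zop (ocomp S)" and eW: "ess_unitary_on Wop (ocomp S)"
begin

private abbreviation "N \<equiv> ocomp S"

private lemma N: "csubspace N" "subspace N" "closed N"
  using csubspace_ocomp'[OF S] by (auto simp: csubspace_def)

private lemma adj_comp: "adjoint (compression S (pmul_op f)) = compression S (adjoint (pmul_op f))"
  by (rule bidisc.adjoint_compression[OF S _ _ eZ eW])
    (simp_all add: SZ SW cop_bounded_linear[OF cop_pmul_op])

private lemma adj_Sop:
  assumes f: "f \<in> poly2"
  shows "adj (rep_h2 ` N) (Sop f (rep_h2 ` N)) (rep_h2 y) = rep_h2 (adjoint (compression S (pmul_op f)) y)"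
    and "x \<in> N \<Longrightarrow> Sop f (rep_h2 ` N) (rep_h2 x) = rep_h2 (compression S (pmul_op f) x)"
proof -
  show 1: "Sop f (rep_h2 ` N) (rep_h2 x) = rep_h2 (compression S (pmul_op f) x)" if "x \<in> N" for x
  proof -
    have "oproj N x = x" using that oproj_eq_iff[OF N(2,3)] by blast
    then show ?thesis by (simp add: Sop_rep[OF N(1) f] compression_def)
  qed
  have B: "cop (compression S (pmul_op f))"
    by (rule bidisc.cop_compression[OF S SZ SW eZ eW cop_pmul_op])
  have "oproj N (adjoint (compression S (pmul_op f)) y) = adjoint (compression S (pmul_op f)) y"
    unfolding adj_comp by (simp add: compression_def oproj_idem[OF N(2,3)])
  then show "adj (rep_h2 ` N) (Sop f (rep_h2 ` N)) (rep_h2 y) = rep_h2 (adjoint (compression S (pmul_op f)) y)"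
    using adj_rep[where A = "Sop f (rep_h2 ` N)", OF N(1) B 1] by simp
qed

private lemma cop_comp: "cop (compression S (pmul_op f))" "cop (adjoint (compression S (pmul_op f)))"
  using bidisc.cop_compression[OF S SZ SW eZ eW cop_pmul_op] cop_adjoint by blast+

private lemma comp_in: "compression S A x \<in> N"
  by (simp add: compression_def oproj_in[OF N(2,3)])

private lemma adj_comp_in: "adjoint (compression S (pmul_op f)) x \<in> N"
  unfolding adj_comp by (rule comp_in)

lemma ess_normal_rep: "ess_normal (orth (rep_h2 ` S))"
  unfolding ess_normal_def orth_rep[OF S]
proof (intro ballI)
  fix f g assume f: "f \<in> poly2" and g: "g \<in> poly2"
  let ?A = "compression S (pmul_op f)" and ?B = "compression S (pmul_op g)"
  have d: "decay 2 (\<lambda>x. adjoint ?A (?B x) - ?B (adjoint ?A x))"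
    using bidisc.ess_commute_mult_op[OF S SZ SW eZ eW] unfolding pmul_op_def ess_commute_def by blast
  show "macaev (rep_h2 ` N) (\<lambda>x. adj (rep_h2 ` N) (Sop f (rep_h2 ` N)) (Sop g (rep_h2 ` N) x) -
      Sop g (rep_h2 ` N) (adj (rep_h2 ` N) (Sop f (rep_h2 ` N)) x))"
  proof (rule macaev_decay[OF N(1) _ d])
    show "cop (\<lambda>x. adjoint ?A (?B x) - ?B (adjoint ?A x))"
      by (rule cop_minus_op[OF cop_compose[OF cop_comp(2,1)] cop_compose[OF cop_comp(1,2)]])
    show "adjoint ?A (?B x) - ?B (adjoint ?A x) \<in> N" for x
      by (rule subspace_diff[OF N(2) adj_comp_in comp_in])
    show "adj (rep_h2 ` N) (Sop f (rep_h2 ` N)) (Sop g (rep_h2 ` N) (rep_h2 x)) -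
        Sop g (rep_h2 ` N) (adj (rep_h2 ` N) (Sop f (rep_h2 ` N)) (rep_h2 x)) =
        rep_h2 (adjoint ?A (?B x) - ?B (adjoint ?A x))" if "x \<in> N" for x
      by (simp add: adj_Sop[OF f] adj_Sop(2)[OF g] that adj_comp_in)
  qed
qed

lemma ess_unitary_rep_aux:
  assumes f: "f \<in> poly2" and Y: "pmul_op f = Y" "\<And>x. x \<in> S \<Longrightarrow> Y x \<in> S" "ess_unitary_on Y N"
  shows "ess_unitary (orth (rep_h2 ` S)) (Sop f (orth (rep_h2 ` S)))"
proof -
  let ?A = "compression S Y"
  note A = cop_comp[of f, unfolded Y(1)] and Ain = adj_comp_in[of f, unfolded Y(1)]
    and adj = adj_Sop[OF f, unfolded Y(1)]
  have Yc: "cop Y" using cop_pmul_op[of f] Y(1) by simp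
  note Qc = cop_oproj[OF N(1)]
  have A': "adjoint ?A x = oproj N (adjoint Y (oproj N x))" for x
    unfolding adj_comp[of f, unfolded Y(1)] by (simp add: compression_def)
  have 1: "oproj N x - adjoint ?A (?A x) = oproj N x - oproj N (adjoint Y (oproj N (Y (oproj N x))))" for x
    by (simp add: A') (simp add: compression_def oproj_idem[OF N(2,3)])
  have 2: "oproj N x - ?A (adjoint ?A x) = oproj N (defect Y (oproj N x))" for x
    using bidisc.compression_mult[OF S SZ SW eZ eW Yc Y(2), of "adjoint Y (oproj N x)"]
    by (simp add: A' defect_def cop_diff[OF Qc] oproj_idem[OF N(2,3)]) (simp add: compression_def oproj_idem[OF N(2,3)])
  have d: "decay 2 (\<lambda>x. oproj N x - adjoint ?A (?A x))" "decay 2 (\<lambda>x. oproj N x - ?A (adjoint ?A x))"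
    unfolding 1 2 using Y(3) by (simp_all add: ess_unitary_on_def)
  have Px: "oproj N x = x" if "x \<in> N" for x using that oproj_eq_iff[OF N(2,3)] by simp
  show ?thesis
    unfolding ess_unitary_def orth_rep[OF S]
  proof
    show "macaev (rep_h2 ` N) (\<lambda>x. x - adj (rep_h2 ` N) (Sop f (rep_h2 ` N)) (Sop f (rep_h2 ` N) x))"
      by (rule macaev_decay[OF N(1) cop_minus_op[OF Qc cop_compose[OF A(2,1)]] d(1)
            subspace_diff[OF N(2) oproj_in[OF N(2,3)] Ain]]) (simp add: adj Px)
    show "macaev (rep_h2 ` N) (\<lambda>x. x - Sop f (rep_h2 ` N) (adj (rep_h2 ` N) (Sop f (rep_h2 ` N)) x))"
      by (rule macaev_decay[OF N(1) cop_minus_op[OF Qc cop_compose[OF A(1,2)]] d(2)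
            subspace_diff[OF N(2) oproj_in[OF N(2,3)] comp_in]]) (simp add: adj Px Ain)
  qed
qed

lemma ess_unitary_rep:
  "ess_unitary (orth (rep_h2 ` S)) (Sop mono_z (orth (rep_h2 ` S)))"
  "ess_unitary (orth (rep_h2 ` S)) (Sop mono_w (orth (rep_h2 ` S)))"
proof -
  show "ess_unitary (orth (rep_h2 ` S)) (Sop mono_z (orth (rep_h2 ` S)))"
    by (rule ess_unitary_rep_aux[OF monomials_poly2(1) pmul_op_mono(1) SZ eZ])
  show "ess_unitary (orth (rep_h2 ` S)) (Sop mono_w (orth (rep_h2 ` S)))"
    by (rule ess_unitary_rep_aux[OF monomials_poly2(2) pmul_op_mono(2) SW eW])
qed

lemma hilbert_schmidt_core_rep: "hilbert_schmidt (rep_h2 ` S) (core (rep_h2 ` S))"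
proof -
  let ?P = "oproj S"
  have sub: "subspace S" "closed S" using S by (auto simp: csubspace_def)
  define C where "C = (\<lambda>x. ?P x - Zop (?P (adjoint Zop (?P x))) - Wop (?P (adjoint Wop (?P x)))
     + Zop (Wop (?P (adjoint Wop (adjoint Zop (?P x))))))"
  note P = cop_oproj[OF S]
  note cops = bidisc.Z bidisc.W bidisc.Z' bidisc.W' P
  have ZWc: "cop (\<lambda>x. Zop (Wop x))" by (rule cop_compose[OF bidisc.Z bidisc.W])
  have C: "cop C"
    unfolding C_def
    by (rule cop_plus[OF cop_minus_op[OF cop_minus_op[OF P
        cop_compose[OF bidisc.Z cop_compose[OF P cop_compose[OF bidisc.Z' P]]]]
        cop_compose[OF bidisc.W cop_compose[OF P cop_compose[OF bidisc.W' P]]]]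
        cop_compose[OF bidisc.Z cop_compose[OF bidisc.W cop_compose[OF P
          cop_compose[OF bidisc.W' cop_compose[OF bidisc.Z' P]]]]]])
  have dC: "decay 2 C"
    unfolding C_def by (rule bidisc.core_decay[OF S SZ SW eZ eW])
  have CS: "C x \<in> S" for x
    unfolding C_def by (intro subspace_add subspace_diff sub SZ SW oproj_in[OF sub])
  have adjR: "adj (rep_h2 ` S) (Rop f) (rep_h2 x) = rep_h2 (?P (adjoint (pmul_op f) x))" if "f \<in> poly2" for f x
    by (rule adj_rep[OF S cop_pmul_op]) (simp add: Rop_def pmul_rep[OF that])
  have R: "Rop f (rep_h2 x) = rep_h2 (pmul_op f x)" if "f \<in> poly2" for f x
    by (simp add: Rop_def pmul_rep[OF that])
  have "adjoint (\<lambda>x. Zop (Wop x)) = (\<lambda>x. adjoint Wop (adjoint Zop x))"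
    by (rule adjoint_compose[OF bidisc.bl_Z bidisc.bl_W])
  then have "core (rep_h2 ` S) (rep_h2 x) = rep_h2 (C x)" if "x \<in> S" for x
    using that oproj_eq_iff[OF sub, of x]
    by (simp add: core_def adjR R monomials_poly2 pmul_op_mono C_def)
  then show ?thesis
    by (rule hilbert_schmidt_decay[OF S C dC CS])
qed

end

theorem theorem4p4:
  fixes p :: coef and B1 B2 :: "complex \<Rightarrow> complex" and M :: "coef set"
  assumes "p \<in> poly2" and "homogeneous2 p" and "distinguished p"
    and "nonconst_fin_blaschke B1" and "nonconst_fin_blaschke B2"
    and "submodule M" and "finitely_generated M"
    and "\<exists>f\<in>M. represents f (\<lambda>z w. peval p (B1 z) (B2 w))"
  shows "(ess_unitary (orth M) (Sop mono_z (orth M)) \<and>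
          ess_unitary (orth M) (Sop mono_w (orth M)) \<and>
          hilbert_schmidt M (core M))
       \<and> ess_normal (orth M)"
proof -
  obtain c \<alpha>s where p: "c \<noteq> 0" "\<forall>\<alpha>\<in>set \<alpha>s. cmod \<alpha> = 1"
    "\<And>z w. peval p z w = c * (\<Prod>\<alpha>\<leftarrow>\<alpha>s. z - \<alpha> * w)"
    using distinguished_homogeneous_factor[OF assms(1-3)] by blast
  obtain c1 as where B1: "cmod c1 = 1" "as \<noteq> []" "\<forall>a\<in>set as. cmod a < 1" "B1 = blaschke c1 as"
    using assms(4) by (auto simp: nonconst_fin_blaschke_def)
  obtain c2 bs where B2: "cmod c2 = 1" "bs \<noteq> []" "\<forall>a\<in>set bs. cmod a < 1" "B2 = blaschke c2 bs"
    using assms(5) by (auto simp: nonconst_fin_blaschke_def)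
  interpret bp: blaschke_pair Zop Wop one_h2 c1 c2 as bs \<alpha>s
    using p(2) B1 B2 by unfold_locales auto
  obtain S where S: "M = rep_h2 ` S" "csubspace S" and SZ: "\<And>x. x \<in> S \<Longrightarrow> Zop x \<in> S"
    and SW: "\<And>x. x \<in> S \<Longrightarrow> Wop x \<in> S"
    using submodule_imp_csubspace[OF assms(6)] by metis
  obtain F' where F': "finite F'" "F' \<subseteq> H2" "M = gen_submodule F'"
    using assms(7) by (auto simp: finitely_generated_def)
  define F where "F = Abs_h2 ` F'"
  have F: "finite F" "rep_h2 ` F = F'"
    using F'(1,2) by (auto simp: F_def image_image Abs_h2_inverse subset_iff)
  have "F' \<subseteq> M" unfolding F'(3) by (auto simp: gen_submodule_def)
  then have FS: "F \<subseteq> S"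
    unfolding S(1) F(2)[symmetric] by (auto simp: rep_h2_inject)
  have gen: "x = 0" if "x \<in> S" "\<And>i j f c. f \<in> F \<Longrightarrow> inner (c *\<^sub>C (Zop ^^ i) ((Wop ^^ j) f)) x = 0" for x
  proof (rule gen_submodule_total[OF S(2) SZ SW _ that(1)])
    show "rep_h2 ` S = gen_submodule (rep_h2 ` F)"
      using F'(3) S(1) F(2) by simp
  qed (use that(2) in auto)
  \<comment> \<open>The given representative of p_B and c times G applied to 1 have the same values
    on the bidisc, so they coincide, and c can be inverted.\<close>
  have G1: "bp.G one_h2 \<in> S"
  proof -
    obtain x where x: "x \<in> S" "represents (rep_h2 x) (\<lambda>z w. peval p (B1 z) (B2 w))"
      using assms(8) S(1) by blast
    have "eval_h2 z w (x - c *\<^sub>C bp.G one_h2) = 0" if zw: "cmod z < 1" "cmod w < 1" for z w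
    proof -
      note ev = eval_diff[OF zw] eval_scaleC[OF zw]
      have U: "eval_h2 z w (bp.U y) = B1 z * eval_h2 z w y" for y
        using eval_blop[OF bidisc.Z bidisc.iso_Z B1(3), of "eval_h2 z w" z y] ev eval_Zop[OF zw] zw
        by (simp add: bp.U_def B1(4) blaschke_prod_list)
      have V: "eval_h2 z w (bp.V y) = B2 w * eval_h2 z w y" for y
        using eval_blop[OF bidisc.W bidisc.iso_W B2(3), of "eval_h2 z w" w y] ev eval_Wop[OF zw] zw
        by (simp add: bp.V_def B2(4) blaschke_prod_list)
      have "eval_h2 z w (gprod bp.U bp.V l y) = (\<Prod>\<alpha>\<leftarrow>l. B1 z - \<alpha> * B2 w) * eval_h2 z w y" for l y
        by (induction l) (simp_all add: ev U V algebra_simps)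
      then have "eval_h2 z w (c *\<^sub>C bp.G one_h2) = peval p (B1 z) (B2 w)"
        by (simp add: ev eval_one[OF zw] p(3))
      moreover have "eval_h2 z w x = peval p (B1 z) (B2 w)"
        using x(2) zw has_sum_unique[OF has_sum_eval[OF zw, of x]] by (simp add: represents_def)
      ultimately show ?thesis by (simp add: ev)
    qed
    then have "x = c *\<^sub>C bp.G one_h2"
      using eval_eq_0_imp[of "x - c *\<^sub>C bp.G one_h2"] by simp
    then have "bp.G one_h2 = inverse c *\<^sub>C x" using p(1) by simp
    then show ?thesis using csubspace_scaleC[OF S(2) x(1)] by simp
  qed
  \<comment> \<open>G commutes with the shifts, so it sends every monomial into \<open>S\<close>.
    The preimage of \<open>S\<close> under G is a closed subspace and the monomials are total, so it
    is the whole space.\<close>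
  have GS: "range bp.G \<subseteq> S"
  proof -
    define T where "T = {y. bp.G y \<in> S}"
    note G = bp.cop_G
    have "closed T"
      unfolding T_def using csubspace_closed[OF S(2)] linear_continuous_on[OF cop_bounded_linear[OF G]]
      by (metis closed_vimage vimage_def continuous_on_eq_continuous_at open_UNIV)
    then have T: "subspace T" "closed T"
      using csubspace_subspace[OF S(2)] by (auto simp: T_def subspace_def cop_simps[OF G])
    have mono: "c *\<^sub>C (Zop ^^ i) ((Wop ^^ j) one_h2) \<in> T" for c i j
    proof -
      have j: "(Wop ^^ j) (bp.G one_h2) \<in> S" by (induction j) (auto simp: G1 SW)
      have "(Zop ^^ i) ((Wop ^^ j) (bp.G one_h2)) \<in> S" by (induction i) (auto simp: j SZ)
      moreover have "bp.G ((Zop ^^ i) ((Wop ^^ j) one_h2)) = (Zop ^^ i) ((Wop ^^ j) (bp.G one_h2))"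
        using funpow_commute[of bp.G Zop i] funpow_commute[of bp.G Wop j] bp.ZG bp.WG by simp
      ultimately show ?thesis
        using csubspace_scaleC[OF S(2)] by (simp add: T_def cop_scaleC[OF G])
    qed
    have "y \<in> T" for y
    proof -
      have "y - oproj T y = 0"
        using oproj_orth[OF T mono, of y] by (intro monomials_total) (simp add: inner_commute)
      then show ?thesis using oproj_in[OF T, of y] by simp
    qed
    then show ?thesis by (auto simp: T_def)
  qed
  note eu = bp.ess_unitary_on_ZW[OF S(2) SZ SW F(1) FS gen GS]
  show ?thesis
    unfolding S(1)
    using ess_unitary_rep[OF S(2) SZ SW eu] hilbert_schmidt_core_rep[OF S(2) SZ SW eu]
      ess_normal_rep[OF S(2) SZ SW eu] by blast
qed

end
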